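(* Let $N\ge 2$, $\alpha\in(0,2)$, $C_1,C_2\ge 1$. There exist constants $\varepsilon,\eta\in(0,1)$ depending only on $C_1,C_2,N,\alpha$ such that the following holds. Let $E\subset\mathbb{R}^N$ be a bounded domain, let $\mu=(\mu(x,\cdot))_{x\in\mathbb{R}^N}$ be a family of Borel measures on $\mathbb{R}^N$ which is symmetric, satisfies the Poincaré inequality in $E$ with constant $C_1$, and satisfies the decay estimate with constant $C_2$. Let $B_R(x_0)\subset E$ and let $u$ be a local weak super-solution of $\mathscr{L}u=0$ in $E$ such that $u\ge0$ in $B_R(x_0)$. Then, for any $0<r<R/32$, $$\inf_{B_{2r}(x_0)}u\ \ge\ \eta\left(\frac{1}{|B_r(x_0)|}\int_{B_r(x_0)}u^{\varepsilon}\,dx\right)^{\frac1\varepsilon}-\left(\frac rR\right)^\alpha\mathrm{Tail}(u_-;x_0,\tfrac78R,R).$$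
   Context: $B_r(x_0)$ is the ball of radius $r$ centred at $x_0$ in $\mathbb{R}^N$; $E\subset\mathbb{R}^N$ is a bounded domain; $\alpha\in(0,2)$; $u_-=\max\{-u,0\}$. A set is $\mu$-measurable if it is $\mu(x,dy)$-measurable for all $x\in\mathbb{R}^N$. The operator is $\mathscr{L}u(x)=\text{p.v.}\int_{\mathbb{R}^N}(u(x)-u(y))\,\mu(x,dy)$, understood weakly as below. Symmetric: for all disjoint $\mu$-measurable sets $\Omega_1,\Omega_2$, the functions $x\mapsto\int_{\Omega_i}\mu(x,dy)$, $i=1,2$, are Lebesgue measurable and $\int_{\Omega_1}\int_{\Omega_2}\mu(x,dy)dx=\int_{\Omega_2}\int_{\Omega_1}\mu(x,dy)dx$. For open $D\subseteq\mathbb{R}^N$ put $\mathcal{E}_D^\mu(u,\varphi)=\int_D\int_D(u(y)-u(x))(\varphi(y)-\varphi(x))\,\mu(x,dy)dx$ and $\mathcal{E}^\mu=\mathcal{E}^\mu_{\mathbb{R}^N}$. $H^\mu_{\rm loc}(E)$ is the set of functions $u$ such that, for every open $D$ with $\overline{D}\subseteq E$, $u\in L^2(D)$ and $\mathcal{E}_D^\mu(u,u)<\infty$. $H^\mu(\mathbb{R}^N)$ is the space of $u\in L^2(\mathbb{R}^N)$ with $\mathcal{E}^\mu(u,u)<\infty$. Poincaré inequality in $E$ with constant $C_1$: for every ball $B_\rho(x_0)\subset E$ and every $v\in H^\mu_{\rm loc}(E)$, $\int_{B_\rho(x_0)}(v-[v]_{B_\rho(x_0)})^2dx\le C_1\rho^\alpha\mathcal{E}^\mu_{B_\rho(x_0)}(v,v)$,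 where $[v]_{B}$ is the average of $v$ over $B$. Decay estimate with constant $C_2$: for every $x_0\in\mathbb{R}^N$, $r>0$, $\int_{\mathbb{R}^N\setminus B_r(x_0)}\mu(x_0,dy)\le C_2r^{-\alpha}$. Local weak super-solution of $\mathscr{L}u=0$ in $E$: a Lebesgue measurable $u:\mathbb{R}^N\to\mathbb{R}$ with $u\in H^\mu_{\rm loc}(E)$, $\sup_{x\in B_{\frac78R}(x_0)}\int_{\mathbb{R}^N\setminus B_R(x_0)}|u(y)|\,\mu(x,dy)<\infty$ for every $B_R(x_0)\subset E$, and $\mathcal{E}^\mu(u,\varphi)\ge0$ for every non-negative $\varphi\in H^\mu(\mathbb{R}^N)$ with $\operatorname{supp}\varphi\subseteq E$. Tail: $\mathrm{Tail}(u;x_0,r_1,r_2)=r_2^\alpha\sup_{x\in B_{r_1}(x_0)}\int_{\mathbb{R}^N\setminus B_{r_2}(x_0)}u(y)\,\mu(x,dy)$. The infimum of $u$ over a ball is the essential infimum (Lebesgue measure). *)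

theory Defs
  imports "HOL-Analysis.Analysis" "HOL-Probability.Essential_Supremum"
begin

text \<open>
  A family of Borel measures on Euclidean space is a function \<open>\<mu> :: 'a \<Rightarrow> 'a measure\<close> with
  \<open>sets (\<mu> x) = sets borel\<close> for every \<open>x\<close>; the measures \<open>\<mu> x\<close> may have infinite mass near \<open>x\<close>.

  The functions \<open>u\<close> integrated against \<open>\<mu> x\<close> are only Lebesgue measurable, hence the integrals are
  taken with respect to \<open>completion (\<mu> x)\<close>.  If the family is symmetric, then a Lebesgue null set
  is a null set of \<open>completion (\<mu> x)\<close> for almost every \<open>x\<close>, so a Lebesgue measurable function
  is \<open>completion (\<mu> x)\<close>-measurable for almost every \<open>x\<close>.
\<close>

definition mu_measurable :: "('a \<Rightarrow> 'a measure) \<Rightarrow> 'a set \<Rightarrow> bool" where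
  "mu_measurable \<mu> \<Omega> \<longleftrightarrow> (\<forall>x. \<Omega> \<in> sets (\<mu> x))"

definition symmetric_family :: "('a::euclidean_space \<Rightarrow> 'a measure) \<Rightarrow> bool" where
  "symmetric_family \<mu> \<longleftrightarrow>
     (\<forall>\<Omega>1 \<Omega>2. mu_measurable \<mu> \<Omega>1 \<longrightarrow> mu_measurable \<mu> \<Omega>2 \<longrightarrow> \<Omega>1 \<inter> \<Omega>2 = {} \<longrightarrow>
        (\<lambda>x. emeasure (\<mu> x) \<Omega>1) \<in> borel_measurable lebesgue \<and>
        (\<lambda>x. emeasure (\<mu> x) \<Omega>2) \<in> borel_measurable lebesgue \<and>
        (\<integral>\<^sup>+x\<in>\<Omega>1. emeasure (\<mu> x) \<Omega>2 \<partial>lebesgue) = (\<integral>\<^sup>+x\<in>\<Omega>2. emeasure (\<mu> x) \<Omega>1 \<partial>lebesgue))"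

text \<open>
  The bilinear form is an iterated Bochner integral.  It is used for a super-solution \<open>u\<close> and a
  test function \<open>\<phi>\<close> supported in \<open>E\<close>, where the double integral converges absolutely.
  The quadratic form is \<open>[0, \<infinity>]\<close>-valued.
\<close>

definition bilinear_form ::
    "('a::euclidean_space \<Rightarrow> 'a measure) \<Rightarrow> 'a set \<Rightarrow> ('a \<Rightarrow> real) \<Rightarrow> ('a \<Rightarrow> real) \<Rightarrow> real" where
  "bilinear_form \<mu> D u \<phi> =
     (LINT x:D|lebesgue. (LINT y:D|completion (\<mu> x). (u y - u x) * (\<phi> y - \<phi> x)))"

definition quadratic_form ::
    "('a::euclidean_space \<Rightarrow> 'a measure) \<Rightarrow> 'a set \<Rightarrow> ('a \<Rightarrow> real) \<Rightarrow> ennreal" where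
  "quadratic_form \<mu> D u =
     (\<integral>\<^sup>+x\<in>D. (\<integral>\<^sup>+y\<in>D. ennreal ((u y - u x)\<^sup>2) \<partial>completion (\<mu> x)) \<partial>lebesgue)"

definition L2 :: "'a::euclidean_space set \<Rightarrow> ('a \<Rightarrow> real) set" where
  "L2 D = {u. u \<in> borel_measurable (lebesgue_on D) \<and> integrable (lebesgue_on D) (\<lambda>x. (u x)\<^sup>2)}"

definition H_loc :: "('a::euclidean_space \<Rightarrow> 'a measure) \<Rightarrow> 'a set \<Rightarrow> ('a \<Rightarrow> real) set" where
  "H_loc \<mu> E = {u. \<forall>D. open D \<longrightarrow> closure D \<subseteq> E \<longrightarrow> u \<in> L2 D \<and> quadratic_form \<mu> D u < \<infinity>}"

definition H_space :: "('a::euclidean_space \<Rightarrow> 'a measure) \<Rightarrow> ('a \<Rightarrow> real) set" where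
  "H_space \<mu> = {u. u \<in> L2 UNIV \<and> quadratic_form \<mu> UNIV u < \<infinity>}"

definition average :: "'a::euclidean_space set \<Rightarrow> ('a \<Rightarrow> real) \<Rightarrow> real" where
  "average B v = (LINT x:B|lebesgue. v x) / measure lebesgue B"

text \<open>
  A ball contained in \<open>E\<close> may touch the boundary of \<open>E\<close>; there \<open>v\<close> need not be integrable and the
  quadratic form may be infinite.  If the quadratic form over the ball is finite, the inequality on
  the smaller concentric balls already forces \<open>v\<close> to be square integrable on the ball.
\<close>

definition poincare_inequality ::
    "real \<Rightarrow> ('a::euclidean_space \<Rightarrow> 'a measure) \<Rightarrow> 'a set \<Rightarrow> real \<Rightarrow> bool" where
  "poincare_inequality \<alpha> \<mu> E C \<longleftrightarrow>
     (\<forall>x0 \<rho>. \<forall>v\<in>H_loc \<mu> E. 0 < \<rho> \<longrightarrow> ball x0 \<rho> \<subseteq> E \<longrightarrow>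
        (\<integral>\<^sup>+x\<in>ball x0 \<rho>. ennreal ((v x - average (ball x0 \<rho>) v)\<^sup>2) \<partial>lebesgue)
          \<le> ennreal (C * \<rho> powr \<alpha>) * quadratic_form \<mu> (ball x0 \<rho>) v)"

definition decay_estimate :: "real \<Rightarrow> ('a::euclidean_space \<Rightarrow> 'a measure) \<Rightarrow> real \<Rightarrow> bool" where
  "decay_estimate \<alpha> \<mu> C \<longleftrightarrow>
     (\<forall>x0 r. 0 < r \<longrightarrow> emeasure (\<mu> x0) (- ball x0 r) \<le> ennreal (C * r powr (- \<alpha>)))"

definition local_weak_supersolution ::
    "('a::euclidean_space \<Rightarrow> 'a measure) \<Rightarrow> 'a set \<Rightarrow> ('a \<Rightarrow> real) \<Rightarrow> bool" where
  "local_weak_supersolution \<mu> E u \<longleftrightarrow>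
     u \<in> borel_measurable lebesgue \<and>
     u \<in> H_loc \<mu> E \<and>
     (\<forall>x0 R. 0 < R \<longrightarrow> ball x0 R \<subseteq> E \<longrightarrow>
        (SUP x\<in>ball x0 (7 / 8 * R). \<integral>\<^sup>+y\<in>- ball x0 R. ennreal \<bar>u y\<bar> \<partial>completion (\<mu> x)) < \<infinity>) \<and>
     (\<forall>\<phi>\<in>H_space \<mu>. (\<forall>x. 0 \<le> \<phi> x) \<longrightarrow> closure {x. \<phi> x \<noteq> 0} \<subseteq> E \<longrightarrow>
        0 \<le> bilinear_form \<mu> UNIV u \<phi>)"

text \<open>The tail is defined for non-negative functions \<open>f\<close>, with values in \<open>[0, \<infinity>]\<close>.\<close>

definition Tail ::
    "real \<Rightarrow> ('a::euclidean_space \<Rightarrow> 'a measure) \<Rightarrow> ('a \<Rightarrow> real) \<Rightarrow> 'a \<Rightarrow> real \<Rightarrow> real \<Rightarrow> ennreal" where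
  "Tail \<alpha> \<mu> f x0 r1 r2 =
     ennreal (r2 powr \<alpha>) *
       (SUP x\<in>ball x0 r1. \<integral>\<^sup>+y\<in>- ball x0 r2. ennreal (f y) \<partial>completion (\<mu> x))"

definition ess_inf :: "'a::euclidean_space set \<Rightarrow> ('a \<Rightarrow> real) \<Rightarrow> ereal" where
  "ess_inf B u = - esssup (lebesgue_on B) (\<lambda>x. - ereal (u x))"

end

theory Submission
  imports Defs "HOL-Probability.Giry_Monad"
begin

text \<open>
  Put \<open>v = u + d\<close>, where \<open>d\<close> slightly exceeds \<open>(r/R) powr \<alpha>\<close> times the tail, so that \<open>d\<close> absorbs the
  negative part of \<open>u\<close> outside the large ball.  Testing with \<open>\<eta>\<^sup>2 g(v)\<close> gives an energy estimate for
  three choices of \<open>g\<close>.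
  For \<open>g(a) = 4/a\<close>, Poincare's inequality bounds the oscillation of \<open>ln v\<close> on every ball; let
  \<open>c\<close> be the approximating constant on the ball of radius \<open>4 r\<close>.
  For \<open>g(a) = 16 q\<^sup>2 a powr (2 q - 1)\<close> with small \<open>q\<close>, a covering by balls of radius \<open>s\<close> bounds the
  integral of \<open>v powr (2 q)\<close> over a ball by a quarter of the integral over the ball enlarged by
  \<open>2 s\<close>, plus a term controlled by the logarithmic oscillation; iteration with \<open>s = r/4, r/8, \<dots>\<close> bounds
  the mean of \<open>v powr (2 q)\<close> by a multiple of \<open>exp (2 q c)\<close> and takes the place of the
  John--Nirenberg lemma.
  For \<open>g(a) = max (l - a) 0\<close>, a De Giorgi iteration, started from the measure of \<open>{v < exp (c - \<lambda>)}\<close>,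
  which is small by the logarithmic estimate, gives \<open>v \<ge> exp (c - \<lambda>) / 2\<close> on the ball of radius \<open>2 r\<close>.
\<close>

subsection \<open>The jump measure off the diagonal\<close>

text \<open>No Sobolev inequality is available: \<open>\<mu> x\<close> may lack a density, and
  coercivity enters only through Poincare's inequality on balls. Being scale invariant, the latter
  is applied on many small balls and summed with bounded overlap; knowing a function to be small on
  half of each ball disposes of the mean values. Two competitions of rates decide the constants. The
  threshold for \<open>v powr q\<close> on balls of radius \<open>r / 2 ^ m\<close> follows the
  constants approximating \<open>ln v\<close>, which drift by at most \<open>\<Lambda>\<close> per
  halving; \<open>exp (2 * q * \<Lambda>) \<le> 2\<close> keeps its growth below what the
  contraction 1/4 can absorb. In the De Giorgi iteration the small radii shrink faster than the
  collars, and \<open>\<tau>\<close> is tuned so that the resulting gain balances the shrinking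
  level gaps. The other obstacle is measurability. Symmetry is given on pairs of disjoint sets only,
  so Fubini-type statements are first proved on separated rectangles, where the jump rate is
  bounded. Symmetry also makes Lebesgue null sets invisible to \<open>\<mu> x\<close> for almost
  every \<open>x\<close>, which allows a Borel representative of \<open>u\<close>.\<close>

lemma indicator_pair_split: "indicator (A \<times> B) (x, y) = (indicator A x * indicator B y :: 'b::semiring_1)"
  by (simp add: indicator_def)

locale nonlocal_kernel =
  fixes \<mu> :: "'a::euclidean_space \<Rightarrow> 'a measure" and \<alpha> C2 :: real
  assumes sets_mu[measurable_cong]: "\<And>x. sets (\<mu> x) = sets borel"
    and sym: "symmetric_family \<mu>"
    and decay: "decay_estimate \<alpha> \<mu> C2"
    and \<alpha>_pos: "0 < \<alpha>" and \<alpha>_less_2: "\<alpha> < 2" and C2_ge_1: "1 \<le> C2"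
begin

lemma space_mu[simp]: "space (\<mu> x) = UNIV"
  using sets_eq_imp_space_eq[OF sets_mu] by simp

lemma mu_measurable_borel: "A \<in> sets borel \<Longrightarrow> mu_measurable \<mu> A"
  by (simp add: mu_measurable_def sets_mu)

lemma measurable_emeasure_mu: "A \<in> sets borel \<Longrightarrow> (\<lambda>x. emeasure (\<mu> x) A) \<in> borel_measurable lebesgue"
  using sym[unfolded symmetric_family_def, rule_format, of A "{}"] mu_measurable_borel by auto

lemma symmetric_rect:
  assumes "A \<in> sets borel" "B \<in> sets borel" "A \<inter> B = {}"
  shows "(\<integral>\<^sup>+x\<in>A. emeasure (\<mu> x) B \<partial>lebesgue) = (\<integral>\<^sup>+x\<in>B. emeasure (\<mu> x) A \<partial>lebesgue)"
  using sym[unfolded symmetric_family_def, rule_format, of A B] mu_measurable_borel assms by auto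

lemma decay_ball: "0 < r \<Longrightarrow> emeasure (\<mu> x) (- ball x r) \<le> ennreal (C2 * r powr (- \<alpha>))"
  using decay unfolding decay_estimate_def by auto

lemma decay_far:
  assumes "0 < r" "\<And>y. y \<in> A \<Longrightarrow> r \<le> dist x y"
  shows "emeasure (\<mu> x) A \<le> ennreal (C2 * r powr (- \<alpha>))"
proof -
  have "emeasure (\<mu> x) A \<le> emeasure (\<mu> x) (- ball x r)"
    using assms(2) by (intro emeasure_mono) (force simp: sets_mu)+
  with decay_ball[OF assms(1)] show ?thesis by (rule order_trans[rotated])
qed

text \<open>
  The normalisation by \<open>c\<close> turns the restriction of the kernel to a separated rectangle into a
  sub-probability kernel, to which the measurability theorems of the Giry monad apply.
\<close>

definition rect_kernel :: "real \<Rightarrow> 'a set \<Rightarrow> 'a set \<Rightarrow> 'a \<Rightarrow> 'a measure" where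
  "rect_kernel c U W x =
     (if x \<in> U then scale_measure (ennreal (1 / c)) (density (\<mu> x) (indicator W)) else null_measure borel)"

lemma sets_rect_kernel[simp, measurable_cong]: "sets (rect_kernel c U W x) = sets borel"
  by (simp add: rect_kernel_def sets_mu)

lemma measurable_Pair_rect_kernel[simp]: "Pair z \<in> rect_kernel c U W x \<rightarrow>\<^sub>M borel \<Otimes>\<^sub>M borel"
  by (subst measurable_cong_sets[OF sets_rect_kernel refl]) (rule measurable_Pair1', simp)

lemma measurable_Pair_rect_kernel'[simp]: "(\<lambda>y. (y, z)) \<in> rect_kernel c U W x \<rightarrow>\<^sub>M borel \<Otimes>\<^sub>M borel"
  by (subst measurable_cong_sets[OF sets_rect_kernel refl]) (rule measurable_Pair2', simp)

lemma rect_kernel_emeasure: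
  assumes [measurable]: "A \<in> sets borel" "W \<in> sets borel"
  shows "emeasure (rect_kernel c U W x) A = ennreal (1/c) * emeasure (\<mu> x) (W \<inter> A) * indicator U x"
proof -
  have "emeasure (density (\<mu> x) (indicator W)) A = emeasure (\<mu> x) (W \<inter> A)"
    by (subst emeasure_density) (auto simp: sets_mu simp flip: indicator_inter_arith)
  then show ?thesis
    by (simp add: rect_kernel_def)
qed

lemma rect_kernel_measurable:
  assumes c: "0 < c" and [measurable]: "U \<in> sets borel" "W \<in> sets borel"
    and bd: "\<And>x. x \<in> U \<Longrightarrow> emeasure (\<mu> x) W \<le> ennreal c"
  shows "rect_kernel c U W \<in> measurable lebesgue (subprob_algebra borel)"
proof (rule measurable_subprob_algebra)
  fix x
  show "subprob_space (rect_kernel c U W x)"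
  proof (rule subprob_spaceI)
    have "emeasure (rect_kernel c U W x) UNIV \<le> 1"
    proof (cases "x \<in> U")
      case True
      have "ennreal (1/c) * emeasure (\<mu> x) W \<le> ennreal (1/c) * ennreal c"
        by (intro mult_left_mono bd True) auto
      also have "\<dots> = 1" using c by (simp flip: ennreal_mult)
      finally show ?thesis by (simp add: rect_kernel_emeasure True)
    qed (simp add: rect_kernel_emeasure)
    then show "emeasure (rect_kernel c U W x) (space (rect_kernel c U W x)) \<le> 1"
      using sets_eq_imp_space_eq[OF sets_rect_kernel] by simp
    show "space (rect_kernel c U W x) \<noteq> {}"
      using sets_eq_imp_space_eq[OF sets_rect_kernel] by simp
  qed
  show "sets (rect_kernel c U W x) = sets borel" by simp
next
  fix A :: "'a set" assume [measurable]: "A \<in> sets borel"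
  have [measurable]: "(\<lambda>x. emeasure (\<mu> x) (W \<inter> A)) \<in> borel_measurable lebesgue"
    by (rule measurable_emeasure_mu) simp
  have [measurable]: "U \<in> sets lebesgue" by simp
  show "(\<lambda>a. emeasure (rect_kernel c U W a) A) \<in> borel_measurable lebesgue"
    by (simp add: rect_kernel_emeasure)
qed

lemma nn_integral_rect_kernel:
  assumes c: "0 < c" and [measurable]: "W \<in> sets borel" "f \<in> borel_measurable borel"
  shows "(\<integral>\<^sup>+y. f y * indicator W y \<partial>\<mu> x) * indicator U x = ennreal c * (\<integral>\<^sup>+y. f y \<partial>rect_kernel c U W x)"
proof (cases "x \<in> U")
  case True
  have "(\<integral>\<^sup>+y. f y \<partial>rect_kernel c U W x) = ennreal (1/c) * (\<integral>\<^sup>+y. indicator W y * f y \<partial>\<mu> x)"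
    using True by (simp add: rect_kernel_def nn_integral_scale_measure nn_integral_density)
  moreover have "ennreal c * ennreal (1/c) = 1" using c by (simp flip: ennreal_mult)
  ultimately show ?thesis using True by (simp add: mult.assoc[symmetric] mult.commute)
qed (simp add: rect_kernel_def)

lemma borel_pair_generator:
  "sets (borel \<Otimes>\<^sub>M borel :: ('a \<times> 'a) measure) = sigma_sets UNIV {A \<times> B | A B. A \<in> sets borel \<and> B \<in> sets borel}"
  using sets_pair_measure[of "borel :: 'a measure" "borel :: 'a measure"] by simp

lemma id_measurable_lebesgue_pair: "id \<in> (lebesgue \<Otimes>\<^sub>M (borel :: 'a measure)) \<rightarrow>\<^sub>M (borel \<Otimes>\<^sub>M borel)"
proof -
  have "(\<lambda>z. (fst z, snd z)) \<in> (lebesgue \<Otimes>\<^sub>M (borel :: 'a measure)) \<rightarrow>\<^sub>M (borel \<Otimes>\<^sub>M borel)"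
    by (intro measurable_Pair measurable_compose[OF measurable_fst] measurable_snd)
       (auto intro: measurable_completion)
  then show ?thesis by (simp add: id_def)
qed

lemma measurable_Pair_lebesgue:
  "f \<in> borel_measurable (borel \<Otimes>\<^sub>M borel) \<Longrightarrow> f \<in> borel_measurable (lebesgue \<Otimes>\<^sub>M (borel :: 'a measure))"
  using measurable_comp[OF id_measurable_lebesgue_pair] by simp

text \<open>Each iterated integral is an integral against a measure on the product space. The two
  measures agree on rectangles by symmetry, rectangles form an intersection-stable generator, and
  the total mass is finite because \<open>U\<close> is bounded and the decay estimate bounds the
  jump rate across the gap \<open>d\<close>. Uniqueness of measures then extends the symmetry to
  every Borel kernel.\<close>

lemma kernel_rect:
  fixes k :: "'a \<times> 'a \<Rightarrow> ennreal"
  assumes d: "0 < d" and U[measurable]: "U \<in> sets borel" and W[measurable]: "W \<in> sets borel"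
    and bU: "bounded U" and sep: "\<And>x y. x \<in> U \<Longrightarrow> y \<in> W \<Longrightarrow> d \<le> dist x y"
    and k[measurable]: "k \<in> borel_measurable (borel \<Otimes>\<^sub>M borel)"
  shows "(\<lambda>x. \<integral>\<^sup>+y. k (x, y) * indicator (U \<times> W) (x, y) \<partial>\<mu> x) \<in> borel_measurable lebesgue" (is ?meas)
    and "(\<integral>\<^sup>+x. \<integral>\<^sup>+y. k (x, y) * indicator (U \<times> W) (x, y) \<partial>\<mu> x \<partial>lebesgue) =
         (\<integral>\<^sup>+y. \<integral>\<^sup>+x. k (x, y) * indicator (U \<times> W) (x, y) \<partial>\<mu> y \<partial>lebesgue)" (is ?sym)
proof -
  define c where "c = C2 * d powr (- \<alpha>)"
  have c: "0 < c" using C2_ge_1 d by (simp add: c_def)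
  have bd1: "emeasure (\<mu> x) W \<le> ennreal c" if "x \<in> U" for x
    unfolding c_def using d sep that by (intro decay_far) auto
  have bd2: "emeasure (\<mu> y) U \<le> ennreal c" if "y \<in> W" for y
    unfolding c_def using d sep that by (intro decay_far) (auto simp: dist_commute)
  note K1 = rect_kernel_measurable[OF c U W bd1]
  note K2 = rect_kernel_measurable[OF c W U bd2]
  have ke1: "(\<integral>\<^sup>+y. k (x, y) * indicator (U \<times> W) (x, y) \<partial>\<mu> x) =
      ennreal c * (\<integral>\<^sup>+y. k (x, y) \<partial>rect_kernel c U W x)" (is "?l x = ?r x")
    if [measurable]: "k \<in> borel_measurable (borel \<Otimes>\<^sub>M borel)" for k :: "'a \<times> 'a \<Rightarrow> ennreal" and x
  proof -
    have "?l x = (\<integral>\<^sup>+y. k (x, y) * indicator W y \<partial>\<mu> x) * indicator U x"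
      by (cases "x \<in> U") (simp_all add: indicator_pair_split)
    also have "\<dots> = ?r x" by (rule nn_integral_rect_kernel) (use c in auto)
    finally show ?thesis .
  qed
  have ke2: "(\<integral>\<^sup>+x. k (x, y) * indicator (U \<times> W) (x, y) \<partial>\<mu> y) =
      ennreal c * (\<integral>\<^sup>+x. k (x, y) \<partial>rect_kernel c W U y)" (is "?l y = ?r y")
    if [measurable]: "k \<in> borel_measurable (borel \<Otimes>\<^sub>M borel)" for k :: "'a \<times> 'a \<Rightarrow> ennreal" and y
  proof -
    have "?l y = (\<integral>\<^sup>+x. k (x, y) * indicator U x \<partial>\<mu> y) * indicator W y"
      by (cases "y \<in> W") (simp_all add: indicator_pair_split)
    also have "\<dots> = ?r y" by (rule nn_integral_rect_kernel) (use c in auto)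
    finally show ?thesis .
  qed
  have m1: "(\<lambda>x. \<integral>\<^sup>+y. k (x, y) \<partial>rect_kernel c U W x) \<in> borel_measurable lebesgue"
    if "k \<in> borel_measurable (borel \<Otimes>\<^sub>M borel)" for k :: "'a \<times> 'a \<Rightarrow> ennreal"
    by (rule nn_integral_measurable_subprob_algebra2[OF _ K1])
       (use measurable_Pair_lebesgue[OF that] in simp)
  show ?meas using m1[OF k] by (simp add: ke1)
  define P1 where "P1 x = distr (rect_kernel c U W x) (borel \<Otimes>\<^sub>M borel) (\<lambda>y. (x, y))" for x
  define P2 where "P2 y = distr (rect_kernel c W U y) (borel \<Otimes>\<^sub>M borel) (\<lambda>x. (x, y))" for y
  have [measurable]: "(\<lambda>x. x) \<in> lebesgue \<rightarrow>\<^sub>M (borel :: 'a measure)" by (auto intro: measurable_completion)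
  have P1: "P1 \<in> lebesgue \<rightarrow>\<^sub>M subprob_algebra (borel \<Otimes>\<^sub>M borel)" unfolding P1_def
    by (rule measurable_distr2[OF _ K1]) (simp add: measurable_split_conv id_measurable_lebesgue_pair flip: id_def)
  have P2: "P2 \<in> lebesgue \<rightarrow>\<^sub>M subprob_algebra (borel \<Otimes>\<^sub>M borel)" unfolding P2_def
    by (rule measurable_distr2[OF _ K2]) (simp add: measurable_split_conv id_measurable_lebesgue_pair flip: id_def)
  \<comment> \<open>The bind of the Giry monad glues a kernel to Lebesgue measure. \<open>P1\<close>
    and \<open>P2\<close> put the base point into opposite coordinates, so the symmetry becomes the
    equation \<open>m1 = m2\<close>.\<close>
  define m1 where "m1 = lebesgue \<bind> P1"
  define m2 where "m2 = lebesgue \<bind> P2"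
  have I1: "(\<integral>\<^sup>+z. k z \<partial>m1) = (\<integral>\<^sup>+x. \<integral>\<^sup>+y. k (x, y) \<partial>rect_kernel c U W x \<partial>lebesgue)"
    if [measurable]: "k \<in> borel_measurable (borel \<Otimes>\<^sub>M borel)" for k :: "'a \<times> 'a \<Rightarrow> ennreal"
    unfolding m1_def by (subst nn_integral_bind[OF _ P1]) (simp_all add: P1_def, intro nn_integral_cong, subst nn_integral_distr, simp_all)
  have I2: "(\<integral>\<^sup>+z. k z \<partial>m2) = (\<integral>\<^sup>+y. \<integral>\<^sup>+x. k (x, y) \<partial>rect_kernel c W U y \<partial>lebesgue)"
    if [measurable]: "k \<in> borel_measurable (borel \<Otimes>\<^sub>M borel)" for k :: "'a \<times> 'a \<Rightarrow> ennreal"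
    unfolding m2_def by (subst nn_integral_bind[OF _ P2]) (simp_all add: P2_def, intro nn_integral_cong, subst nn_integral_distr, simp_all)
  have sm: "sets m1 = sets (borel \<Otimes>\<^sub>M borel)" "sets m2 = sets (borel \<Otimes>\<^sub>M borel)"
    unfolding m1_def m2_def by (auto simp: sets_bind[OF sets_kernel[OF P1]] sets_bind[OF sets_kernel[OF P2]])
  have em1: "emeasure m1 (A \<times> B) = ennreal (1/c) * (\<integral>\<^sup>+x\<in>U \<inter> A. emeasure (\<mu> x) (W \<inter> B) \<partial>lebesgue)"
    if [measurable]: "A \<in> sets borel" "B \<in> sets borel" for A B
  proof -
    have [measurable]: "(\<lambda>x. emeasure (\<mu> x) (W \<inter> B)) \<in> borel_measurable lebesgue"
      by (rule measurable_emeasure_mu) simp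
    have "emeasure m1 (A \<times> B) = (\<integral>\<^sup>+z. indicator (A \<times> B) z \<partial>m1)"
      by (simp add: sm)
    also have "\<dots> = (\<integral>\<^sup>+x. \<integral>\<^sup>+y. indicator B y * indicator A x \<partial>rect_kernel c U W x \<partial>lebesgue)"
      by (subst I1) (auto simp: indicator_pair_split mult.commute)
    also have "\<dots> = (\<integral>\<^sup>+x. ennreal (1/c) * (emeasure (\<mu> x) (W \<inter> B) * indicator (U \<inter> A) x) \<partial>lebesgue)"
      by (intro nn_integral_cong, subst nn_integral_multc) (auto simp: rect_kernel_emeasure indicator_inter_arith ac_simps cong: measurable_cong_sets)
    finally show ?thesis by (subst (asm) nn_integral_cmult) auto
  qed
  have em2: "emeasure m2 (A \<times> B) = ennreal (1/c) * (\<integral>\<^sup>+y\<in>W \<inter> B. emeasure (\<mu> y) (U \<inter> A) \<partial>lebesgue)"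
    if [measurable]: "A \<in> sets borel" "B \<in> sets borel" for A B
  proof -
    have [measurable]: "(\<lambda>x. emeasure (\<mu> x) (U \<inter> A)) \<in> borel_measurable lebesgue"
      by (rule measurable_emeasure_mu) simp
    have "emeasure m2 (A \<times> B) = (\<integral>\<^sup>+z. indicator (A \<times> B) z \<partial>m2)"
      by (simp add: sm)
    also have "\<dots> = (\<integral>\<^sup>+y. \<integral>\<^sup>+x. indicator A x * indicator B y \<partial>rect_kernel c W U y \<partial>lebesgue)"
      by (subst I2) (auto simp: indicator_pair_split mult.commute)
    also have "\<dots> = (\<integral>\<^sup>+y. ennreal (1/c) * (emeasure (\<mu> y) (U \<inter> A) * indicator (W \<inter> B) y) \<partial>lebesgue)"
      by (intro nn_integral_cong, subst nn_integral_multc) (auto simp: rect_kernel_emeasure indicator_inter_arith ac_simps cong: measurable_cong_sets)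
    finally show ?thesis by (subst (asm) nn_integral_cmult) auto
  qed
  have "m1 = m2"
  proof (rule measure_eqI_generator_eq[where E="{A \<times> B | A B. A \<in> sets borel \<and> B \<in> sets borel}" and A="\<lambda>_. UNIV" and \<Omega>=UNIV])
    show "Int_stable {A \<times> B |A B. A \<in> sets (borel :: 'a measure) \<and> B \<in> sets (borel :: 'a measure)}"
      by (rule Int_stable_pair_measure_generator)
    show "emeasure m1 X = emeasure m2 X" if "X \<in> {A \<times> B |A B. A \<in> sets borel \<and> B \<in> sets borel}" for X
    proof -
      from that obtain A B where X: "X = A \<times> B" and [measurable]: "A \<in> sets borel" "B \<in> sets borel" by auto
      have "U \<inter> W = {}" using sep d by (metis disjoint_iff dist_self linorder_not_less)
      then show ?thesis unfolding X by (subst em1, simp, simp, subst em2, simp, simp, subst symmetric_rect) auto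
    qed
    show "sets m1 = sigma_sets UNIV {A \<times> B |A B. A \<in> sets borel \<and> B \<in> sets borel}"
      "sets m2 = sigma_sets UNIV {A \<times> B |A B. A \<in> sets borel \<and> B \<in> sets borel}"
      by (simp_all add: sm borel_pair_generator)
    show "range (\<lambda>_. UNIV) \<subseteq> {A \<times> B |A B. A \<in> sets (borel :: 'a measure) \<and> B \<in> sets (borel :: 'a measure)}"
      by (auto intro!: exI[of _ UNIV])
    have "(\<integral>\<^sup>+x\<in>U. emeasure (\<mu> x) W \<partial>lebesgue) \<le> (\<integral>\<^sup>+x\<in>U. ennreal c \<partial>lebesgue)"
      using bd1 by (intro nn_integral_mono) (auto simp: indicator_def)
    also have "\<dots> = ennreal c * emeasure lborel U"
      by (subst nn_integral_cmult_indicator) auto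
    also have "\<dots> < \<infinity>"
      using emeasure_bounded_finite[OF bU] by (auto simp: ennreal_mult_less_top)
    finally have "emeasure m1 (UNIV \<times> UNIV) \<noteq> \<infinity>"
      by (subst em1) (auto simp: ennreal_mult_eq_top_iff)
    then show "emeasure m1 UNIV \<noteq> \<infinity>" by (simp add: UNIV_Times_UNIV)
  qed auto
  have "(\<lambda>y. \<integral>\<^sup>+x. k (x, y) \<partial>rect_kernel c W U y) \<in> borel_measurable lebesgue"
    by (rule nn_integral_measurable_subprob_algebra2[OF _ K2])
       (use measurable_Pair_lebesgue[of "\<lambda>(x, y). k (y, x)"] in simp)
  then show ?sym
    by (simp add: ke1 ke2 nn_integral_cmult m1 flip: I1 I2 \<open>m1 = m2\<close>)
qed

end

text \<open>A countable dense set supplies the centres. Two balls of radius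
  \<open>h = 1 / (n + 1)\<close> whose centres are more than \<open>3 * h\<close> apart have
  distance at least \<open>h\<close>, which serves as \<open>d\<close>, and such pairs reach every
  point off the diagonal.\<close>

lemma offdiagonal_cover:
  obtains U W :: "nat \<Rightarrow> 'a::euclidean_space set" and d :: "nat \<Rightarrow> real" where
    "\<And>i. open (U i)" "\<And>i. open (W i)" "\<And>i. bounded (U i)" "\<And>i. bounded (W i)" "\<And>i. 0 < d i"
    "\<And>i x y. x \<in> U i \<Longrightarrow> y \<in> W i \<Longrightarrow> d i \<le> dist x y"
    "\<And>x y. x \<noteq> y \<Longrightarrow> \<exists>i. x \<in> U i \<and> y \<in> W i"
proof -
  obtain D :: "'a set" where D: "countable D" "\<And>X. open X \<Longrightarrow> X \<noteq> {} \<Longrightarrow> \<exists>d\<in>D. d \<in> X"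
    using countable_dense_exists by metis
  define J where "J = {(p, q, n). p \<in> D \<and> q \<in> D \<and> dist p q > 3 / (real n + 1)}"
  have J: "countable J"
    by (rule countable_subset[of _ "D \<times> D \<times> UNIV"]) (auto simp: J_def D)
  have cover: "\<exists>p q n. (p, q, n) \<in> J \<and> x \<in> ball p (1 / (real n + 1)) \<and> y \<in> ball q (1 / (real n + 1))"
    if "x \<noteq> y" for x y
  proof -
    \<comment> \<open>The 5 is 3 + 2: replacing \<open>x\<close> and \<open>y\<close> by dense
      points within \<open>h\<close> costs \<open>2 * h\<close>, and more than \<open>3 * h\<close>
      must remain.\<close>
    obtain n where n: "5 / dist x y < real n" using reals_Archimedean2 by blast
    have pos: "0 < dist x y" using that by simp
    define h where "h = 1 / (real n + 1)"
    have h: "0 < h" "5 * h < dist x y"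
      using n pos by (auto simp: h_def field_simps add_pos_pos intro: order.strict_trans)
    obtain p where p: "p \<in> D" "p \<in> ball x h" using D(2)[of "ball x h"] h by auto
    obtain q where q: "q \<in> D" "q \<in> ball y h" using D(2)[of "ball y h"] h by auto
    have "dist x y \<le> dist x p + dist p q + dist q y"
      by (meson add_mono dist_triangle order_refl order_trans)
    then have "3 * h < dist p q" using p q h by (auto simp: dist_commute)
    then show ?thesis using p q
      by (intro exI[of _ p] exI[of _ q] exI[of _ n]) (auto simp: J_def h_def dist_commute)
  qed
  have "J \<noteq> {}"
  proof -
    have "\<exists>b::'a. b \<noteq> 0" using nonzero_Basis SOME_Basis by blast
    then show ?thesis using cover by blast
  qed
  define e where "e = from_nat_into J"
  define U where "U i = (case e i of (p, q, n) \<Rightarrow> ball p (1 / (real n + 1)))" for i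
  define W where "W i = (case e i of (p, q, n) \<Rightarrow> ball q (1 / (real n + 1)))" for i
  define d where "d i = (case e i of (p, q, n) \<Rightarrow> 1 / (real n + 1))" for i
  have sep: "d i \<le> dist x y" if "x \<in> U i" "y \<in> W i" for i x y
  proof -
    obtain p q n where e: "e i = (p, q, n)" by (cases "e i") auto
    have "e i \<in> J" unfolding e_def by (rule from_nat_into) fact
    then have "dist p q > 3 * (1 / (real n + 1))" by (simp add: e J_def)
    moreover have "dist p q \<le> dist p x + dist x y + dist y q"
      by (meson add_mono dist_triangle order_refl order_trans)
    ultimately show ?thesis using that by (auto simp: U_def W_def d_def e dist_commute)
  qed
  have "\<exists>i. x \<in> U i \<and> y \<in> W i" if neq: "x \<noteq> y" for x y
  proof -
    obtain p q n where j: "(p, q, n) \<in> J" "x \<in> ball p (1 / (real n + 1))" "y \<in> ball q (1 / (real n + 1))"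
      using cover[OF neq] by blast
    obtain i where "e i = (p, q, n)"
      using from_nat_into_surj[OF J j(1)] by (auto simp: e_def)
    then show ?thesis using j by (intro exI[of _ i]) (auto simp: U_def W_def)
  qed
  moreover have "open (U i)" "open (W i)" "bounded (U i)" "bounded (W i)" "0 < d i" for i
    by (auto simp: U_def W_def d_def split: prod.splits)
  ultimately show ?thesis using sep by (intro that[of U W d])
qed

text \<open>
  Only kernels vanishing on the diagonal are admitted: \<open>\<mu> x\<close> may have infinite mass near \<open>x\<close> and
  even at \<open>x\<close>, and symmetry says nothing about the diagonal.
\<close>

definition offdiag_measurable :: "('a::euclidean_space \<Rightarrow> 'a \<Rightarrow> ennreal) \<Rightarrow> bool" where
  "offdiag_measurable k \<longleftrightarrow> (\<lambda>(x, y). k x y) \<in> borel_measurable (borel \<Otimes>\<^sub>M borel) \<and> (\<forall>x. k x x = 0)"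

lemma offdiag_measurableI:
  "(\<lambda>(x, y). k x y) \<in> borel_measurable (borel \<Otimes>\<^sub>M borel) \<Longrightarrow> (\<And>x. k x x = 0) \<Longrightarrow> offdiag_measurable k"
  by (simp add: offdiag_measurable_def)

lemma offdiag_measurable_slice: "offdiag_measurable k \<Longrightarrow> k x \<in> borel_measurable borel"
  unfolding offdiag_measurable_def by (auto dest: measurable_Pair2)

lemma offdiag_measurable_add:
  "offdiag_measurable k \<Longrightarrow> offdiag_measurable l \<Longrightarrow> offdiag_measurable (\<lambda>x y. k x y + l x y)"
  unfolding offdiag_measurable_def by (auto simp: split_def)

lemma offdiag_measurable_cmult:
  "offdiag_measurable k \<Longrightarrow> offdiag_measurable (\<lambda>x y. c * k x y)"
  unfolding offdiag_measurable_def by (auto simp: split_def)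

lemma offdiag_measurable_swap:
  "offdiag_measurable k \<Longrightarrow> offdiag_measurable (\<lambda>x y. k y x)"
  unfolding offdiag_measurable_def using measurable_pair_swap[of "\<lambda>(x, y). k x y" borel borel]
  by (auto simp: split_def)

section \<open>Double integrals against the jump measure\<close>

context nonlocal_kernel
begin

definition double_integral :: "('a \<Rightarrow> 'a \<Rightarrow> ennreal) \<Rightarrow> ennreal" where
  "double_integral k = (\<integral>\<^sup>+x. \<integral>\<^sup>+y. k x y \<partial>\<mu> x \<partial>lebesgue)"

lemma slice_measurable_mu: "offdiag_measurable k \<Longrightarrow> k x \<in> borel_measurable (\<mu> z)"
  using offdiag_measurable_slice by (simp add: measurable_cong_sets[OF sets_mu refl])

lemma
  assumes k: "offdiag_measurable k"
  shows inner_integral_measurable: "(\<lambda>x. \<integral>\<^sup>+y. k x y \<partial>\<mu> x) \<in> borel_measurable lebesgue"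
    and double_integral_swap: "double_integral (\<lambda>x y. k y x) = double_integral k"
proof -
  obtain U W :: "nat \<Rightarrow> 'a set" and d where
    o: "\<And>i. open (U i)" "\<And>i. open (W i)" and bd: "\<And>i. bounded (U i)" "\<And>i. bounded (W i)" "\<And>i. 0 < d i"
    and sep: "\<And>i x y. x \<in> U i \<Longrightarrow> y \<in> W i \<Longrightarrow> d i \<le> dist x y"
    and cover: "\<And>x y. x \<noteq> y \<Longrightarrow> \<exists>i. x \<in> U i \<and> y \<in> W i"
    by (rule offdiagonal_cover) blast
  have [measurable]: "U i \<in> sets borel" "W i \<in> sets borel" for i using o by auto
  define kk where "kk = (\<lambda>(x, y). k x y)"
  have kk[measurable]: "kk \<in> borel_measurable (borel \<Otimes>\<^sub>M borel)" and k0: "k x x = 0" for x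
    using k by (auto simp: kk_def offdiag_measurable_def)
  \<comment> \<open>Disjointing the rectangles makes the pieces of the kernel add up exactly, while
    each piece stays supported in its own \<open>U i \<times> W i\<close>, where
    \<open>kernel_rect\<close> applies.\<close>
  define D where "D = disjointed (\<lambda>i. U i \<times> W i)"
  have sD[measurable]: "D i \<in> sets (borel \<Otimes>\<^sub>M borel)" for i
  proof -
    have "range (\<lambda>i. U i \<times> W i) \<subseteq> sets (borel \<Otimes>\<^sub>M borel)"
      by (intro image_subsetI pair_measureI) auto
    from sets.range_disjointed_sets[OF this] show ?thesis by (auto simp: D_def)
  qed
  define g where "g i z = kk z * indicator (D i) z" for i z
  have g[measurable]: "g i \<in> borel_measurable (borel \<Otimes>\<^sub>M borel)" for i
    unfolding g_def by measurable
  have gi: "g i z * indicator (U i \<times> W i) z = g i z" for i z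
    using disjointed_subset[of "\<lambda>i. U i \<times> W i" i] by (auto simp: g_def D_def indicator_def)
  have disjD: "disjoint_family D"
    unfolding D_def by (rule disjoint_family_disjointed)
  \<comment> \<open>The rectangles miss the diagonal; the expansion holds there because
    \<open>k x x = 0\<close>.\<close>
  have ksum: "k x y = (\<Sum>i. g i (x, y))" for x y
  proof (cases "x = y")
    case True
    then show ?thesis by (simp add: g_def kk_def k0)
  next
    case False
    then have "(x, y) \<in> (\<Union>i. D i)"
      unfolding D_def UN_disjointed_eq using cover by auto
    then have "(\<Sum>i. indicator (D i) (x, y)) = (1 :: ennreal)"
      by (simp add: suminf_indicator[OF disjD])
    then show ?thesis by (simp add: g_def kk_def)
  qed
  have m: "(\<lambda>x. \<integral>\<^sup>+y. g i (x, y) \<partial>\<mu> x) \<in> borel_measurable lebesgue" for i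
    using kernel_rect(1)[of "d i" "U i" "W i" "g i"] bd sep by (simp add: gi)
  have [measurable]: "(\<lambda>y. g i (x, y)) \<in> borel_measurable (\<mu> z)" "(\<lambda>y. g i (y, x)) \<in> borel_measurable (\<mu> z)" for i x z
    using measurable_Pair1[OF g] measurable_Pair2[OF g] by (simp_all add: measurable_cong_sets[OF sets_mu refl])
  have s: "(\<integral>\<^sup>+x. \<integral>\<^sup>+y. g i (x, y) \<partial>\<mu> x \<partial>lebesgue) = (\<integral>\<^sup>+y. \<integral>\<^sup>+x. g i (x, y) \<partial>\<mu> y \<partial>lebesgue)" for i
    using kernel_rect(2)[of "d i" "U i" "W i" "g i"] bd sep by (simp add: gi)
  have sep': "\<And>x y. x \<in> W i \<Longrightarrow> y \<in> U i \<Longrightarrow> d i \<le> dist x y" for i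
    using sep by (metis dist_commute)
  have m': "(\<lambda>y. \<integral>\<^sup>+x. g i (x, y) \<partial>\<mu> y) \<in> borel_measurable lebesgue" for i
  proof -
    have "(\<lambda>(x, y). g i (y, x)) \<in> borel_measurable (borel \<Otimes>\<^sub>M borel)"
      by (simp add: split_def)
    moreover have "g i (y, x) * indicator (W i \<times> U i) (x, y) = g i (y, x)" for x y
      using gi[of i "(y, x)"] by (auto simp: indicator_def split: if_splits)
    ultimately show ?thesis
      using kernel_rect(1)[of "d i" "W i" "U i" "\<lambda>(x, y). g i (y, x)"] bd sep' by simp
  qed
  show "(\<lambda>x. \<integral>\<^sup>+y. k x y \<partial>\<mu> x) \<in> borel_measurable lebesgue"
    using m by (simp add: ksum nn_integral_suminf)
  show "double_integral (\<lambda>x y. k y x) = double_integral k"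
    using m m' s by (simp add: double_integral_def ksum nn_integral_suminf)
qed

lemma double_integral_add:
  assumes k: "offdiag_measurable k" and l: "offdiag_measurable l"
  shows "double_integral (\<lambda>x y. k x y + l x y) = double_integral k + double_integral l"
  unfolding double_integral_def
  by (simp add: nn_integral_add slice_measurable_mu inner_integral_measurable k l)

lemma double_integral_cmult:
  assumes k: "offdiag_measurable k"
  shows "double_integral (\<lambda>x y. c * k x y) = c * double_integral k"
  unfolding double_integral_def
  by (simp add: nn_integral_cmult slice_measurable_mu inner_integral_measurable k)

lemma double_integral_sum:
  assumes k: "\<And>i. i \<in> I \<Longrightarrow> offdiag_measurable (k i)"
  shows "double_integral (\<lambda>x y. \<Sum>i\<in>I. k i x y) = (\<Sum>i\<in>I. double_integral (k i))"
  unfolding double_integral_def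
  by (simp add: nn_integral_sum slice_measurable_mu inner_integral_measurable k)

lemma double_integral_mono:
  "(\<And>x y. k x y \<le> l x y) \<Longrightarrow> double_integral k \<le> double_integral l"
  unfolding double_integral_def by (intro nn_integral_mono) auto

lemma double_integral_mono_AE:
  "(AE x in lebesgue. (\<integral>\<^sup>+y. k x y \<partial>\<mu> x) \<le> b x) \<Longrightarrow> double_integral k \<le> (\<integral>\<^sup>+x. b x \<partial>lebesgue)"
  unfolding double_integral_def by (intro nn_integral_mono_AE) auto

end

subsection \<open>Admissible test functions\<close>

lemma lipschitz_half_line:
  fixes f :: "real \<Rightarrow> real"
  assumes der: "\<And>x. d \<le> x \<Longrightarrow> (f has_real_derivative f' x) (at x)"
    and bd: "\<And>x. d \<le> x \<Longrightarrow> \<bar>f' x\<bar> \<le> L" and xy: "d \<le> x" "d \<le> y"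
  shows "\<bar>f x - f y\<bar> \<le> L * \<bar>x - y\<bar>"
  using xy
proof (induction x y rule: linorder_wlog)
  case (le a b)
  show ?case
  proof (cases "a = b")
    case False
    with le have "a < b" by simp
    then obtain z where z: "a < z" "z < b" "f b - f a = (b - a) * f' z"
      using MVT2[of a b f f'] der le by auto
    have "\<bar>f b - f a\<bar> = \<bar>b - a\<bar> * \<bar>f' z\<bar>" by (simp add: z(3) abs_mult)
    also have "\<dots> \<le> \<bar>b - a\<bar> * L" using z le by (intro mult_left_mono bd) auto
    finally show ?thesis by (simp add: abs_minus_commute mult.commute)
  qed simp
next
  case (sym a b)
  then show ?case by (simp add: abs_minus_commute)
qed

text \<open>
  Testing with \<open>\<eta>\<^sup>2 g(v)\<close>, where \<open>v \<ge> d\<close>, bounds the energy of \<open>\<Phi>(v)\<close> by the integral of \<open>k(v)\<close>;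
  the variables \<open>a\<close>, \<open>b\<close> stand for two values of \<open>v\<close> and \<open>s\<close>, \<open>t\<close> for the values of the cutoff \<open>\<eta>\<close>.
\<close>

definition admissible_test :: "real \<Rightarrow> (real \<Rightarrow> real) \<Rightarrow> (real \<Rightarrow> real) \<Rightarrow> (real \<Rightarrow> real) \<Rightarrow> bool" where
  "admissible_test d g \<Phi> k \<longleftrightarrow>
     g \<in> borel_measurable borel \<and> \<Phi> \<in> borel_measurable borel \<and> k \<in> borel_measurable borel \<and>
     (\<exists>L. \<forall>a\<ge>d. g a \<le> L \<and> (\<forall>b\<ge>d. \<bar>g a - g b\<bar> \<le> L * \<bar>a - b\<bar> \<and> \<bar>\<Phi> a - \<Phi> b\<bar> \<le> L * \<bar>a - b\<bar>)) \<and>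
     (\<forall>a\<ge>d. 0 \<le> g a \<and> g a * a \<le> k a) \<and>
     (\<forall>a\<ge>d. \<forall>b\<ge>d. \<forall>s\<in>{0..1}. \<forall>t\<in>{0..1}.
        (b - a) * (t\<^sup>2 * g b - s\<^sup>2 * g a) + (if s = 1 \<and> t = 1 then (\<Phi> a - \<Phi> b)\<^sup>2 else 0)
          \<le> (k a + k b) * (s - t)\<^sup>2)"

section \<open>The logarithmic test function\<close>

lemma ln_sq_le:
  fixes x :: real assumes "1 \<le> x" shows "(ln x)\<^sup>2 * x \<le> 4 * (x - 1)\<^sup>2"
proof -
  \<comment> \<open>The square root gives \<open>ln x = 2 * ln y \<le> 2 * (y - 1)\<close>, and
    \<open>x = y\<^sup>2 \<le> (y + 1)\<^sup>2\<close> supplies the factor that completes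
    \<open>(x - 1)\<^sup>2 = (y - 1)\<^sup>2 * (y + 1)\<^sup>2\<close>.\<close>
  define y where "y = sqrt x"
  have y: "1 \<le> y" "x = y\<^sup>2" using assms by (auto simp: y_def)
  have "ln x = 2 * ln y" using y by (simp add: ln_realpow)
  also have "\<dots> \<le> 2 * (y - 1)" using ln_le_minus_one[of y] y by simp
  finally have "(ln x)\<^sup>2 \<le> (2 * (y - 1))\<^sup>2" using assms by (intro power_mono) auto
  then have "(ln x)\<^sup>2 * x \<le> (2 * (y - 1))\<^sup>2 * x" using assms by (intro mult_right_mono) auto
  also have "\<dots> \<le> (2 * (y - 1))\<^sup>2 * (y + 1)\<^sup>2"
    unfolding y(2) using y by (intro mult_left_mono power_mono) auto
  also have "\<dots> = 4 * (x - 1)\<^sup>2" by (simp add: y(2) power2_eq_square algebra_simps)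
  finally show ?thesis .
qed

text \<open>The right side minus the left side is exactly
  \<open>(t * a - s * b)\<^sup>2 / (a * b)\<close>.\<close>

lemma log_test_inequality:
  fixes a b s t :: real assumes ab: "0 < a" "0 < b"
  shows "(b - a) * (t\<^sup>2 / b - s\<^sup>2 / a) \<le> (s - t)\<^sup>2"
proof -
  have "0 \<le> (t * a - s * b)\<^sup>2 / (a * b)" using ab by simp
  also have "\<dots> = t\<^sup>2 * a / b + s\<^sup>2 * b / a - 2 * s * t"
    using ab by (simp add: field_simps power2_eq_square)
  finally show ?thesis using ab by (simp add: field_simps power2_eq_square)
qed

text \<open>At \<open>s = t = 1\<close> the product in \<open>log_test_inequality\<close> equals
  \<open>- ((b - a)\<^sup>2 / (a * b))\<close>; this bound converts that negative term into
  logarithmic energy.\<close>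

lemma log_test_core:
  fixes a b :: real assumes ab: "0 < a" "0 < b"
  shows "(ln a - ln b)\<^sup>2 \<le> 4 * ((b - a)\<^sup>2 / (a * b))"
  using ab
proof (induction a b rule: linorder_wlog)
  case (le a b)
  then have "(ln (b / a))\<^sup>2 * (b / a) \<le> 4 * (b / a - 1)\<^sup>2" by (intro ln_sq_le) auto
  then have "(ln (b / a))\<^sup>2 \<le> 4 * (b / a - 1)\<^sup>2 / (b / a)" using le by (subst pos_le_divide_eq) auto
  also have "\<dots> = 4 * ((b - a)\<^sup>2 / (a * b))" using le by (simp add: field_simps power2_eq_square)
  also have "ln (b / a) = ln b - ln a" using le by (simp add: ln_div)
  finally show ?case by (simp add: power2_commute)
next
  case (sym a b)
  then show ?case by (simp add: power2_commute mult.commute)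
qed

text \<open>The 4 in \<open>4 / a\<close> is the constant of \<open>log_test_core\<close>, so that
  the product at \<open>s = t = 1\<close> pays for all of \<open>(ln a - ln b)\<^sup>2\<close>.
  Since \<open>g a * a\<close> is constant, the energy of \<open>ln v\<close> is controlled by
  volume alone.\<close>

lemma admissible_log:
  assumes d: "0 < d" shows "admissible_test d (\<lambda>a. 4 / a) ln (\<lambda>_. 4)"
proof -
  define L where "L = 4 / d\<^sup>2 + 1 / d + 4 / d"
  have "0 < 1 / d" "4 / d = 4 * (1 / d)" "0 < 4 / d\<^sup>2" using d by auto
  then have L: "4 / d\<^sup>2 \<le> L" "1 / d \<le> L" "4 / d \<le> L" unfolding L_def by linarith+
  have "\<bar>4 / a - 4 / b\<bar> \<le> L * \<bar>a - b\<bar>" if "d \<le> a" "d \<le> b" for a b :: real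
  proof (rule lipschitz_half_line[where d=d and f'="\<lambda>x. - 4 / x\<^sup>2"])
    fix x assume x: "d \<le> x"
    with d show "((\<lambda>x. 4 / x) has_real_derivative - 4 / x\<^sup>2) (at x)"
      by (auto intro!: derivative_eq_intros simp: power2_eq_square)
    have "4 / x\<^sup>2 \<le> 4 / d\<^sup>2" using x d by (intro divide_left_mono power_mono) auto
    with L show "\<bar>- 4 / x\<^sup>2\<bar> \<le> L" by simp
  qed fact+
  moreover have "\<bar>ln a - ln b\<bar> \<le> L * \<bar>a - b\<bar>" if "d \<le> a" "d \<le> b" for a b :: real
  proof (rule lipschitz_half_line[where d=d and f'="\<lambda>x. 1 / x"])
    fix x assume x: "d \<le> x"
    with d show "(ln has_real_derivative 1 / x) (at x)" by (auto intro!: derivative_eq_intros)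
    have "1 / x \<le> 1 / d" using x d by (intro divide_left_mono) auto
    with L x d show "\<bar>1 / x\<bar> \<le> L" by simp
  qed fact+
  moreover have "4 / a \<le> L" if "d \<le> a" for a
  proof -
    have "4 / a \<le> 4 / d" using that d by (intro divide_left_mono) auto
    with L show ?thesis by simp
  qed
  moreover have "(b - a) * (t\<^sup>2 * (4 / b) - s\<^sup>2 * (4 / a)) + (if s = 1 \<and> t = 1 then (ln a - ln b)\<^sup>2 else 0)
          \<le> (4 + 4) * (s - t)\<^sup>2" if "d \<le> a" "d \<le> b" for a b s t :: real
  proof -
    have ab: "0 < a" "0 < b" using that d by auto
    have e: "(b - a) * (t\<^sup>2 * (4 / b) - s\<^sup>2 * (4 / a)) = 4 * ((b - a) * (t\<^sup>2 / b - s\<^sup>2 / a))"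
      by (simp add: algebra_simps)
    show ?thesis
    proof (cases "s = 1 \<and> t = 1")
      case True
      have "(b - a) * (1 / b - 1 / a) = - ((b - a)\<^sup>2 / (a * b))"
        using ab by (simp add: field_simps power2_eq_square)
      then show ?thesis using True log_test_core[OF ab] unfolding e by simp
    next
      case False
      have "4 * ((b - a) * (t\<^sup>2 / b - s\<^sup>2 / a)) \<le> 4 * (s - t)\<^sup>2"
        by (rule mult_left_mono[OF log_test_inequality[OF ab]]) simp
      also have "\<dots> \<le> (4 + 4) * (s - t)\<^sup>2" by simp
      finally show ?thesis unfolding e if_not_P[OF False] by simp
    qed
  qed
  ultimately show ?thesis using d unfolding admissible_test_def
    by (intro conjI exI[of _ L] allI impI ballI) auto
qed

section \<open>The truncation test function\<close>

lemma truncation_test_inequality: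
  fixes a b s t K :: real
  defines "g \<equiv> \<lambda>a. max (K - a) 0"
  assumes ab: "0 < a" "0 < b"
  shows "(b - a) * (t\<^sup>2 * g b - s\<^sup>2 * g a) + (t * g b - s * g a)\<^sup>2 \<le> g a * g b * (s - t)\<^sup>2"
proof -
  \<comment> \<open>With both values below \<open>K\<close> the claim is an identity. With only one
    below, the distance between the two values exceeds the truncated one, which makes the first
    product only more negative.\<close>
  consider "K \<le> a" "K \<le> b" | "a < K" "b < K" | "a < K" "K \<le> b" | "K \<le> a" "b < K" by linarith
  then show ?thesis
  proof cases
    case 1 then show ?thesis by (simp add: g_def)
  next
    case 2
    have "b - a = g a - g b" using 2 by (simp add: g_def)
    show ?thesis unfolding \<open>b - a = g a - g b\<close> by (simp add: power2_eq_square algebra_simps)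
  next
    case 3
    then have g: "g b = 0" "g a = K - a" by (auto simp: g_def)
    have "s\<^sup>2 * (K - a) * (K - a) \<le> s\<^sup>2 * (K - a) * (b - a)"
      using 3 by (intro mult_left_mono) auto
    then show ?thesis unfolding g by (simp add: power2_eq_square algebra_simps)
  next
    case 4
    then have g: "g a = 0" "g b = K - b" by (auto simp: g_def)
    have "t\<^sup>2 * (K - b) * (K - b) \<le> t\<^sup>2 * (K - b) * (a - b)"
      using 4 by (intro mult_left_mono) auto
    then show ?thesis unfolding g by (simp add: power2_eq_square algebra_simps)
  qed
qed

text \<open>All values are at least \<open>d > 0\<close>, so \<open>g\<close> is below
  \<open>K\<close> where it is nonzero, and \<open>k\<close> may be \<open>K\<^sup>2\<close> times
  an indicator. The energy is thereby bounded by the measure of a sublevel set, the quantity that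
  the De Giorgi iteration tracks.\<close>

lemma admissible_truncation:
  assumes d: "0 < d"
  shows "admissible_test d (\<lambda>a. max (K - a) 0) (\<lambda>a. max (K - a) 0) (\<lambda>a. K\<^sup>2 * indicator {..<K} a)"
proof -
  define g where "g a = max (K - a) 0" for a
  have "g \<in> borel_measurable borel" unfolding g_def[abs_def] by measurable
  moreover have "\<bar>g a - g b\<bar> \<le> max 1 K * \<bar>a - b\<bar>" for a b
  proof -
    have "\<bar>g a - g b\<bar> \<le> 1 * \<bar>a - b\<bar>" by (auto simp: g_def)
    also have "\<dots> \<le> max 1 K * \<bar>a - b\<bar>" by (intro mult_right_mono) auto
    finally show ?thesis .
  qed
  moreover have "g a \<le> max 1 K" "0 \<le> g a" if "d \<le> a" for a
    using that d by (auto simp: g_def)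
  moreover have "g a * a \<le> K\<^sup>2 * indicator {..<K} a" if "d \<le> a" for a
    using that d by (auto simp: g_def power2_eq_square indicator_def intro!: mult_mono)
  moreover have "(b - a) * (t\<^sup>2 * g b - s\<^sup>2 * g a) + (if s = 1 \<and> t = 1 then (g a - g b)\<^sup>2 else 0)
          \<le> (K\<^sup>2 * indicator {..<K} a + K\<^sup>2 * indicator {..<K} b) * (s - t)\<^sup>2"
    if "d \<le> a" "d \<le> b" for a b s t :: real
  proof -
    have ab: "0 < a" "0 < b" using that d by auto
    have "(if s = 1 \<and> t = 1 then (g a - g b)\<^sup>2 else 0) \<le> (t * g b - s * g a)\<^sup>2"
      by (auto simp: power2_commute)
    moreover have "g a * g b \<le> K\<^sup>2 * indicator {..<K} a + K\<^sup>2 * indicator {..<K} b"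
    proof (cases "a < K \<and> b < K")
      case True
      then have "g a * g b \<le> K * K" using ab by (intro mult_mono) (auto simp: g_def)
      moreover have "K\<^sup>2 * indicator {..<K} a + K\<^sup>2 * indicator {..<K} b = K * K + K * K"
        using True by (simp add: power2_eq_square)
      ultimately show ?thesis using zero_le_square[of K] by linarith
    qed (auto simp: g_def)
    then have "g a * g b * (s - t)\<^sup>2 \<le> (K\<^sup>2 * indicator {..<K} a + K\<^sup>2 * indicator {..<K} b) * (s - t)\<^sup>2"
      by (intro mult_right_mono) auto
    ultimately show ?thesis using truncation_test_inequality[OF ab, of t K s] unfolding g_def by linarith
  qed
  ultimately have "admissible_test d g g (\<lambda>a. K\<^sup>2 * indicator {..<K} a)"
    unfolding admissible_test_def by (intro conjI exI[of _ "max 1 K"] allI impI ballI) (auto simp: g_def)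
  then show ?thesis by (simp add: g_def[abs_def])
qed

section \<open>The power test function\<close>

lemma powr_diff_sq_le:
  fixes x q :: real assumes x: "1 \<le> x" and q: "0 < q" "q \<le> 1/4"
  shows "(x powr q - 1)\<^sup>2 \<le> 16 * q\<^sup>2 * ((x - 1) * (1 - x powr (2 * q - 1)))"
proof -
  define y where "y = sqrt x"
  have y: "1 \<le> y" "x = y\<^sup>2" using x by (auto simp: y_def)
  have xy: "x powr (1/2) = y" using x by (simp add: y_def powr_half_sqrt)
  have exp_le: "exp z - 1 \<le> z * exp z" for z :: real
  proof -
    have "1 - z \<le> exp (- z)" using exp_ge_add_one_self[of "- z"] by simp
    then have "(1 - z) * exp z \<le> exp (- z) * exp z" by (intro mult_right_mono) auto
    then show ?thesis by (simp add: exp_minus algebra_simps)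
  qed
  \<comment> \<open>The source of the factor \<open>q\<^sup>2\<close>: the increment of
    \<open>x powr q\<close> is of first order in \<open>q\<close>. The remaining logarithm is
    treated by \<open>ln_sq_le\<close> at \<open>sqrt x\<close>, for which
    \<open>q \<le> 1/4\<close> gives \<open>x powr (2 * q) \<le> x powr (1/2)\<close>.\<close>
  have "x powr q - 1 \<le> q * ln x * x powr q" using x exp_le[of "q * ln x"] by (simp add: powr_def)
  then have "(x powr q - 1)\<^sup>2 \<le> (q * ln x * x powr q)\<^sup>2"
    using x q by (intro power_mono) (auto simp: ge_one_powr_ge_zero)
  also have "\<dots> = q\<^sup>2 * ((ln x)\<^sup>2 * x powr (2 * q))"
    using x by (simp add: power_mult_distrib powr_powr mult.commute flip: powr_realpow)
  also have "\<dots> \<le> q\<^sup>2 * ((ln x)\<^sup>2 * x powr (1/2))"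
    using x q by (intro mult_left_mono powr_mono) auto
  also have "\<dots> = 4 * q\<^sup>2 * ((ln y)\<^sup>2 * y)" using y by (simp add: xy ln_realpow power_mult_distrib)
  also have "\<dots> \<le> 4 * q\<^sup>2 * (4 * (y - 1)\<^sup>2)" using ln_sq_le[OF y(1)] by (intro mult_left_mono) auto
  also have "\<dots> \<le> 4 * q\<^sup>2 * (4 * ((y - 1)\<^sup>2 * ((y + 1) / y)))"
  proof -
    have "(y - 1)\<^sup>2 * 1 \<le> (y - 1)\<^sup>2 * ((y + 1) / y)" using y by (intro mult_left_mono) auto
    then show ?thesis by (intro mult_left_mono) auto
  qed
  also have "(y - 1)\<^sup>2 * ((y + 1) / y) = (x - 1) * (1 - 1 / y)"
    using y by (simp add: field_simps power2_eq_square)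
  also have "4 * q\<^sup>2 * (4 * ((x - 1) * (1 - 1 / y))) \<le> 4 * q\<^sup>2 * (4 * ((x - 1) * (1 - x powr (2 * q - 1))))"
  proof -
    have "x powr (2 * q - 1) \<le> x powr (- (1/2))" using x q by (intro powr_mono) auto
    also have "\<dots> = 1 / y" using xy by (simp add: powr_minus_divide)
    finally show ?thesis using x by (intro mult_left_mono) auto
  qed
  finally show ?thesis by simp
qed

lemma powr_test_quotient:
  fixes x q :: real assumes x: "1 < x" and q: "0 < q" "q \<le> 1/4"
  shows "(x - 1) * x powr (2 * q - 1) \<le> 2 * x powr (2 * q) * (1 - x powr (2 * q - 1))"
proof -
  define y where "y = sqrt x"
  have y: "1 < y" "x = y\<^sup>2" using x by (auto simp: y_def)
  have xy: "x powr (1/2) = y" using x by (simp add: y_def powr_half_sqrt)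
  have p: "x powr (2 * q - 1) = x powr (2 * q) / x" using x by (simp add: powr_diff)
  have "x powr (2 * q) \<le> y" using x q xy powr_mono[of "2 * q" "1/2" x] by simp
  \<comment> \<open>Here \<open>x - 1 = (y - 1) * (y + 1) \<le> 2 * y * (y - 1)\<close>.\<close>
  moreover have "x - 1 \<le> 2 * (x - y)" using y sum_squares_ge_zero[of "y - 1" 0] by (simp add: power2_eq_square algebra_simps)
  ultimately have "x - 1 \<le> 2 * (x - x powr (2 * q))" by simp
  then have "(x - 1) * (x powr (2 * q) / x) \<le> 2 * (x - x powr (2 * q)) * (x powr (2 * q) / x)"
    using x by (intro mult_right_mono) auto
  also have "\<dots> = 2 * x powr (2 * q) * (1 - x powr (2 * q) / x)" using x by (simp add: field_simps)
  finally show ?thesis by (simp add: p)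
qed

text \<open>With the increment \<open>t - s\<close> held fixed, the left side is a concave quadratic
  in \<open>s\<close>; its maximum, at \<open>s = (t - s) * B / (A - B)\<close>, is the right
  side.\<close>

lemma weighted_square_diff:
  fixes A B s t :: real assumes "0 < B" "B < A" "0 \<le> s" "s \<le> t"
  shows "t\<^sup>2 * B - s\<^sup>2 * A \<le> (t - s)\<^sup>2 * (A * B / (A - B))"
proof -
  have "0 \<le> (s * (A - B) - (t - s) * B)\<^sup>2 / (A - B)" using assms by simp
  also have "\<dots> = (t - s)\<^sup>2 * (A * B / (A - B)) - (t\<^sup>2 * B - s\<^sup>2 * A)"
    using assms by (simp add: divide_simps) (simp add: power2_eq_square algebra_simps)
  finally show ?thesis by simp
qed

text \<open>Since \<open>a powr (2 * q - 1)\<close> decreases in \<open>a\<close>, the product can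
  be positive only if the cutoff is larger at the larger value. Then
  \<open>weighted_square_diff\<close> isolates the cutoff difference, and homogeneity reduces the
  rest to the ratio \<open>b / a\<close>, where \<open>powr_test_quotient\<close> applies.\<close>

lemma powr_test_inequality:
  fixes a b s t q :: real
  assumes "0 < a" "a \<le> b" and q: "0 < q" "q \<le> 1/4" and st: "0 \<le> s" "0 \<le> t"
  shows "(b - a) * (t\<^sup>2 * b powr (2 * q - 1) - s\<^sup>2 * a powr (2 * q - 1)) \<le> 2 * b powr (2 * q) * (s - t)\<^sup>2"
proof (cases "a = b \<or> t \<le> s")
  case True
  have "b powr (2 * q - 1) \<le> a powr (2 * q - 1)" using assms by (intro powr_mono2') auto
  then have "t \<le> s \<Longrightarrow> t\<^sup>2 * b powr (2 * q - 1) \<le> s\<^sup>2 * a powr (2 * q - 1)"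
    using st by (intro mult_mono power_mono) auto
  then have "(b - a) * (t\<^sup>2 * b powr (2 * q - 1) - s\<^sup>2 * a powr (2 * q - 1)) \<le> 0"
    using assms True by (auto intro: mult_nonneg_nonpos)
  also have "0 \<le> 2 * b powr (2 * q) * (s - t)\<^sup>2" by simp
  finally show ?thesis .
next
  case False
  define A where "A = a powr (2 * q - 1)"
  define B where "B = b powr (2 * q - 1)"
  define x where "x = b / a"
  have x: "1 < x" "b = x * a" using False assms by (auto simp: x_def)
  have AB: "0 < B" "B < A" unfolding A_def B_def using False assms by (auto intro: powr_less_mono2_neg)
  have Bx: "B = x powr (2 * q - 1) * A" using x assms by (simp add: A_def B_def powr_mult)
  have "(b - a) * (A * B / (A - B)) = ((x - 1) * x powr (2 * q - 1) / (1 - x powr (2 * q - 1))) * (a * A)"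
    using AB x by (simp add: Bx divide_simps) (simp add: algebra_simps)
  also have "\<dots> \<le> 2 * x powr (2 * q) * (a * A)"
  proof (rule mult_right_mono)
    have "x powr (2 * q - 1) < 1" using AB Bx mult_less_cancel_right_pos[of A "x powr (2 * q - 1)" 1] by simp
    then show "(x - 1) * x powr (2 * q - 1) / (1 - x powr (2 * q - 1)) \<le> 2 * x powr (2 * q)"
      using powr_test_quotient[OF x(1) q] by (simp add: divide_le_eq)
  qed (use assms AB in auto)
  also have "a * A = a powr (2 * q)" using assms by (simp add: A_def powr_diff)
  also have "2 * x powr (2 * q) * a powr (2 * q) = 2 * b powr (2 * q)" using x assms by (simp add: powr_mult)
  finally have *: "(b - a) * (A * B / (A - B)) \<le> 2 * b powr (2 * q)" .
  have "(b - a) * (t\<^sup>2 * B - s\<^sup>2 * A) \<le> (b - a) * ((t - s)\<^sup>2 * (A * B / (A - B)))"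
    using AB st False assms by (intro mult_left_mono weighted_square_diff) auto
  also have "\<dots> = (t - s)\<^sup>2 * ((b - a) * (A * B / (A - B)))" by simp
  also have "\<dots> \<le> (t - s)\<^sup>2 * (2 * b powr (2 * q))" by (intro mult_left_mono *) auto
  finally show ?thesis by (simp add: A_def B_def power2_commute mult.commute)
qed

lemma powr_test_core:
  fixes a b q :: real
  assumes "0 < a" "a \<le> b" and q: "0 < q" "q \<le> 1/4"
  shows "(b - a) * (16 * q\<^sup>2 * b powr (2 * q - 1) - 16 * q\<^sup>2 * a powr (2 * q - 1)) + (a powr q - b powr q)\<^sup>2 \<le> 0"
proof -
  define x where "x = b / a"
  have x: "1 \<le> x" "b = x * a" using assms by (auto simp: x_def)
  have e: "a powr (2 * q) = a * a powr (2 * q - 1)" "a powr (2 * q) = (a powr q)\<^sup>2"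
    using assms by (auto simp: powr_diff power2_eq_square simp flip: powr_add)
  have "(a powr q - b powr q)\<^sup>2 = (x powr q - 1)\<^sup>2 * a powr (2 * q)"
    using x assms by (simp add: powr_mult e(2)) (simp add: power2_eq_square algebra_simps)
  also have "\<dots> \<le> 16 * q\<^sup>2 * ((x - 1) * (1 - x powr (2 * q - 1))) * a powr (2 * q)"
    using powr_diff_sq_le[OF x(1) q] by (intro mult_right_mono) auto
  also have "\<dots> = - ((b - a) * (16 * q\<^sup>2 * b powr (2 * q - 1) - 16 * q\<^sup>2 * a powr (2 * q - 1)))"
    using x assms unfolding e(1) by (simp add: powr_mult) (simp add: algebra_simps)
  finally show ?thesis by simp
qed

text \<open>The factor \<open>16 * q\<^sup>2\<close> is the constant of
  \<open>powr_diff_sq_le\<close>, so the energy of \<open>a powr q\<close> appears with coefficient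
  one. The \<open>q\<^sup>2\<close> survives in \<open>k\<close>, and a small \<open>q\<close> later
  beats the constants from overlap and oscillation.\<close>

lemma admissible_powr:
  assumes d: "0 < d" and q: "0 < q" "q \<le> 1/4"
  shows "admissible_test d (\<lambda>a. 16 * q\<^sup>2 * a powr (2 * q - 1)) (\<lambda>a. a powr q) (\<lambda>a. 32 * q\<^sup>2 * a powr (2 * q))"
proof -
  define g where "g a = 16 * q\<^sup>2 * a powr (2 * q - 1)" for a
  define L where "L = \<bar>16 * q\<^sup>2 * (2 * q - 1)\<bar> * d powr (2 * q - 2) + q * d powr (q - 1) + 16 * q\<^sup>2 * d powr (2 * q - 1)"
  have L: "\<bar>16 * q\<^sup>2 * (2 * q - 1)\<bar> * d powr (2 * q - 2) \<le> L" "q * d powr (q - 1) \<le> L" "16 * q\<^sup>2 * d powr (2 * q - 1) \<le> L"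
    using q by (auto simp: L_def)
  have "\<bar>g a - g b\<bar> \<le> L * \<bar>a - b\<bar>" if "d \<le> a" "d \<le> b" for a b :: real
    unfolding g_def
  proof (rule lipschitz_half_line[where d=d and f'="\<lambda>x. 16 * q\<^sup>2 * (2 * q - 1) * x powr (2 * q - 2)"])
    fix x assume x: "d \<le> x"
    with d show "((\<lambda>x. 16 * q\<^sup>2 * x powr (2 * q - 1)) has_real_derivative 16 * q\<^sup>2 * (2 * q - 1) * x powr (2 * q - 2)) (at x)"
      by (auto intro!: derivative_eq_intros)
    have "\<bar>16 * q\<^sup>2 * (2 * q - 1)\<bar> * x powr (2 * q - 2) \<le> \<bar>16 * q\<^sup>2 * (2 * q - 1)\<bar> * d powr (2 * q - 2)"
      using x d q by (intro mult_left_mono powr_mono2') auto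
    with L(1) show "\<bar>16 * q\<^sup>2 * (2 * q - 1) * x powr (2 * q - 2)\<bar> \<le> L" by (simp add: abs_mult)
  qed fact+
  moreover have "\<bar>a powr q - b powr q\<bar> \<le> L * \<bar>a - b\<bar>" if "d \<le> a" "d \<le> b" for a b :: real
  proof (rule lipschitz_half_line[where d=d and f'="\<lambda>x. q * x powr (q - 1)"])
    fix x assume x: "d \<le> x"
    with d show "((\<lambda>x. x powr q) has_real_derivative q * x powr (q - 1)) (at x)"
      by (auto intro!: derivative_eq_intros)
    have "q * x powr (q - 1) \<le> q * d powr (q - 1)"
      using x d q by (intro mult_left_mono powr_mono2') auto
    with L(2) have "q * x powr (q - 1) \<le> L" by linarith
    with q show "\<bar>q * x powr (q - 1)\<bar> \<le> L" by (subst abs_of_nonneg) auto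
  qed fact+
  moreover have "g a \<le> L" if "d \<le> a" for a
  proof -
    have "g a \<le> 16 * q\<^sup>2 * d powr (2 * q - 1)"
      unfolding g_def using that d q by (intro mult_left_mono powr_mono2') auto
    with L(3) show ?thesis by simp
  qed
  moreover have "0 \<le> g a" for a by (simp add: g_def)
  moreover have "g a * a \<le> 32 * q\<^sup>2 * a powr (2 * q)" if "d \<le> a" for a
    using that d by (simp add: g_def powr_diff)
  moreover have "(b - a) * (t\<^sup>2 * g b - s\<^sup>2 * g a) + (if s = 1 \<and> t = 1 then (a powr q - b powr q)\<^sup>2 else 0)
          \<le> (32 * q\<^sup>2 * a powr (2 * q) + 32 * q\<^sup>2 * b powr (2 * q)) * (s - t)\<^sup>2"
    if "d \<le> a" "d \<le> b" "s \<in> {0..1}" "t \<in> {0..1}" for a b s t :: real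
    using that
  proof (induction a b arbitrary: s t rule: linorder_wlog)
    case (le a b)
    then have ab: "0 < a" "a \<le> b" using d by auto
    show ?case
    proof (cases "s = 1 \<and> t = 1")
      case True
      then show ?thesis using powr_test_core[OF ab q] by (simp add: g_def)
    next
      case False
      have "(b - a) * (t\<^sup>2 * g b - s\<^sup>2 * g a) = 16 * q\<^sup>2 * ((b - a) * (t\<^sup>2 * b powr (2 * q - 1) - s\<^sup>2 * a powr (2 * q - 1)))"
        by (simp add: g_def algebra_simps)
      also have "\<dots> \<le> 16 * q\<^sup>2 * (2 * b powr (2 * q) * (s - t)\<^sup>2)"
        using le by (intro mult_left_mono powr_test_inequality[OF ab q]) auto
      also have "\<dots> = (32 * q\<^sup>2 * b powr (2 * q)) * (s - t)\<^sup>2" by simp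
      also have "\<dots> \<le> (32 * q\<^sup>2 * a powr (2 * q) + 32 * q\<^sup>2 * b powr (2 * q)) * (s - t)\<^sup>2"
        by (intro mult_right_mono) auto
      finally show ?thesis unfolding if_not_P[OF False] by simp
    qed
  next
    case (sym a b)
    from sym(1)[of t s] sym(2-) have "(a - b) * (s\<^sup>2 * g a - t\<^sup>2 * g b) + (if t = 1 \<and> s = 1 then (b powr q - a powr q)\<^sup>2 else 0)
      \<le> (32 * q\<^sup>2 * b powr (2 * q) + 32 * q\<^sup>2 * a powr (2 * q)) * (t - s)\<^sup>2" by simp
    moreover have "(a - b) * (s\<^sup>2 * g a - t\<^sup>2 * g b) = (b - a) * (t\<^sup>2 * g b - s\<^sup>2 * g a)"
      by (simp add: algebra_simps)
    ultimately show ?case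
      by (simp only: power2_commute[of "b powr q"] power2_commute[of t s] conj_commute[of "t = 1"]
          add.commute[of "32 * q\<^sup>2 * b powr (2 * q)"])
  qed
  ultimately have "admissible_test d g (\<lambda>a. a powr q) (\<lambda>a. 32 * q\<^sup>2 * a powr (2 * q))"
    unfolding admissible_test_def
    by (intro conjI exI[of _ L] allI impI ballI) (auto simp: g_def[abs_def])
  then show ?thesis by (simp add: g_def[abs_def])
qed

subsection \<open>Deviation, covering and cutoff estimates\<close>

lemma ball_borel[measurable]: "ball (z :: 'a::euclidean_space) r \<in> sets borel"
  by simp

text \<open>
  Any constant \<open>c\<close> is allowed, so the mean values in Poincare's inequality never have to be identified.
\<close>

lemma nn_integral_square_le_deviation:
  fixes f :: "'a::euclidean_space \<Rightarrow> real"
  assumes [measurable]: "f \<in> borel_measurable borel" "B \<in> sets borel"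
    and nonneg: "\<And>x. 0 \<le> f x" and T: "0 \<le> T"
    and half: "emeasure lborel B \<le> 2 * emeasure lborel {x \<in> B. f x \<le> T}"
  shows "(\<integral>\<^sup>+x\<in>B. ennreal ((f x)\<^sup>2) \<partial>lborel) \<le>
     10 * (\<integral>\<^sup>+x\<in>B. ennreal ((f x - c)\<^sup>2) \<partial>lborel) + ennreal (4 * T\<^sup>2) * emeasure lborel B"
proof -
  \<comment> \<open>As \<open>f\<close> is non-negative, raising a negative \<open>c\<close> to 0
    brings it closer to every value of \<open>f\<close>. The number \<open>m\<close> below is the
    squared excess of \<open>c'\<close> over \<open>T\<close>.\<close>
  define c' where "c' = max c 0"
  define m where "m = (max (c' - T) 0)\<^sup>2"
  have [measurable]: "{x \<in> B. f x \<le> T} \<in> sets borel" by measurable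
  define J where "J = (\<integral>\<^sup>+x\<in>B. ennreal ((f x - c')\<^sup>2) \<partial>lborel)"
  have c': "(f x - c')\<^sup>2 \<le> (f x - c)\<^sup>2" for x
    using nonneg[of x] by (auto simp: c'_def max_def not_le intro!: power_mono)
  have J: "J \<le> (\<integral>\<^sup>+x\<in>B. ennreal ((f x - c)\<^sup>2) \<partial>lborel)"
    unfolding J_def using c' by (intro nn_integral_mono) (auto simp: indicator_def ennreal_leI)
  have "ennreal m * emeasure lborel {x \<in> B. f x \<le> T} = (\<integral>\<^sup>+x. ennreal m * indicator {x \<in> B. f x \<le> T} x \<partial>lborel)"
    by (subst nn_integral_cmult_indicator) auto
  also have "\<dots> \<le> J"
    unfolding J_def
  proof (intro nn_integral_mono)
    fix x
    have "m \<le> (f x - c')\<^sup>2" if "f x \<le> T"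
    proof -
      have "max (c' - T) 0 \<le> \<bar>f x - c'\<bar>" using that by auto
      then have "(max (c' - T) 0)\<^sup>2 \<le> \<bar>f x - c'\<bar>\<^sup>2" by (intro power_mono) auto
      then show ?thesis by (simp add: m_def)
    qed
    then show "ennreal m * indicator {x \<in> B. f x \<le> T} x \<le> ennreal ((f x - c')\<^sup>2) * indicator B x"
      by (auto simp: indicator_def ennreal_leI)
  qed
  finally have "2 * (ennreal m * emeasure lborel {x \<in> B. f x \<le> T}) \<le> 2 * J" by (intro mult_left_mono) auto
  \<comment> \<open>At least half of \<open>B\<close> lies in \<open>{f \<le> T}\<close>, where
    \<open>f\<close> misses \<open>c'\<close> by the excess, so \<open>m\<close> times the measure
    of \<open>B\<close> costs at most twice the deviation integral. The 10 of the statement arises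
    as \<open>2 + 4 * 2\<close>.\<close>
  moreover have "ennreal m * emeasure lborel B \<le> ennreal m * (2 * emeasure lborel {x \<in> B. f x \<le> T})"
    by (intro mult_left_mono half) auto
  ultimately have mB: "ennreal m * emeasure lborel B \<le> 2 * J"
    by (simp add: mult.left_commute)
  have pw: "(f x)\<^sup>2 \<le> 2 * (f x - c')\<^sup>2 + (4 * T\<^sup>2 + 4 * m)" for x
  proof -
    have "(f x)\<^sup>2 \<le> 2 * (f x - c')\<^sup>2 + 2 * c'\<^sup>2"
      using zero_le_power2[of "f x - 2 * c'"] by (simp add: power2_eq_square algebra_simps)
    moreover have "c'\<^sup>2 \<le> 2 * T\<^sup>2 + 2 * m"
    proof (cases "c' \<le> T")
      case True
      then have "c'\<^sup>2 \<le> T\<^sup>2" by (intro power_mono) (auto simp: c'_def)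
      then show ?thesis by (auto simp: m_def intro: order_trans)
    next
      case False
      then show ?thesis using zero_le_power2[of "c' - 2 * T"]
        by (simp add: m_def power2_eq_square algebra_simps)
    qed
    ultimately show ?thesis by linarith
  qed
  have "(\<integral>\<^sup>+x\<in>B. ennreal ((f x)\<^sup>2) \<partial>lborel) \<le>
    (\<integral>\<^sup>+x. 2 * (ennreal ((f x - c')\<^sup>2) * indicator B x) + ennreal (4 * T\<^sup>2 + 4 * m) * indicator B x \<partial>lborel)"
  proof (intro nn_integral_mono)
    fix x
    have "ennreal ((f x)\<^sup>2) \<le> ennreal (2 * (f x - c')\<^sup>2 + (4 * T\<^sup>2 + 4 * m))"
      by (intro ennreal_leI pw)
    also have "\<dots> = 2 * ennreal ((f x - c')\<^sup>2) + ennreal (4 * T\<^sup>2 + 4 * m)"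
      by (subst ennreal_plus) (auto simp: m_def ennreal_mult)
    finally show "ennreal ((f x)\<^sup>2) * indicator B x \<le> 2 * (ennreal ((f x - c')\<^sup>2) * indicator B x) + ennreal (4 * T\<^sup>2 + 4 * m) * indicator B x"
      by (auto simp: indicator_def)
  qed
  also have "\<dots> = 2 * J + ennreal (4 * T\<^sup>2 + 4 * m) * emeasure lborel B"
    by (subst nn_integral_add) (auto simp: nn_integral_cmult J_def nn_integral_cmult_indicator)
  also have "ennreal (4 * T\<^sup>2 + 4 * m) = ennreal (4 * T\<^sup>2) + 4 * ennreal m"
    by (subst ennreal_plus) (auto simp: m_def ennreal_mult)
  also have "2 * J + (ennreal (4 * T\<^sup>2) + 4 * ennreal m) * emeasure lborel B =
     2 * J + 4 * (ennreal m * emeasure lborel B) + ennreal (4 * T\<^sup>2) * emeasure lborel B"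
    by (simp add: algebra_simps)
  also have "\<dots> \<le> 2 * J + 4 * (2 * J) + ennreal (4 * T\<^sup>2) * emeasure lborel B"
    by (intro add_mono mult_left_mono mB) auto
  also have "2 * J + 4 * (2 * J) = 10 * J"
    by (simp add: mult.assoc[symmetric] distrib_right[symmetric])
  also have "10 * J + ennreal (4 * T\<^sup>2) * emeasure lborel B \<le>
    10 * (\<integral>\<^sup>+x\<in>B. ennreal ((f x - c)\<^sup>2) \<partial>lborel) + ennreal (4 * T\<^sup>2) * emeasure lborel B"
    by (intro add_mono mult_left_mono J) auto
  finally show ?thesis .
qed

section \<open>Coverings by balls with bounded overlap\<close>

lemma emeasure_ball_neq_top[simp]: "emeasure lborel (ball z r :: 'a::euclidean_space set) \<noteq> top"
  using emeasure_bounded_finite[OF bounded_ball, of z r] by (simp add: less_top)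

text \<open>Volume comparison: the balls of radius \<open>s / 2\<close> around the points of
  \<open>Z\<close> are disjoint and lie in \<open>ball y (t + s / 2)\<close>.\<close>

lemma separated_card_le:
  fixes Z :: "'a::euclidean_space set"
  assumes Z: "finite Z" "Z \<subseteq> ball y t" and s: "0 < s" and t: "0 < t"
    and sep: "\<And>z w. z \<in> Z \<Longrightarrow> w \<in> Z \<Longrightarrow> z \<noteq> w \<Longrightarrow> s \<le> dist z w"
  shows "real (card Z) * (s / 2) ^ DIM('a) \<le> (t + s / 2) ^ DIM('a)"
proof -
  have dis: "disjoint_family_on (\<lambda>z. ball z (s/2)) Z"
  proof (unfold disjoint_family_on_def, intro ballI impI)
    fix z w assume "z \<in> Z" "w \<in> Z" "z \<noteq> w"
    then have d: "s \<le> dist z w" by (rule sep)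
    show "ball z (s/2) \<inter> ball w (s/2) = {}"
    proof (rule ccontr)
      assume "ball z (s/2) \<inter> ball w (s/2) \<noteq> {}"
      then obtain u where "dist z u < s/2" "dist w u < s/2" by auto
      with d dist_triangle2[of z w u] show False by simp
    qed
  qed
  have "unit_ball_vol (DIM('a)) * (real (card Z) * (s / 2) ^ DIM('a)) = (\<Sum>z\<in>Z. measure lborel (ball z (s/2)))"
    using s by (simp add: content_ball)
  also have "\<dots> = measure lborel (\<Union>z\<in>Z. ball z (s/2))"
    by (rule measure_finite_Union[symmetric]) (use Z dis in auto)
  also have "\<dots> \<le> measure lborel (ball y (t + s/2))"
  proof (rule measure_mono_fmeasurable)
    show "(\<Union>z\<in>Z. ball z (s/2)) \<subseteq> ball y (t + s/2)"
    proof
      fix u assume "u \<in> (\<Union>z\<in>Z. ball z (s/2))"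
      then obtain z where "z \<in> Z" "dist z u < s/2" by auto
      then show "u \<in> ball y (t + s/2)" using Z dist_triangle[of y u z] by fastforce
    qed
    show "ball y (t + s/2) \<in> fmeasurable lborel"
      by (simp add: fmeasurable_def less_top[symmetric])
    show "(\<Union>z\<in>Z. ball z (s/2)) \<in> sets lborel"
      by (simp add: borel_open open_UN)
  qed
  also have "\<dots> = unit_ball_vol (DIM('a)) * (t + s / 2) ^ DIM('a)"
    using s t by (simp add: content_ball)
  finally show ?thesis by simp
qed

text \<open>A separated subset of largest cardinality, which exists by the volume bound, must cover,
  since an uncovered point could be added to it. The overlap of the doubled balls is again a packing
  bound, now around \<open>y\<close>, with ratio
  \<open>(2 * s + s / 2) / (s / 2) = 5\<close>.\<close>

lemma ball_covering:
  fixes x0 :: "'a::euclidean_space"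
  assumes s: "0 < s" and \<rho>: "0 < \<rho>"
  obtains Z where "finite Z" "Z \<subseteq> ball x0 \<rho>" "ball x0 \<rho> \<subseteq> (\<Union>z\<in>Z. ball z s)"
    "\<And>y. card {z \<in> Z. y \<in> ball z (2 * s)} \<le> 5 ^ DIM('a)"
proof -
  define P where "P Z \<longleftrightarrow> finite Z \<and> Z \<subseteq> ball x0 \<rho> \<and> (\<forall>z\<in>Z. \<forall>w\<in>Z. z \<noteq> w \<longrightarrow> s \<le> dist z w)" for Z
  have bd: "card Z \<le> nat \<lceil>(\<rho> + s / 2) ^ DIM('a) / (s / 2) ^ DIM('a)\<rceil>" if "P Z" for Z
  proof -
    have "real (card Z) * (s / 2) ^ DIM('a) \<le> (\<rho> + s / 2) ^ DIM('a)"
      using that s \<rho> by (intro separated_card_le) (auto simp: P_def)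
    then have "real (card Z) \<le> (\<rho> + s / 2) ^ DIM('a) / (s / 2) ^ DIM('a)" using s by (simp add: le_divide_eq)
    then show ?thesis by linarith
  qed
  have "P {}" by (simp add: P_def)
  then obtain Z where Z: "P Z" and max: "\<And>Y. P Y \<Longrightarrow> card Y \<le> card Z"
    using ex_has_greatest_nat[of P "{}" card] bd by (metis less_Suc_eq_le)
  have "finite Z" "Z \<subseteq> ball x0 \<rho>" using Z by (auto simp: P_def)
  moreover have "ball x0 \<rho> \<subseteq> (\<Union>z\<in>Z. ball z s)"
  proof
    fix x assume x: "x \<in> ball x0 \<rho>"
    show "x \<in> (\<Union>z\<in>Z. ball z s)"
    proof (rule ccontr)
      assume n: "x \<notin> (\<Union>z\<in>Z. ball z s)"
      then have "P (insert x Z)" "x \<notin> Z" using Z x s by (auto simp: P_def dist_commute not_less)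
      with max[of "insert x Z"] Z show False by (simp add: P_def)
    qed
  qed
  moreover have "card {z \<in> Z. y \<in> ball z (2 * s)} \<le> 5 ^ DIM('a)" for y
  proof -
    have "real (card {z \<in> Z. y \<in> ball z (2 * s)}) * (s / 2) ^ DIM('a) \<le> (2 * s + s / 2) ^ DIM('a)"
      using Z s by (intro separated_card_le[where y=y]) (auto simp: P_def dist_commute)
    also have "\<dots> = 5 ^ DIM('a) * (s / 2) ^ DIM('a)" by (simp flip: power_mult_distrib)
    finally have "real (card {z \<in> Z. y \<in> ball z (2 * s)}) \<le> 5 ^ DIM('a)" using s by simp
    then show ?thesis by (metis of_nat_le_iff of_nat_numeral of_nat_power)
  qed
  ultimately show ?thesis using that by blast
qed

lemma sum_indicator_le_card:
  "finite Z \<Longrightarrow> (\<Sum>z\<in>Z. indicator (A z) x) = (of_nat (card {z \<in> Z. x \<in> A z}) :: ennreal)"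
  by (simp add: indicator_def sum.If_cases Int_def conj_commute)

lemma nn_integral_cover_le:
  fixes F :: "'a::euclidean_space \<Rightarrow> ennreal"
  assumes [measurable]: "F \<in> borel_measurable borel" and Z: "finite Z" "ball x0 \<rho> \<subseteq> (\<Union>z\<in>Z. ball z s)"
  shows "(\<integral>\<^sup>+x\<in>ball x0 \<rho>. F x \<partial>lborel) \<le> (\<Sum>z\<in>Z. \<integral>\<^sup>+x\<in>ball z s. F x \<partial>lborel)"
proof -
  have [simp]: "(\<lambda>x. F x * indicator (ball z s) x) \<in> borel_measurable borel" for z by measurable
  have "(\<integral>\<^sup>+x\<in>ball x0 \<rho>. F x \<partial>lborel) \<le> (\<integral>\<^sup>+x. (\<Sum>z\<in>Z. F x * indicator (ball z s) x) \<partial>lborel)"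
  proof (intro nn_integral_mono)
    fix x
    show "F x * indicator (ball x0 \<rho>) x \<le> (\<Sum>z\<in>Z. F x * indicator (ball z s) x)"
    proof (cases "x \<in> ball x0 \<rho>")
      case True
      then obtain z where z: "z \<in> Z" "x \<in> ball z s" using Z(2) by auto
      have "F x * indicator (ball z s) x \<le> (\<Sum>z\<in>Z. F x * indicator (ball z s) x)"
        using Z(1) z by (intro member_le_sum) auto
      then show ?thesis using True z by simp
    qed simp
  qed
  also have "\<dots> = (\<Sum>z\<in>Z. \<integral>\<^sup>+x\<in>ball z s. F x \<partial>lborel)" by (rule nn_integral_sum) simp
  finally show ?thesis .
qed

lemma sum_nn_integral_overlap_le:
  fixes F :: "'a::euclidean_space \<Rightarrow> ennreal"
  assumes [measurable]: "F \<in> borel_measurable borel" and Z: "finite Z" "Z \<subseteq> ball x0 \<rho>"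
    and ov: "\<And>y. card {z \<in> Z. y \<in> ball z t} \<le> m"
  shows "(\<Sum>z\<in>Z. \<integral>\<^sup>+x\<in>ball z t. F x \<partial>lborel) \<le> of_nat m * (\<integral>\<^sup>+x\<in>ball x0 (\<rho> + t). F x \<partial>lborel)"
proof -
  have [simp]: "(\<lambda>x. F x * indicator (ball z t) x) \<in> borel_measurable borel" for z by measurable
  have "(\<Sum>z\<in>Z. \<integral>\<^sup>+x\<in>ball z t. F x \<partial>lborel) = (\<integral>\<^sup>+x. (\<Sum>z\<in>Z. F x * indicator (ball z t) x) \<partial>lborel)"
    by (rule nn_integral_sum[symmetric]) simp
  also have "\<dots> \<le> (\<integral>\<^sup>+x. of_nat m * (F x * indicator (ball x0 (\<rho> + t)) x) \<partial>lborel)"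
  proof (intro nn_integral_mono)
    fix x
    have "(\<Sum>z\<in>Z. F x * indicator (ball z t) x) = F x * of_nat (card {z \<in> Z. x \<in> ball z t})"
      by (simp add: sum_distrib_left[symmetric] sum_indicator_le_card[OF Z(1)])
    also have "\<dots> \<le> of_nat m * (F x * indicator (ball x0 (\<rho> + t)) x)"
    proof (cases "x \<in> ball x0 (\<rho> + t)")
      case True
      then show ?thesis using ov[of x] by (simp add: mult.commute mult_left_mono)
    next
      case False
      have "x \<notin> ball z t" if "z \<in> Z" for z
      proof
        assume "x \<in> ball z t"
        moreover have "dist x0 z < \<rho>" using that Z(2) by auto
        ultimately show False using False dist_triangle[of x0 x z] by auto
      qed
      then have "{z \<in> Z. x \<in> ball z t} = {}" by blast
      then show ?thesis unfolding \<open>{z \<in> Z. x \<in> ball z t} = {}\<close> by simp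
    qed
    finally show "(\<Sum>z\<in>Z. F x * indicator (ball z t) x) \<le> of_nat m * (F x * indicator (ball x0 (\<rho> + t)) x)" .
  qed
  also have "\<dots> = of_nat m * (\<integral>\<^sup>+x\<in>ball x0 (\<rho> + t). F x \<partial>lborel)" by (rule nn_integral_cmult) auto
  finally show ?thesis .
qed

section \<open>Cutoff functions and the decay estimate\<close>

definition cutoff :: "'a::euclidean_space \<Rightarrow> real \<Rightarrow> real \<Rightarrow> 'a \<Rightarrow> real" where
  "cutoff z \<rho> \<delta> y = max 0 (min 1 ((\<rho> + \<delta> - dist z y) / \<delta>))"

lemma cutoff_range: "0 \<le> cutoff z \<rho> \<delta> y" "cutoff z \<rho> \<delta> y \<le> 1"
  by (auto simp: cutoff_def)

lemma cutoff_measurable[measurable]: "cutoff z \<rho> \<delta> \<in> borel_measurable borel"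
  unfolding cutoff_def[abs_def] by measurable

lemma cutoff_eq_1: "0 < \<delta> \<Longrightarrow> y \<in> ball z \<rho> \<Longrightarrow> cutoff z \<rho> \<delta> y = 1"
  by (auto simp: cutoff_def min_def max_def field_simps)

lemma cutoff_eq_0: "0 < \<delta> \<Longrightarrow> y \<notin> ball z (\<rho> + \<delta>) \<Longrightarrow> cutoff z \<rho> \<delta> y = 0"
  by (auto simp: cutoff_def field_simps)

lemma cutoff_diff_sq:
  assumes \<delta>: "0 < \<delta>"
  shows "(cutoff z \<rho> \<delta> x - cutoff z \<rho> \<delta> y)\<^sup>2 \<le> min 1 ((dist x y / \<delta>)\<^sup>2)"
proof -
  define a b where "a = (\<rho> + \<delta> - dist z x) / \<delta>" "b = (\<rho> + \<delta> - dist z y) / \<delta>"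
  have "\<bar>dist z y - dist z x\<bar> \<le> dist x y"
    using dist_triangle[of z y x] dist_triangle2[of z x y] by auto
  moreover have "a - b = (dist z y - dist z x) / \<delta>" by (simp add: a_b_def diff_divide_distrib[symmetric])
  ultimately have "\<bar>a - b\<bar> \<le> dist x y / \<delta>" using \<delta> by (simp add: divide_right_mono)
  then have l: "\<bar>cutoff z \<rho> \<delta> x - cutoff z \<rho> \<delta> y\<bar> \<le> dist x y / \<delta>"
    unfolding cutoff_def a_b_def[symmetric] by (auto simp: min_def max_def)
  have "\<bar>cutoff z \<rho> \<delta> x - cutoff z \<rho> \<delta> y\<bar>\<^sup>2 \<le> (dist x y / \<delta>)\<^sup>2" using l by (intro power_mono) auto
  moreover have "\<bar>cutoff z \<rho> \<delta> x - cutoff z \<rho> \<delta> y\<bar>\<^sup>2 \<le> 1\<^sup>2"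
    using cutoff_range[of z \<rho> \<delta> x] cutoff_range[of z \<rho> \<delta> y] by (intro power_mono) auto
  ultimately show ?thesis by simp
qed

text \<open>The decay estimate measures only complements of balls, hence the weights on the sets
  \<open>t \<ge> (1/2) ^ Suc j\<close>. At the least such \<open>j\<close> the single term
  \<open>(1/4) ^ j\<close> suffices: either \<open>j = 0\<close> and the minimum is at most 1, or
  \<open>t \<le> (1/2) ^ j\<close>.\<close>

lemma min_1_square_le_dyadic:
  fixes t :: real assumes t: "0 < t"
  shows "ennreal (min 1 (t\<^sup>2)) \<le> (\<Sum>j. ennreal ((1/4)^j) * indicator {(1/2)^Suc j..} t)"
proof -
  have "\<exists>j. (1/2::real)^Suc j \<le> t"
  proof -
    obtain n where "(1/2::real)^n < t" using real_arch_pow_inv[of t "1/2"] t by auto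
    moreover have "(1/2::real)^Suc n \<le> (1/2)^n" by simp
    ultimately have "(1/2::real)^Suc n \<le> t" by linarith
    then show ?thesis by blast
  qed
  then obtain j where j: "(1/2::real)^Suc j \<le> t" "\<And>i. i < j \<Longrightarrow> \<not> (1/2::real)^Suc i \<le> t"
    using exists_least_iff[of "\<lambda>j. (1/2::real)^Suc j \<le> t"] by blast
  have "min 1 (t\<^sup>2) \<le> (1/4)^j"
  proof (cases j)
    case (Suc i)
    then have "t \<le> (1/2)^j" using j(2)[of i] by simp
    then have "t\<^sup>2 \<le> ((1/2)^j)\<^sup>2" using t by (intro power_mono) auto
    also have "\<dots> = (1/4::real)^j" by (simp add: power2_eq_square flip: power_mult_distrib)
    finally show ?thesis by simp
  qed simp
  then have "ennreal (min 1 (t\<^sup>2)) \<le> ennreal ((1/4)^j) * indicator {(1/2)^Suc j..} t"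
    using j(1) by (simp add: ennreal_leI)
  also have "\<dots> \<le> (\<Sum>j. ennreal ((1/4)^j) * indicator {(1/2)^Suc j..} t)"
  proof -
    define f :: "nat \<Rightarrow> ennreal" where "f i = ennreal ((1/4)^i) * indicator {(1/2)^Suc i..} t" for i
    have "(\<Sum>i\<in>{j}. f i) \<le> suminf f" by (rule sum_le_suminf) auto
    then have "f j \<le> suminf f" by (simp only: sum.insert[OF finite.emptyI] sum.empty add_0_right empty_iff not_False_eq_True)
    then show ?thesis by (simp only: f_def[abs_def])
  qed
  finally show ?thesis .
qed

text \<open>Sum of the dyadic series: the set of level \<open>j\<close> has mass of order
  \<open>(2 powr \<alpha>) ^ Suc j\<close> against the weight \<open>(1/4) ^ j\<close>. The ratio
  \<open>2 powr \<alpha> / 4\<close> is below 1 because \<open>\<alpha> < 2\<close>.\<close>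

definition cutoff_const :: "real \<Rightarrow> real \<Rightarrow> real" where
  "cutoff_const \<alpha> C2 = C2 * 2 powr \<alpha> / (1 - 2 powr \<alpha> / 4)"

lemma cutoff_const_nonneg:
  assumes "\<alpha> < 2" "1 \<le> C2" shows "0 \<le> cutoff_const \<alpha> C2"
proof -
  have "2 powr \<alpha> \<le> 2 powr (2::real)" using assms by (intro powr_mono) auto
  then show ?thesis using assms by (simp add: cutoff_const_def)
qed

context nonlocal_kernel
begin

lemma nn_integral_min_1_square_le:
  assumes \<delta>: "0 < \<delta>"
  shows "(\<integral>\<^sup>+y. ennreal (min 1 ((dist x y / \<delta>)\<^sup>2)) \<partial>\<mu> x) \<le> ennreal (cutoff_const \<alpha> C2 * \<delta> powr (- \<alpha>))"
proof -
  define A where "A j = {y. (1/2)^Suc j \<le> dist x y / \<delta>}" for j :: nat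
  have A[measurable]: "A j \<in> sets (\<mu> x)" for j
    unfolding A_def sets_mu by measurable
  have "(\<integral>\<^sup>+y. ennreal (min 1 ((dist x y / \<delta>)\<^sup>2)) \<partial>\<mu> x) \<le> (\<integral>\<^sup>+y. (\<Sum>j. ennreal ((1/4)^j) * indicator (A j) y) \<partial>\<mu> x)"
  proof (intro nn_integral_mono)
    fix y
    show "ennreal (min 1 ((dist x y / \<delta>)\<^sup>2)) \<le> (\<Sum>j. ennreal ((1/4)^j) * indicator (A j) y)"
    \<comment> \<open>At \<open>y = x\<close> the integrand vanishes, so a possible mass of
      \<open>\<mu> x\<close> at \<open>x\<close> is harmless.\<close>
    proof (cases "x = y")
      case False
      then have "0 < dist x y / \<delta>" using \<delta> by simp
      from min_1_square_le_dyadic[OF this] show ?thesis by (simp add: A_def indicator_def)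
    qed simp
  qed
  also have "\<dots> = (\<Sum>j. ennreal ((1/4)^j) * emeasure (\<mu> x) (A j))"
    by (subst nn_integral_suminf) (auto simp: nn_integral_cmult_indicator)
  also have "\<dots> \<le> (\<Sum>j. ennreal (C2 * \<delta> powr (- \<alpha>) * 2 powr \<alpha> * (2 powr \<alpha> / 4)^j))"
  proof (intro suminf_le summableI)
    fix j :: nat
    have "emeasure (\<mu> x) (A j) \<le> ennreal (C2 * (\<delta> * (1/2)^Suc j) powr (- \<alpha>))"
      by (rule decay_far) (use \<delta> in \<open>auto simp: A_def field_simps\<close>)
    also have "(\<delta> * (1/2)^Suc j) powr (- \<alpha>) = \<delta> powr (- \<alpha>) * (2 powr \<alpha>) ^ Suc j"
    proof -
      have "((1/2::real)^Suc j) powr (- \<alpha>) = (2 powr \<alpha>) ^ Suc j"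
        by (simp add: powr_realpow[symmetric] powr_powr powr_power power_one_over powr_minus powr_divide divide_simps mult.commute del: power_Suc)
      then show ?thesis using \<delta> by (simp add: powr_mult del: power_Suc)
    qed
    finally have "ennreal ((1/4)^j) * emeasure (\<mu> x) (A j) \<le> ennreal ((1/4)^j) * ennreal (C2 * (\<delta> powr (- \<alpha>) * (2 powr \<alpha>) ^ Suc j))"
      by (intro mult_left_mono) auto
    also have "\<dots> = ennreal (C2 * \<delta> powr (- \<alpha>) * 2 powr \<alpha> * (2 powr \<alpha> / 4)^j)"
      using C2_ge_1 by (simp add: power_divide power_one_over field_simps flip: ennreal_mult)
    finally show "ennreal ((1/4)^j) * emeasure (\<mu> x) (A j) \<le> ennreal (C2 * \<delta> powr (- \<alpha>) * 2 powr \<alpha> * (2 powr \<alpha> / 4)^j)" .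
  qed
  also have "\<dots> = ennreal (C2 * \<delta> powr (- \<alpha>) * 2 powr \<alpha> * (1 / (1 - 2 powr \<alpha> / 4)))"
  proof (rule suminf_ennreal_eq)
    have "2 powr \<alpha> < 2 powr (2::real)" using \<alpha>_less_2 by (intro powr_less_mono) auto
    then have "norm (2 powr \<alpha> / 4) < 1" by simp
    from geometric_sums[OF this] show "(\<lambda>j. C2 * \<delta> powr (- \<alpha>) * 2 powr \<alpha> * (2 powr \<alpha> / 4)^j) sums (C2 * \<delta> powr (- \<alpha>) * 2 powr \<alpha> * (1 / (1 - 2 powr \<alpha> / 4)))"
      by (rule sums_mult)
  qed (use C2_ge_1 in simp)
  finally show ?thesis by (simp add: cutoff_const_def mult_ac)
qed

lemma nn_integral_cutoff_diff_le:
  assumes \<delta>: "0 < \<delta>"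
  shows "(\<integral>\<^sup>+y. ennreal ((cutoff z \<rho> \<delta> x - cutoff z \<rho> \<delta> y)\<^sup>2) \<partial>\<mu> x) \<le> ennreal (cutoff_const \<alpha> C2 * \<delta> powr (- \<alpha>))"
  by (rule order_trans[OF nn_integral_mono nn_integral_min_1_square_le[OF \<delta>]])
     (intro ennreal_leI cutoff_diff_sq \<delta>)

end

subsection \<open>Energy estimate\<close>

text \<open>\<open>h\<close> has no sign, while double integrals of kernels live in
  \<open>ennreal\<close>; in this arrangement \<open>h + G \<le> P\<close> can be integrated without
  subtraction.\<close>

lemma ennreal_add_le_pos_neg:
  assumes "h + G \<le> P" "0 \<le> G" "0 \<le> P"
  shows "ennreal h + ennreal G \<le> ennreal P + ennreal (- h)"
proof (cases "0 \<le> h")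
  case True
  then have "ennreal h + ennreal G = ennreal (h + G)" using assms by (simp add: ennreal_plus)
  also have "\<dots> \<le> ennreal P" using assms by (intro ennreal_leI)
  also have "\<dots> \<le> ennreal P + ennreal (- h)" by simp
  finally show ?thesis .
next
  case False
  then have "ennreal P + ennreal (- h) = ennreal (P - h)" using assms by (subst ennreal_plus[symmetric]) auto
  moreover have "ennreal h + ennreal G \<le> ennreal (P - h)" using assms False by (simp add: ennreal_neg ennreal_leI)
  ultimately show ?thesis by simp
qed

lemma offdiag_measurable_ennreal:
  fixes h :: "'a::euclidean_space \<Rightarrow> 'a \<Rightarrow> real"
  assumes "(\<lambda>(x, y). h x y) \<in> borel_measurable (borel \<Otimes>\<^sub>M borel)" "\<And>x. h x x = 0"
  shows "offdiag_measurable (\<lambda>x y. ennreal (h x y))"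
  using assms by (intro offdiag_measurableI) (auto simp: split_def)

context nonlocal_kernel
begin

text \<open>\<open>bilinear_form\<close> is an iterated Bochner integral. Absolute convergence
  splits it into the positive and negative parts of \<open>h\<close>, so its sign becomes a
  comparison of two double integrals; the finiteness statement permits cancelling later.\<close>

lemma double_integral_neg_le_pos:
  fixes h :: "'a \<Rightarrow> 'a \<Rightarrow> real"
  assumes m: "(\<lambda>(x, y). h x y) \<in> borel_measurable (borel \<Otimes>\<^sub>M borel)" and h0: "\<And>x. h x x = 0"
    and fin: "double_integral (\<lambda>x y. ennreal \<bar>h x y\<bar>) < \<infinity>"
    and pos: "0 \<le> (LINT x|lebesgue. LINT y|\<mu> x. h x y)"
  shows "double_integral (\<lambda>x y. ennreal (- h x y)) \<le> double_integral (\<lambda>x y. ennreal (h x y))"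
    and "double_integral (\<lambda>x y. ennreal (h x y)) < \<infinity>"
proof -
  have op: "offdiag_measurable (\<lambda>x y. ennreal (h x y))"
    using m h0 by (rule offdiag_measurable_ennreal)
  have on: "offdiag_measurable (\<lambda>x y. ennreal (- h x y))"
    using m h0 by (intro offdiag_measurable_ennreal) (auto simp: split_def)
  have oa: "offdiag_measurable (\<lambda>x y. ennreal \<bar>h x y\<bar>)"
    using m h0 by (intro offdiag_measurable_ennreal) (auto simp: split_def)
  define p where "p x = (\<integral>\<^sup>+y. ennreal (h x y) \<partial>\<mu> x)" for x
  define n where "n x = (\<integral>\<^sup>+y. ennreal (- h x y) \<partial>\<mu> x)" for x
  define a where "a x = (\<integral>\<^sup>+y. ennreal \<bar>h x y\<bar> \<partial>\<mu> x)" for x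
  have [measurable]: "p \<in> borel_measurable lebesgue" "n \<in> borel_measurable lebesgue" "a \<in> borel_measurable lebesgue"
    unfolding p_def[abs_def] n_def[abs_def] a_def[abs_def] using op on oa by (auto intro: inner_integral_measurable)
  have pa: "p x \<le> a x" "n x \<le> a x" for x
    unfolding p_def n_def a_def by (auto intro!: nn_integral_mono ennreal_leI)
  have ifin: "(\<integral>\<^sup>+x. a x \<partial>lebesgue) < \<infinity>" using fin by (simp add: double_integral_def a_def)
  have pfin: "(\<integral>\<^sup>+x. p x \<partial>lebesgue) < \<infinity>" "(\<integral>\<^sup>+x. n x \<partial>lebesgue) < \<infinity>"
    using nn_integral_mono[of lebesgue p a] nn_integral_mono[of lebesgue n a] pa ifin by (auto intro: le_less_trans)
  then show "double_integral (\<lambda>x y. ennreal (h x y)) < \<infinity>" by (simp add: double_integral_def p_def)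
  have afin: "AE x in lebesgue. a x \<noteq> \<infinity>"
    using ifin by (intro nn_integral_PInf_AE) auto
  have hm: "h x \<in> borel_measurable (\<mu> x)" for x
    using measurable_Pair2[OF m, of x] by (simp add: measurable_cong_sets[OF sets_mu refl])
  have inner: "AE x in lebesgue. (LINT y|\<mu> x. h x y) = enn2real (p x) - enn2real (n x)"
    using afin
  proof eventually_elim
    case (elim x)
    have "integrable (\<mu> x) (h x)"
      using elim hm by (intro integrableI_bounded) (auto simp: a_def less_top)
    then show ?case unfolding p_def n_def by (rule real_lebesgue_integral_def)
  qed
  have P: "(\<integral>\<^sup>+x. ennreal (enn2real (p x)) \<partial>lebesgue) = (\<integral>\<^sup>+x. p x \<partial>lebesgue)"
    using afin by (intro nn_integral_cong_AE, eventually_elim) (use pa in \<open>auto simp: less_top intro!: ennreal_enn2real intro: le_less_trans\<close>)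
  have N: "(\<integral>\<^sup>+x. ennreal (enn2real (n x)) \<partial>lebesgue) = (\<integral>\<^sup>+x. n x \<partial>lebesgue)"
    using afin by (intro nn_integral_cong_AE, eventually_elim) (use pa in \<open>auto simp: less_top intro!: ennreal_enn2real intro: le_less_trans\<close>)
  have ip: "integrable lebesgue (\<lambda>x. enn2real (p x))" and inn: "integrable lebesgue (\<lambda>x. enn2real (n x))"
    using pfin by (auto intro!: integrableI_bounded simp: P N)
  have "(LINT x|lebesgue. LINT y|\<mu> x. h x y) = (LINT x|lebesgue. enn2real (p x) - enn2real (n x))"
  proof (rule integral_cong_AE)
    show "(\<lambda>x. enn2real (p x) - enn2real (n x)) \<in> borel_measurable lebesgue" by measurable
    then show "(\<lambda>x. LINT y|\<mu> x. h x y) \<in> borel_measurable lebesgue"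
      by (rule borel_measurable_AE) (use inner in \<open>auto elim: eventually_mono\<close>)
  qed (use inner in auto)
  also have "\<dots> = (LINT x|lebesgue. enn2real (p x)) - (LINT x|lebesgue. enn2real (n x))"
    by (rule Bochner_Integration.integral_diff[OF ip inn])
  finally have "(LINT x|lebesgue. enn2real (n x)) \<le> (LINT x|lebesgue. enn2real (p x))" using pos by simp
  then have "ennreal (LINT x|lebesgue. enn2real (n x)) \<le> ennreal (LINT x|lebesgue. enn2real (p x))" by (rule ennreal_leI)
  also have "ennreal (LINT x|lebesgue. enn2real (n x)) = (\<integral>\<^sup>+x. n x \<partial>lebesgue)"
    using N by (subst nn_integral_eq_integral[OF inn, symmetric]) auto
  also have "ennreal (LINT x|lebesgue. enn2real (p x)) = (\<integral>\<^sup>+x. p x \<partial>lebesgue)"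
    using P by (subst nn_integral_eq_integral[OF ip, symmetric]) auto
  finally show "double_integral (\<lambda>x y. ennreal (- h x y)) \<le> double_integral (\<lambda>x y. ennreal (h x y))"
    by (simp add: double_integral_def p_def n_def)
qed

definition square_kernel :: "('a \<Rightarrow> real) \<Rightarrow> 'a set \<Rightarrow> 'a \<Rightarrow> 'a \<Rightarrow> ennreal" where
  "square_kernel w D x y = ennreal ((w y - w x)\<^sup>2 * (indicator D x * indicator D y))"

lemma quadratic_form_eq: "quadratic_form \<mu> D w = double_integral (square_kernel w D)"
proof -
  have "(\<integral>\<^sup>+y\<in>D. ennreal ((w y - w x)\<^sup>2) \<partial>completion (\<mu> x)) * indicator D x = (\<integral>\<^sup>+y. square_kernel w D x y \<partial>\<mu> x)" for x
    by (cases "x \<in> D") (auto simp: nn_integral_completion square_kernel_def indicator_def intro!: nn_integral_cong)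
  then show ?thesis by (simp add: quadratic_form_def double_integral_def)
qed

lemma offdiag_measurable_square[simp]:
  assumes [measurable]: "w \<in> borel_measurable borel" "D \<in> sets borel"
  shows "offdiag_measurable (square_kernel w D)"
  unfolding square_kernel_def[abs_def]
  by (rule offdiag_measurable_ennreal) auto

lemma bilinear_form_eq:
  assumes [measurable]: "u \<in> borel_measurable borel" "\<phi> \<in> borel_measurable borel"
  shows "bilinear_form \<mu> UNIV u \<phi> = (LINT x|lebesgue. LINT y|\<mu> x. (u y - u x) * (\<phi> y - \<phi> x))"
proof -
  have "(LINT y|completion (\<mu> x). (u y - u x) * (\<phi> y - \<phi> x)) = (LINT y|\<mu> x. (u y - u x) * (\<phi> y - \<phi> x))" for x
    by (rule integral_completion) measurable
  then show ?thesis by (simp add: bilinear_form_def set_lebesgue_integral_def)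
qed

text \<open>A pair is counted only by balls that contain its first point, so the overlap bound for
  points also bounds the overlap of the product sets.\<close>

lemma sum_quadratic_form_overlap_le:
  assumes [measurable]: "w \<in> borel_measurable borel" and Z: "finite Z" "Z \<subseteq> ball x0 \<rho>"
    and ov: "\<And>y. card {z \<in> Z. y \<in> ball z t} \<le> m"
  shows "(\<Sum>z\<in>Z. quadratic_form \<mu> (ball z t) w) \<le> of_nat m * quadratic_form \<mu> (ball x0 (\<rho> + t)) w"
proof -
  have "(\<Sum>z\<in>Z. quadratic_form \<mu> (ball z t) w) = double_integral (\<lambda>x y. \<Sum>z\<in>Z. square_kernel w (ball z t) x y)"
    by (simp add: quadratic_form_eq double_integral_sum)
  also have "\<dots> \<le> double_integral (\<lambda>x y. of_nat m * square_kernel w (ball x0 (\<rho> + t)) x y)"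
  proof (intro double_integral_mono)
    fix x y
    have sub: "ball z t \<subseteq> ball x0 (\<rho> + t)" if "z \<in> Z" for z
    proof
      fix u assume "u \<in> ball z t"
      moreover have "dist x0 z < \<rho>" using that Z(2) by auto
      ultimately show "u \<in> ball x0 (\<rho> + t)" using dist_triangle[of x0 u z] by auto
    qed
    have "(\<Sum>z\<in>Z. square_kernel w (ball z t) x y) \<le> (\<Sum>z\<in>Z. square_kernel w (ball x0 (\<rho> + t)) x y * indicator (ball z t) x)"
      using sub by (intro sum_mono) (auto simp: square_kernel_def indicator_def simp del: mem_ball)
    also have "\<dots> = square_kernel w (ball x0 (\<rho> + t)) x y * of_nat (card {z \<in> Z. x \<in> ball z t})"
      by (simp add: sum_distrib_left[symmetric] sum_indicator_le_card[OF Z(1)])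
    also have "\<dots> \<le> square_kernel w (ball x0 (\<rho> + t)) x y * of_nat m"
      using ov[of x] by (intro mult_left_mono) auto
    finally show "(\<Sum>z\<in>Z. square_kernel w (ball z t) x y) \<le> of_nat m * square_kernel w (ball x0 (\<rho> + t)) x y"
      by (simp add: mult.commute)
  qed
  also have "\<dots> = of_nat m * quadratic_form \<mu> (ball x0 (\<rho> + t)) w"
    by (simp add: double_integral_cmult quadratic_form_eq)
  finally show ?thesis .
qed

text \<open>The form scales by \<open>L\<^sup>2\<close>. As \<open>F 0\<close> may be nonzero,
  square integrability rests on \<open>D\<close> having finite measure, hence on \<open>E\<close>
  being bounded.\<close>

lemma H_loc_lipschitz:
  assumes E: "bounded E" and bu[measurable]: "u \<in> borel_measurable borel" and u: "u \<in> H_loc \<mu> E" and lip: "\<And>s t. \<bar>F s - F t\<bar> \<le> L * \<bar>s - t\<bar>"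
  shows "(\<lambda>x. F (u x :: real) :: real) \<in> H_loc \<mu> E"
  unfolding H_loc_def
proof (intro CollectI allI impI)
  fix D :: "'a set" assume D: "open D" "closure D \<subseteq> E"
  have uD: "u \<in> L2 D" and qD: "quadratic_form \<mu> D u < \<infinity>" using u D by (auto simp: H_loc_def)
  have [measurable]: "u \<in> borel_measurable (lebesgue_on D)" and i: "integrable (lebesgue_on D) (\<lambda>x. (u x)\<^sup>2)"
    using uD by (auto simp: L2_def)
  have L: "0 \<le> L" using lip[of 0 1] by simp
  have "L-lipschitz_on UNIV F" by (rule lipschitz_onI) (use lip L in \<open>auto simp: dist_real_def\<close>)
  then have "continuous_on UNIV F" by (rule lipschitz_on_continuous_on)
  then have [measurable]: "F \<in> borel_measurable borel" by (rule borel_measurable_continuous_onI)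
  have bD: "bounded D" using D E by (meson bounded_subset closure_subset)
  have fD: "emeasure lebesgue D < \<infinity>" using emeasure_bounded_finite[OF bD] D(1) by (simp add: emeasure_completion borel_open)
  have "finite_measure (lebesgue_on D)"
    by (rule finite_measureI) (use fD D(1) in \<open>simp add: emeasure_restrict_space space_restrict_space less_top\<close>)
  then have ic: "integrable (lebesgue_on D) (\<lambda>x. 2 * (F 0)\<^sup>2)" by (rule finite_measure.integrable_const)
  have sq: "(F s)\<^sup>2 \<le> 2 * (F 0)\<^sup>2 + 2 * L\<^sup>2 * s\<^sup>2" for s
  proof -
    have "(F s - F 0)\<^sup>2 \<le> (L * \<bar>s\<bar>)\<^sup>2" using lip[of s 0] by (simp add: abs_le_square_iff[symmetric] abs_mult L)
    moreover have "(F s)\<^sup>2 \<le> 2 * (F s - F 0)\<^sup>2 + 2 * (F 0)\<^sup>2"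
      using zero_le_power2[of "F s - 2 * F 0"] by (simp add: power2_eq_square algebra_simps)
    ultimately show ?thesis by (simp add: power_mult_distrib)
  qed
  have "integrable (lebesgue_on D) (\<lambda>x. (F (u x))\<^sup>2)"
  proof (rule Bochner_Integration.integrable_bound)
    show "integrable (lebesgue_on D) (\<lambda>x. 2 * (F 0)\<^sup>2 + 2 * L\<^sup>2 * (u x)\<^sup>2)"
      using ic i by auto
  qed (use sq in \<open>auto intro!: AE_I2 order_trans[OF sq]\<close>)
  then have "(\<lambda>x. F (u x)) \<in> L2 D" by (simp add: L2_def)
  moreover have "quadratic_form \<mu> D (\<lambda>x. F (u x)) \<le> ennreal (L\<^sup>2) * quadratic_form \<mu> D u"
  proof -
    have [measurable]: "D \<in> sets borel" using D(1) by (rule borel_open)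
    have "square_kernel (\<lambda>x. F (u x)) D x y \<le> ennreal (L\<^sup>2) * square_kernel u D x y" for x y
    proof -
      have "(F (u y) - F (u x))\<^sup>2 \<le> (L * \<bar>u y - u x\<bar>)\<^sup>2"
        using lip[of "u y" "u x"] by (simp add: abs_le_square_iff[symmetric] abs_mult L)
      then have "(F (u y) - F (u x))\<^sup>2 * (indicator D x * indicator D y) \<le> L\<^sup>2 * ((u y - u x)\<^sup>2 * (indicator D x * indicator D y))"
        by (simp add: power_mult_distrib indicator_def)
      then show ?thesis unfolding square_kernel_def by (subst ennreal_mult[symmetric]) (auto intro: ennreal_leI)
    qed
    then have "quadratic_form \<mu> D (\<lambda>x. F (u x)) \<le> double_integral (\<lambda>x y. ennreal (L\<^sup>2) * square_kernel u D x y)"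
      unfolding quadratic_form_eq by (rule double_integral_mono)
    then show ?thesis by (simp add: double_integral_cmult quadratic_form_eq)
  qed
  then have "quadratic_form \<mu> D (\<lambda>x. F (u x)) < \<infinity>"
    using qD by (auto simp: ennreal_mult_less_top intro: le_less_trans)
  ultimately show "(\<lambda>x. F (u x)) \<in> L2 D \<and> quadratic_form \<mu> D (\<lambda>x. F (u x)) < \<infinity>" by simp
qed

end

lemma emeasure_ball_less_top[simp]: "emeasure lborel (ball z r :: 'a::euclidean_space set) < top"
  using emeasure_bounded_finite[OF bounded_ball, of z r] by simp

text \<open>
  The function \<open>u\<close> is a Borel representative of the super-solution.  The number \<open>d\<close> is at least
  \<open>(r / R) powr \<alpha>\<close> times the tail, hence \<open>outer_negative\<close>; \<open>K\<close> is only used qualitatively, for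
  absolute convergence.
\<close>

locale weak_supersolution = nonlocal_kernel \<mu> \<alpha> C2
  for \<mu> :: "'a::euclidean_space \<Rightarrow> 'a measure" and \<alpha> C2 :: real +
  fixes C1 :: real and E :: "'a set" and u :: "'a \<Rightarrow> real" and x0 :: 'a and R r d K :: real and N :: nat
  assumes N_eq: "N = DIM('a)" and bounded_E: "bounded E" and ball_E: "ball x0 R \<subseteq> E"
    and C1_ge_1: "1 \<le> C1" and poincare: "poincare_inequality \<alpha> \<mu> E C1"
    and u_borel[measurable]: "u \<in> borel_measurable borel" and u_H_loc: "u \<in> H_loc \<mu> E"
    and r_pos: "0 < r" and r_less: "32 * r < R" and d_pos: "0 < d"
    and u_nonneg: "\<And>x. x \<in> ball x0 R \<Longrightarrow> 0 \<le> u x"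
    and outer_finite: "AE x in lebesgue. x \<in> ball x0 (7 / 16 * R) \<longrightarrow>
        (\<integral>\<^sup>+y\<in>- ball x0 (R / 2). ennreal \<bar>u y\<bar> \<partial>\<mu> x) \<le> ennreal K"
    and outer_negative: "AE x in lebesgue. x \<in> ball x0 (7 / 16 * R) \<longrightarrow>
        (\<integral>\<^sup>+y\<in>- ball x0 R. ennreal (max (- u y) 0) \<partial>\<mu> x) \<le> ennreal (d * r powr (- \<alpha>))"
    and supersolution: "\<And>\<phi>. \<phi> \<in> H_space \<mu> \<Longrightarrow> \<phi> \<in> borel_measurable borel \<Longrightarrow> (\<And>x. 0 \<le> \<phi> x) \<Longrightarrow>
        closure {x. \<phi> x \<noteq> 0} \<subseteq> E \<Longrightarrow> 0 \<le> bilinear_form \<mu> UNIV u \<phi>"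
begin

text \<open>
  Inside \<open>ball x0 R\<close> this is \<open>u + d\<close>; the truncation makes \<open>\<Phi>(v)\<close> a Lipschitz function of \<open>u\<close> on the
  whole space, so that Poincare's inequality applies to it.
\<close>

definition v :: "'a \<Rightarrow> real" where "v x = max (u x + d) d"

lemma v_measurable[measurable]: "v \<in> borel_measurable borel"
  unfolding v_def[abs_def] by measurable

lemma v_ge: "d \<le> v x" and v_pos: "0 < v x"
  using d_pos by (auto simp: v_def)

lemma v_eq: "x \<in> ball x0 R \<Longrightarrow> v x = u x + d"
  using u_nonneg[of x] by (auto simp: v_def)

lemma R_pos: "0 < R" using r_pos r_less by simp

lemma u_finite_half_ball: "(\<integral>\<^sup>+x\<in>ball x0 (R / 2). ennreal (1 + (u x)\<^sup>2) \<partial>lborel) < \<infinity>"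
proof -
  let ?D = "ball x0 (R / 2)"
  have "closure ?D \<subseteq> E" using R_pos ball_E by (subst closure_ball) (auto simp: subset_eq)
  then have "u \<in> L2 ?D" using u_H_loc by (auto simp: H_loc_def)
  then have i: "integrable (lebesgue_on ?D) (\<lambda>x. (u x)\<^sup>2)" by (simp add: L2_def lebesgue_on_UNIV_eq)
  then have "(\<integral>\<^sup>+x. ennreal ((u x)\<^sup>2) \<partial>lebesgue_on ?D) < \<infinity>"
    using i unfolding integrable_iff_bounded by simp
  then have fin: "(\<integral>\<^sup>+x\<in>?D. ennreal ((u x)\<^sup>2) \<partial>lborel) < \<infinity>"
    by (simp add: nn_integral_restrict_space nn_integral_completion)
  have "(\<integral>\<^sup>+x\<in>?D. ennreal (1 + (u x)\<^sup>2) \<partial>lborel) = (\<integral>\<^sup>+x. indicator ?D x + ennreal ((u x)\<^sup>2) * indicator ?D x \<partial>lborel)"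
    by (intro nn_integral_cong) (auto simp: indicator_def)
  also have "\<dots> = emeasure lborel ?D + (\<integral>\<^sup>+x\<in>?D. ennreal ((u x)\<^sup>2) \<partial>lborel)"
    by (subst nn_integral_add) auto
  also have "\<dots> < \<infinity>" using fin by simp
  finally show ?thesis .
qed

lemma quadratic_form_u_half_ball: "quadratic_form \<mu> (ball x0 (R / 2)) u < \<infinity>"
proof -
  have "closure (ball x0 (R / 2)) \<subseteq> E" using R_pos ball_E by (subst closure_ball) (auto simp: subset_eq)
  then show ?thesis using u_H_loc by (auto simp: H_loc_def)
qed

end

text \<open>The content of \<open>admissible_test\<close> with its constant \<open>L\<close> fixed,
  together with a cutoff. \<open>L\<close> serves integrability and is absent from the final
  estimate. The outer collar, from \<open>\<rho> + \<delta>\<close> to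
  \<open>\<rho> + 2 * \<delta>\<close>, keeps the support of the cutoff at distance
  \<open>\<delta>\<close> from the far region.\<close>

locale caccioppoli = weak_supersolution +
  fixes g \<Phi> k :: "real \<Rightarrow> real" and z :: 'a and \<rho> \<delta> L :: real
  assumes [measurable]: "g \<in> borel_measurable borel" "\<Phi> \<in> borel_measurable borel" "k \<in> borel_measurable borel"
    and g_le: "\<And>a. d \<le> a \<Longrightarrow> g a \<le> L"
    and g_lip: "\<And>a b. d \<le> a \<Longrightarrow> d \<le> b \<Longrightarrow> \<bar>g a - g b\<bar> \<le> L * \<bar>a - b\<bar>"
    and g_nonneg: "\<And>a. d \<le> a \<Longrightarrow> 0 \<le> g a" and g_k: "\<And>a. d \<le> a \<Longrightarrow> g a * a \<le> k a"
    and test: "\<And>a b s t. d \<le> a \<Longrightarrow> d \<le> b \<Longrightarrow> s \<in> {0..1} \<Longrightarrow> t \<in> {0..1} \<Longrightarrow>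
        (b - a) * (t\<^sup>2 * g b - s\<^sup>2 * g a) + (if s = 1 \<and> t = 1 then (\<Phi> a - \<Phi> b)\<^sup>2 else 0) \<le> (k a + k b) * (s - t)\<^sup>2"
    and \<delta>_pos: "0 < \<delta>" and \<delta>_le: "\<delta> \<le> 2 * r"
    and ball_z: "ball z (\<rho> + 2 * \<delta>) \<subseteq> ball x0 (7 / 16 * R)"
begin

abbreviation "\<eta> \<equiv> cutoff z \<rho> \<delta>"
abbreviation "S \<equiv> ball z (\<rho> + \<delta>)"
abbreviation "S' \<equiv> ball z (\<rho> + 2 * \<delta>)"
abbreviation "D \<equiv> ball x0 (R / 2)"
definition "\<phi> x = (\<eta> x)\<^sup>2 * g (v x)"

lemma \<phi>_measurable[measurable]: "\<phi> \<in> borel_measurable borel"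
  unfolding \<phi>_def[abs_def] by measurable

lemma S_sub: "S \<subseteq> S'" using \<delta>_pos by (auto simp: subset_ball)
lemma S'_D: "S' \<subseteq> D" using ball_z R_pos by fastforce
lemma S'_R: "S' \<subseteq> ball x0 R" using ball_z R_pos by fastforce

lemma \<eta>_0: "x \<notin> S \<Longrightarrow> \<eta> x = 0" using \<delta>_pos by (rule cutoff_eq_0)

lemma far: "x \<in> S \<Longrightarrow> y \<notin> S' \<Longrightarrow> \<delta> \<le> dist x y"
  using dist_triangle[of z y x] by auto

lemma g_v: "0 \<le> g (v x)" "g (v x) \<le> L" "g (v x) * v x \<le> k (v x)"
  using v_ge g_nonneg g_le g_k by auto

lemma L_nonneg: "0 \<le> L" using g_v(1,2)[of x0] by simp

lemma k_nonneg: "0 \<le> k (v x)"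
  using g_v[of x] v_pos[of x] by (meson mult_nonneg_nonneg less_imp_le order_trans)

lemma \<phi>_bounds: "0 \<le> \<phi> x" "\<phi> x \<le> L" "\<phi> x \<le> g (v x)"
proof -
  have e: "0 \<le> (\<eta> x)\<^sup>2" "(\<eta> x)\<^sup>2 \<le> 1" using cutoff_range[of z \<rho> \<delta> x] by (auto simp: power_le_one)
  show "0 \<le> \<phi> x" using e g_v by (simp add: \<phi>_def)
  show "\<phi> x \<le> g (v x)" using mult_right_mono[OF e(2) g_v(1)] by (simp add: \<phi>_def)
  then show "\<phi> x \<le> L" using g_v(2) by (rule order_trans)
qed

lemma \<phi>_0: "x \<notin> S \<Longrightarrow> \<phi> x = 0" by (simp add: \<phi>_def \<eta>_0)

lemma v_lip: "\<bar>v x - v y\<bar> \<le> \<bar>u x - u y\<bar>" by (auto simp: v_def max_def)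

text \<open>\<open>u\<close> has finite energy only locally, so its difference may appear only for
  pairs inside \<open>D\<close>, where the product rule is used. Any other pair has a point outside
  \<open>S\<close>, and the difference is a single value of \<open>\<phi>\<close>, which the cutoff
  alone controls.\<close>

lemma \<phi>_diff:
  "(\<phi> y - \<phi> x)\<^sup>2 \<le> 2 * L\<^sup>2 * ((u y - u x)\<^sup>2 * (indicator D x * indicator D y)) + 8 * L\<^sup>2 * (\<eta> x - \<eta> y)\<^sup>2"
proof (cases "x \<in> D \<and> y \<in> D")
  case True
  have e: "0 \<le> \<eta> x" "\<eta> x \<le> 1" "0 \<le> \<eta> y" "\<eta> y \<le> 1" using cutoff_range by auto
  have "\<bar>g (v y) - g (v x)\<bar> \<le> L * \<bar>v y - v x\<bar>" using g_lip v_ge by simp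
  also have "\<dots> \<le> L * \<bar>u y - u x\<bar>" using v_lip L_nonneg by (intro mult_left_mono) auto
  finally have a: "\<bar>(\<eta> y)\<^sup>2 * (g (v y) - g (v x))\<bar> \<le> 1 * (L * \<bar>u y - u x\<bar>)"
    unfolding abs_mult using e by (intro mult_mono) (auto simp: power_le_one)
  have "(\<eta> y)\<^sup>2 - (\<eta> x)\<^sup>2 = (\<eta> y + \<eta> x) * (\<eta> y - \<eta> x)" by (simp add: power2_eq_square algebra_simps)
  moreover have "\<bar>(\<eta> y + \<eta> x) * (\<eta> y - \<eta> x)\<bar> \<le> 2 * \<bar>\<eta> x - \<eta> y\<bar>"
    unfolding abs_mult using e by (intro mult_mono) auto
  ultimately have b: "\<bar>((\<eta> y)\<^sup>2 - (\<eta> x)\<^sup>2) * g (v x)\<bar> \<le> 2 * \<bar>\<eta> x - \<eta> y\<bar> * L"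
    unfolding abs_mult[of "(\<eta> y)\<^sup>2 - (\<eta> x)\<^sup>2"] using g_v(1,2)[of x] by (intro mult_mono) simp_all
  have "\<phi> y - \<phi> x = (\<eta> y)\<^sup>2 * (g (v y) - g (v x)) + ((\<eta> y)\<^sup>2 - (\<eta> x)\<^sup>2) * g (v x)"
    by (simp add: \<phi>_def algebra_simps)
  then have "\<bar>\<phi> y - \<phi> x\<bar> \<le> L * \<bar>u y - u x\<bar> + 2 * \<bar>\<eta> x - \<eta> y\<bar> * L"
    using a b by linarith
  then have "\<bar>\<phi> y - \<phi> x\<bar>\<^sup>2 \<le> (L * \<bar>u y - u x\<bar> + 2 * \<bar>\<eta> x - \<eta> y\<bar> * L)\<^sup>2" by (intro power_mono) auto
  also have "\<dots> \<le> 2 * (L * \<bar>u y - u x\<bar>)\<^sup>2 + 2 * (2 * \<bar>\<eta> x - \<eta> y\<bar> * L)\<^sup>2"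
    using zero_le_power2[of "L * \<bar>u y - u x\<bar> - 2 * \<bar>\<eta> x - \<eta> y\<bar> * L"] by (simp add: power2_sum power2_diff)
  finally show ?thesis using True by (simp add: power_mult_distrib mult_ac)
next
  case False
  have "(\<phi> y - \<phi> x)\<^sup>2 \<le> L\<^sup>2 * (\<eta> x - \<eta> y)\<^sup>2"
  proof -
    have sq: "(\<phi> w)\<^sup>2 \<le> L\<^sup>2 * (\<eta> w)\<^sup>2" for w
    proof -
      have e: "0 \<le> \<eta> w" "\<eta> w \<le> 1" using cutoff_range by auto
      have "\<phi> w = \<eta> w * (\<eta> w * g (v w))" by (simp add: \<phi>_def power2_eq_square)
      also have "\<dots> \<le> \<eta> w * (1 * L)" using e g_v by (intro mult_left_mono mult_mono) auto
      finally have "\<phi> w \<le> L * \<eta> w" by (simp add: mult.commute)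
      then have "(\<phi> w)\<^sup>2 \<le> (L * \<eta> w)\<^sup>2" using \<phi>_bounds(1) by (rule power_mono)
      then show ?thesis by (simp add: power_mult_distrib)
    qed
    have "x \<notin> S \<or> y \<notin> S" using False S_sub S'_D by blast
    then show ?thesis
    proof
      assume "x \<notin> S" then show ?thesis using sq[of y] by (simp add: \<phi>_0 \<eta>_0)
    next
      assume "y \<notin> S" then show ?thesis using sq[of x] by (simp add: \<phi>_0 \<eta>_0)
    qed
  qed
  also have "\<dots> \<le> 8 * L\<^sup>2 * (\<eta> x - \<eta> y)\<^sup>2" by simp
  finally show ?thesis using False by (auto simp: indicator_def)
qed

abbreviation "c\<eta> \<equiv> cutoff_const \<alpha> C2 * \<delta> powr (- \<alpha>)"

lemma eta_kernel_weighted: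
  fixes f :: "'a \<Rightarrow> real"
  assumes [measurable]: "f \<in> borel_measurable borel" "A \<in> sets borel" and f: "\<And>x. 0 \<le> f x"
  shows "double_integral (\<lambda>x y. ennreal (f x * (\<eta> x - \<eta> y)\<^sup>2 * indicator A x)) \<le> ennreal c\<eta> * (\<integral>\<^sup>+x\<in>A. ennreal (f x) \<partial>lborel)"
proof -
  have "double_integral (\<lambda>x y. ennreal (f x * (\<eta> x - \<eta> y)\<^sup>2 * indicator A x)) \<le> (\<integral>\<^sup>+x. ennreal c\<eta> * (ennreal (f x) * indicator A x) \<partial>lebesgue)"
  proof (intro double_integral_mono_AE AE_I2)
    fix x
    have "(\<integral>\<^sup>+y. ennreal (f x * (\<eta> x - \<eta> y)\<^sup>2 * indicator A x) \<partial>\<mu> x) =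
        (\<integral>\<^sup>+y. (ennreal (f x) * indicator A x) * ennreal ((\<eta> x - \<eta> y)\<^sup>2) \<partial>\<mu> x)"
      using f by (intro nn_integral_cong) (auto simp: indicator_def ennreal_mult)
    also have "\<dots> = (ennreal (f x) * indicator A x) * (\<integral>\<^sup>+y. ennreal ((\<eta> x - \<eta> y)\<^sup>2) \<partial>\<mu> x)"
      by (rule nn_integral_cmult) measurable
    also have "\<dots> \<le> (ennreal (f x) * indicator A x) * ennreal c\<eta>"
      by (intro mult_left_mono nn_integral_cutoff_diff_le \<delta>_pos) auto
    finally show "(\<integral>\<^sup>+y. ennreal (f x * (\<eta> x - \<eta> y)\<^sup>2 * indicator A x) \<partial>\<mu> x) \<le> ennreal c\<eta> * (ennreal (f x) * indicator A x)"
      by (simp add: mult.commute)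
  qed
  also have "\<dots> = ennreal c\<eta> * (\<integral>\<^sup>+x\<in>A. ennreal (f x) \<partial>lborel)"
    by (simp add: nn_integral_completion nn_integral_cmult)
  finally show ?thesis .
qed

text \<open>The difference vanishes unless one of the points lies in \<open>S\<close>; the swap
  symmetry reduces both cases to \<open>eta_kernel_weighted\<close> with weight 1 on
  \<open>S\<close>.\<close>

lemma eta_energy_finite: "double_integral (\<lambda>x y. ennreal ((\<eta> x - \<eta> y)\<^sup>2)) < \<infinity>"
proof -
  let ?e = "\<lambda>x y. ennreal (1 * (\<eta> x - \<eta> y)\<^sup>2 * indicator S x)"
  have m: "offdiag_measurable ?e" by (rule offdiag_measurable_ennreal) auto
  have "double_integral (\<lambda>x y. ennreal ((\<eta> x - \<eta> y)\<^sup>2)) \<le> double_integral (\<lambda>x y. ?e x y + ?e y x)"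
    by (intro double_integral_mono) (auto simp: indicator_def \<eta>_0 power2_commute simp del: mem_ball)
  also have "\<dots> = double_integral ?e + double_integral ?e"
    by (simp only: double_integral_add[OF m offdiag_measurable_swap[OF m]] double_integral_swap[OF m])
  finally have le: "double_integral (\<lambda>x y. ennreal ((\<eta> x - \<eta> y)\<^sup>2)) \<le> double_integral ?e + double_integral ?e" .
  have "double_integral ?e \<le> ennreal c\<eta> * (\<integral>\<^sup>+x\<in>S. ennreal 1 \<partial>lborel)"
    by (rule eta_kernel_weighted) auto
  also have "\<dots> < \<infinity>" by (simp add: ennreal_mult_less_top)
  finally have "double_integral ?e + double_integral ?e < \<infinity>" by simp
  with le show ?thesis by (rule le_less_trans)
qed

lemma \<phi>_energy_finite: "quadratic_form \<mu> UNIV \<phi> < \<infinity>"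
proof -
  have m1: "offdiag_measurable (square_kernel u D)" by simp
  have m2: "offdiag_measurable (\<lambda>x y. ennreal ((\<eta> x - \<eta> y)\<^sup>2))" by (rule offdiag_measurable_ennreal) auto
  have "quadratic_form \<mu> UNIV \<phi> \<le> double_integral (\<lambda>x y. ennreal (2 * L\<^sup>2) * square_kernel u D x y + ennreal (8 * L\<^sup>2) * ennreal ((\<eta> x - \<eta> y)\<^sup>2))"
    unfolding quadratic_form_eq
  proof (intro double_integral_mono)
    fix x y
    have "square_kernel \<phi> UNIV x y \<le> ennreal (2 * L\<^sup>2 * ((u y - u x)\<^sup>2 * (indicator D x * indicator D y)) + 8 * L\<^sup>2 * (\<eta> x - \<eta> y)\<^sup>2)"
      unfolding square_kernel_def using \<phi>_diff[of y x] by (intro ennreal_leI) simp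
    also have "\<dots> = ennreal (2 * L\<^sup>2) * square_kernel u D x y + ennreal (8 * L\<^sup>2) * ennreal ((\<eta> x - \<eta> y)\<^sup>2)"
      unfolding square_kernel_def by (subst ennreal_plus) (auto simp: ennreal_mult[symmetric])
    finally show "square_kernel \<phi> UNIV x y \<le> \<dots>" .
  qed
  also have "\<dots> = ennreal (2 * L\<^sup>2) * quadratic_form \<mu> D u + ennreal (8 * L\<^sup>2) * double_integral (\<lambda>x y. ennreal ((\<eta> x - \<eta> y)\<^sup>2))"
    by (simp add: double_integral_add offdiag_measurable_cmult m1 m2 double_integral_cmult quadratic_form_eq)
  also have "\<dots> < \<infinity>"
    using quadratic_form_u_half_ball eta_energy_finite by (simp add: ennreal_mult_less_top)
  finally show ?thesis .
qed

lemma \<phi>_H_space: "\<phi> \<in> H_space \<mu>"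
proof -
  have [measurable]: "\<phi> \<in> borel_measurable lebesgue" by (rule measurable_completion) simp
  have "integrable lebesgue (\<lambda>x. (\<phi> x)\<^sup>2)"
  proof (rule integrableI_bounded)
    have "(\<integral>\<^sup>+x. ennreal (norm ((\<phi> x)\<^sup>2)) \<partial>lebesgue) \<le> (\<integral>\<^sup>+x. ennreal (L\<^sup>2) * indicator S x \<partial>lborel)"
      unfolding nn_integral_completion
    proof (intro nn_integral_mono)
      fix x
      have "(\<phi> x)\<^sup>2 \<le> L\<^sup>2" using \<phi>_bounds by (intro power_mono)
      then show "ennreal (norm ((\<phi> x)\<^sup>2)) \<le> ennreal (L\<^sup>2) * indicator S x"
        by (cases "x \<in> S") (auto simp: \<phi>_0 intro: ennreal_leI simp del: mem_ball)
    qed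
    also have "\<dots> < \<infinity>" by (simp add: nn_integral_cmult_indicator ennreal_mult_less_top)
    finally show "(\<integral>\<^sup>+x. ennreal (norm ((\<phi> x)\<^sup>2)) \<partial>lebesgue) < \<infinity>" .
  qed simp
  then have "\<phi> \<in> L2 UNIV" by (simp add: L2_def lebesgue_on_UNIV_eq)
  with \<phi>_energy_finite show ?thesis by (simp add: H_space_def)
qed

lemma \<phi>_support: "closure {x. \<phi> x \<noteq> 0} \<subseteq> E"
proof -
  have "{x. \<phi> x \<noteq> 0} \<subseteq> S" using \<phi>_0 by blast
  then have "{x. \<phi> x \<noteq> 0} \<subseteq> cball z (\<rho> + \<delta>)" using ball_subset_cball by blast
  then have "closure {x. \<phi> x \<noteq> 0} \<subseteq> cball z (\<rho> + \<delta>)" by (rule closure_minimal) simp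
  also have "\<dots> \<subseteq> S'" using \<delta>_pos by auto
  also have "\<dots> \<subseteq> E" using S'_R ball_E by simp
  finally show ?thesis .
qed

definition "h x y = (u y - u x) * (\<phi> y - \<phi> x)"

lemma h_measurable[measurable]: "(\<lambda>(x, y). h x y) \<in> borel_measurable (borel \<Otimes>\<^sub>M borel)"
  unfolding h_def by measurable

lemma h_diag: "h x x = 0" by (simp add: h_def)

lemma h_swap: "h y x = h x y" by (simp add: h_def algebra_simps)

lemma h_bilinear: "0 \<le> (LINT x|lebesgue. LINT y|\<mu> x. h x y)"
  using supersolution[OF \<phi>_H_space _ \<phi>_bounds(1) \<phi>_support] by (simp add: bilinear_form_eq h_def)

end

text \<open>The factor 2 comes from the two orders of a pair. \<open>cutoff_const\<close> pays for
  the variation of the cutoff, \<open>C2\<close> for the value of \<open>v\<close> at the start of a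
  long jump, and 4, as a bound for \<open>2 powr \<alpha>\<close>, for the negative part of
  \<open>u\<close> far away.\<close>

definition caccioppoli_const :: "real \<Rightarrow> real \<Rightarrow> real" where
  "caccioppoli_const \<alpha> C2 = 2 * (cutoff_const \<alpha> C2 + C2 + 4)"

lemma caccioppoli_const_ge:
  assumes "\<alpha> < 2" "1 \<le> C2" shows "10 \<le> caccioppoli_const \<alpha> C2"
  using cutoff_const_nonneg[OF assms] assms by (simp add: caccioppoli_const_def)

section \<open>Near and far jumps, and the energy estimate\<close>

context caccioppoli
begin

lemma outer_kernel_measurable:
  assumes [measurable]: "w \<in> borel_measurable borel" "p \<in> borel_measurable borel" "q \<in> borel_measurable borel" "A \<in> sets borel"
    and A: "S' \<subseteq> A"
  shows "offdiag_measurable (\<lambda>x y. ennreal (w x * (p x + q y) * (indicator S x * indicator (- A) y)))"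
proof (rule offdiag_measurable_ennreal)
  show "w x * (p x + q x) * (indicator S x * indicator (- A) x) = 0" for x
    using A S_sub by (auto simp: indicator_def simp del: mem_ball)
qed measurable

text \<open>Jumps from \<open>S\<close> out of \<open>A\<close> have length at least
  \<open>\<delta>\<close>, so the decay estimate pays for the part with \<open>p x\<close>, and the
  assumed tail bound for the part with \<open>q y\<close>. It is used with \<open>A = D\<close> for
  absolute convergence and with \<open>A = S'\<close> for the energy estimate.\<close>

lemma outer_kernel_le:
  assumes [measurable]: "w \<in> borel_measurable borel" "p \<in> borel_measurable borel" "q \<in> borel_measurable borel" "A \<in> sets borel"
    and nonneg: "\<And>x. 0 \<le> w x" "\<And>x. 0 \<le> p x" "\<And>x. 0 \<le> q x" and B: "0 \<le> B"
    and A: "S' \<subseteq> A"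
    and q: "AE x in lebesgue. x \<in> S \<longrightarrow> (\<integral>\<^sup>+y\<in>- A. ennreal (q y) \<partial>\<mu> x) \<le> ennreal B"
  shows "double_integral (\<lambda>x y. ennreal (w x * (p x + q y) * (indicator S x * indicator (- A) y)))
    \<le> (\<integral>\<^sup>+x\<in>S. ennreal (w x * (p x * (C2 * \<delta> powr (- \<alpha>)) + B)) \<partial>lborel)"
proof -
  have "double_integral (\<lambda>x y. ennreal (w x * (p x + q y) * (indicator S x * indicator (- A) y)))
    \<le> (\<integral>\<^sup>+x\<in>S. ennreal (w x * (p x * (C2 * \<delta> powr (- \<alpha>)) + B)) \<partial>lebesgue)"
  proof (rule double_integral_mono_AE, use q in eventually_elim)
    case (elim x)
    show ?case
    proof (cases "x \<in> S")
      case True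
      have [measurable]: "- A \<in> sets (\<mu> x)" "q \<in> borel_measurable (\<mu> x)"
        by (simp_all add: sets_mu measurable_cong_sets[OF sets_mu refl])
      have "(\<integral>\<^sup>+y. ennreal (w x * (p x + q y) * (indicator S x * indicator (- A) y)) \<partial>\<mu> x)
        = (\<integral>\<^sup>+y. ennreal (w x) * (ennreal (p x) * indicator (- A) y + ennreal (q y) * indicator (- A) y) \<partial>\<mu> x)"
        using True nonneg by (intro nn_integral_cong) (auto simp: indicator_def ennreal_mult)
      also have "\<dots> = ennreal (w x) * (ennreal (p x) * emeasure (\<mu> x) (- A) + (\<integral>\<^sup>+y\<in>- A. ennreal (q y) \<partial>\<mu> x))"
        by (simp add: nn_integral_cmult nn_integral_add nn_integral_cmult_indicator)
      also have "\<dots> \<le> ennreal (w x) * (ennreal (p x) * ennreal (C2 * \<delta> powr (- \<alpha>)) + ennreal B)"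
      proof (intro mult_left_mono add_mono decay_far \<delta>_pos)
        fix y assume "y \<in> - A"
        with A have "y \<notin> S'" by blast
        with True show "\<delta> \<le> dist x y" by (rule far)
      qed (use elim True in auto)
      also have "\<dots> = ennreal (w x * (p x * (C2 * \<delta> powr (- \<alpha>)) + B))"
        using nonneg B C2_ge_1 by (simp add: ennreal_mult)
      finally show ?thesis using True by simp
    qed simp
  qed
  then show ?thesis by (simp add: nn_integral_completion)
qed

lemma h_0: "x \<notin> S \<Longrightarrow> y \<notin> S \<Longrightarrow> h x y = 0"
  by (simp add: h_def \<phi>_0)

definition n :: "'a \<Rightarrow> real" where "n y = max (- u y) 0 * indicator (- ball x0 R) y"

lemma n_measurable[measurable]: "n \<in> borel_measurable borel" unfolding n_def[abs_def] by measurable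

lemma n_nonneg: "0 \<le> n y" by (simp add: n_def)

lemma u_diff_le: "x \<in> S \<Longrightarrow> u x - u y \<le> v x + n y"
  using u_nonneg[of y] d_pos by (auto simp: v_def n_def indicator_def simp del: mem_ball)

definition absolute_kernel :: "'a \<Rightarrow> 'a \<Rightarrow> ennreal" where
  "absolute_kernel x y = ennreal (L * (\<bar>u x\<bar> + \<bar>u y\<bar>) * (indicator S x * indicator (- D) y))"

lemma absolute_kernel: "offdiag_measurable absolute_kernel" "double_integral absolute_kernel < \<infinity>"
proof -
  show "offdiag_measurable absolute_kernel"
    unfolding absolute_kernel_def[abs_def] by (rule outer_kernel_measurable) (use S'_D in auto)
  define b where "b = C2 * \<delta> powr (- \<alpha>)"
  have b: "0 \<le> b" using C2_ge_1 by (simp add: b_def)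
  have "double_integral absolute_kernel \<le> (\<integral>\<^sup>+x\<in>S. ennreal (L * (\<bar>u x\<bar> * b + max K 0)) \<partial>lborel)"
    unfolding absolute_kernel_def[abs_def] b_def
  proof (rule outer_kernel_le)
    show "AE x in lebesgue. x \<in> S \<longrightarrow> (\<integral>\<^sup>+y\<in>- D. ennreal \<bar>u y\<bar> \<partial>\<mu> x) \<le> ennreal (max K 0)"
      using outer_finite
    proof eventually_elim
      case (elim x)
      show ?case
      proof
        assume "x \<in> S"
        then have "x \<in> ball x0 (7 / 16 * R)" using S_sub ball_z by blast
        then have "(\<integral>\<^sup>+y\<in>- D. ennreal \<bar>u y\<bar> \<partial>\<mu> x) \<le> ennreal K" using elim by blast
        also have "\<dots> \<le> ennreal (max K 0)" by (intro ennreal_leI) simp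
        finally show "(\<integral>\<^sup>+y\<in>- D. ennreal \<bar>u y\<bar> \<partial>\<mu> x) \<le> ennreal (max K 0)" .
      qed
    qed
  qed (use L_nonneg S'_D in auto)
  also have "\<dots> \<le> (\<integral>\<^sup>+x. ennreal (L * (b + max K 0)) * (ennreal (1 + (u x)\<^sup>2) * indicator D x) \<partial>lborel)"
  proof (intro nn_integral_mono)
    fix x
    have 1: "\<bar>u x\<bar> \<le> 1 + (u x)\<^sup>2" using zero_le_power2[of "\<bar>u x\<bar> - 1"] by (simp add: power2_diff)
    have "\<bar>u x\<bar> * b + max K 0 \<le> (1 + (u x)\<^sup>2) * b + max K 0 * (1 + (u x)\<^sup>2)"
      using b 1 by (intro add_mono mult_right_mono) (auto simp: mult_le_cancel_left1)
    then have "L * (\<bar>u x\<bar> * b + max K 0) \<le> L * ((1 + (u x)\<^sup>2) * b + max K 0 * (1 + (u x)\<^sup>2))"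
      using L_nonneg by (rule mult_left_mono)
    also have "\<dots> = L * (b + max K 0) * (1 + (u x)\<^sup>2)" by (simp add: algebra_simps)
    finally have "ennreal (L * (\<bar>u x\<bar> * b + max K 0)) \<le> ennreal (L * (b + max K 0)) * ennreal (1 + (u x)\<^sup>2)"
      using L_nonneg b by (subst ennreal_mult[symmetric]) (auto intro!: ennreal_leI)
    then show "ennreal (L * (\<bar>u x\<bar> * b + max K 0)) * indicator S x \<le> ennreal (L * (b + max K 0)) * (ennreal (1 + (u x)\<^sup>2) * indicator D x)"
      using S_sub S'_D by (auto simp: indicator_def simp del: mem_ball)
  qed
  also have "\<dots> = ennreal (L * (b + max K 0)) * (\<integral>\<^sup>+x\<in>D. ennreal (1 + (u x)\<^sup>2) \<partial>lborel)"
    by (rule nn_integral_cmult) simp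
  also have "\<dots> < \<infinity>" using u_finite_half_ball by (simp add: ennreal_mult_less_top)
  finally show "double_integral absolute_kernel < \<infinity>" .
qed

text \<open>For pairs inside \<open>D\<close>, Young's inequality bounds \<open>h\<close> by the two
  energies. Any other contributing pair has one point in \<open>S\<close> and one outside
  \<open>D\<close>, where a single value of \<open>\<phi>\<close> is left and
  \<open>absolute_kernel\<close> dominates.\<close>

lemma h_absolutely_integrable: "double_integral (\<lambda>x y. ennreal \<bar>h x y\<bar>) < \<infinity>"
proof -
  have m[simp]: "offdiag_measurable (square_kernel u D)" "offdiag_measurable (square_kernel \<phi> UNIV)" by simp_all
  note ak = absolute_kernel(1) offdiag_measurable_swap[OF absolute_kernel(1)]
  have "double_integral (\<lambda>x y. ennreal \<bar>h x y\<bar>) \<le>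
    double_integral (\<lambda>x y. (square_kernel u D x y + square_kernel \<phi> UNIV x y) + (absolute_kernel x y + absolute_kernel y x))"
  proof (intro double_integral_mono)
    fix x y
    have outer: "ennreal \<bar>h a b\<bar> \<le> absolute_kernel a b" if "a \<in> S" "b \<notin> D" for a b
    proof -
      have "b \<notin> S" using that S_sub S'_D by blast
      then have "\<bar>h a b\<bar> = \<bar>u b - u a\<bar> * \<phi> a" using \<phi>_bounds(1)[of a] by (simp add: h_def \<phi>_0 abs_mult)
      also have "\<dots> \<le> (\<bar>u a\<bar> + \<bar>u b\<bar>) * L" using \<phi>_bounds by (intro mult_mono) auto
      finally show ?thesis using that by (auto simp: absolute_kernel_def mult.commute indicator_def intro!: ennreal_leI simp del: mem_ball)
    qed
    consider "x \<in> D" "y \<in> D" | "x \<in> S" "y \<notin> D" | "y \<in> S" "x \<notin> D" | "x \<notin> S" "y \<notin> S"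
      using S_sub S'_D by blast
    then show "ennreal \<bar>h x y\<bar> \<le> (square_kernel u D x y + square_kernel \<phi> UNIV x y) + (absolute_kernel x y + absolute_kernel y x)"
    proof cases
      case 1
      have "\<bar>h x y\<bar> \<le> (u y - u x)\<^sup>2 + (\<phi> y - \<phi> x)\<^sup>2"
      proof -
        have "2 * (\<bar>u y - u x\<bar> * \<bar>\<phi> y - \<phi> x\<bar>) \<le> (u y - u x)\<^sup>2 + (\<phi> y - \<phi> x)\<^sup>2"
          using zero_le_power2[of "\<bar>u y - u x\<bar> - \<bar>\<phi> y - \<phi> x\<bar>"] by (simp add: power2_diff)
        moreover have "0 \<le> \<bar>u y - u x\<bar> * \<bar>\<phi> y - \<phi> x\<bar>" by simp
        ultimately show ?thesis unfolding h_def abs_mult by linarith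
      qed
      then have "ennreal \<bar>h x y\<bar> \<le> ennreal ((u y - u x)\<^sup>2 + (\<phi> y - \<phi> x)\<^sup>2)" by (rule ennreal_leI)
      also have "\<dots> = square_kernel u D x y + square_kernel \<phi> UNIV x y"
        using 1 by (simp add: square_kernel_def indicator_def del: mem_ball)
      also have "\<dots> \<le> (square_kernel u D x y + square_kernel \<phi> UNIV x y) + (absolute_kernel x y + absolute_kernel y x)" by simp
      finally show ?thesis .
    next
      case 2
      have "ennreal \<bar>h x y\<bar> \<le> absolute_kernel x y" by (rule outer) fact+
      also have "\<dots> \<le> (square_kernel u D x y + square_kernel \<phi> UNIV x y) + (absolute_kernel x y + absolute_kernel y x)"
        by (simp add: add_increasing add_increasing2)
      finally show ?thesis .
    next
      case 3
      have "ennreal \<bar>h x y\<bar> \<le> absolute_kernel y x" using outer[OF 3] by (simp add: h_swap[of x y])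
      also have "\<dots> \<le> (square_kernel u D x y + square_kernel \<phi> UNIV x y) + (absolute_kernel x y + absolute_kernel y x)"
        by (simp add: add_increasing add_increasing2)
      finally show ?thesis .
    next
      case 4
      then show ?thesis by (simp add: h_0)
    qed
  qed
  also have "\<dots> = (quadratic_form \<mu> D u + quadratic_form \<mu> UNIV \<phi>) + (double_integral absolute_kernel + double_integral absolute_kernel)"
    by (simp add: double_integral_add offdiag_measurable_add ak double_integral_swap[OF absolute_kernel(1)] quadratic_form_eq)
  also have "\<dots> < \<infinity>"
    using quadratic_form_u_half_ball \<phi>_energy_finite absolute_kernel(2) by simp
  finally show ?thesis .
qed

definition "inner_part x y = k (v x) * (\<eta> x - \<eta> y)\<^sup>2 * indicator S' x"
definition "outer_part x y = g (v x) * (v x + n y) * (indicator S x * indicator (- S') y)"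

lemma inner_part_nonneg: "0 \<le> inner_part x y" by (simp add: inner_part_def k_nonneg)
lemma outer_part_nonneg: "0 \<le> outer_part x y" using g_v(1)[of x] v_pos[of x] n_nonneg[of y] by (simp add: outer_part_def)

text \<open>For pairs inside \<open>S'\<close> the locale assumption \<open>test\<close> applies.
  For a jump from \<open>S\<close> to a point \<open>b\<close> outside \<open>S'\<close> a single
  value of \<open>\<phi>\<close> is left; the positive part of \<open>u b\<close> has the favourable
  sign, and \<open>n b\<close> accounts for the negative part, which lives outside
  \<open>ball x0 R\<close>.\<close>

lemma pointwise_bound:
  "h x y + (\<Phi> (v y) - \<Phi> (v x))\<^sup>2 * (indicator (ball z \<rho>) x * indicator (ball z \<rho>) y)
    \<le> (inner_part x y + inner_part y x) + (outer_part x y + outer_part y x)"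
proof -
  have BS: "ball z \<rho> \<subseteq> S" using \<delta>_pos by (auto simp: subset_ball)
  have out: "h a b \<le> outer_part a b" if "a \<in> S" "b \<notin> S'" for a b
  proof -
    have "b \<notin> S" using that S_sub by blast
    then have "h a b = (u a - u b) * \<phi> a" by (simp add: h_def \<phi>_0 algebra_simps)
    also have "\<dots> \<le> (v a + n b) * \<phi> a" using \<phi>_bounds u_diff_le that by (intro mult_right_mono) auto
    also have "\<dots> \<le> (v a + n b) * g (v a)"
      using \<phi>_bounds v_pos[of a] n_nonneg[of b] by (intro mult_left_mono) auto
    finally show ?thesis using that by (simp add: outer_part_def mult.commute indicator_def del: mem_ball)
  qed
  have nn: "0 \<le> (inner_part x y + inner_part y x)" "0 \<le> outer_part x y" "0 \<le> outer_part y x"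
    using inner_part_nonneg outer_part_nonneg by auto
  consider "x \<in> S'" "y \<in> S'" | "x \<in> S" "y \<notin> S'" | "y \<in> S" "x \<notin> S'" | "x \<notin> S" "y \<notin> S"
    using S_sub by blast
  then show ?thesis
  proof cases
    case 1
    \<comment> \<open>On \<open>ball x0 R\<close>, which contains \<open>S'\<close>, the functions
      \<open>u\<close> and \<open>v\<close> differ by the constant \<open>d\<close>.\<close>
    have uv: "u y - u x = v y - v x" using 1 S'_R v_eq by (metis add_diff_cancel_right subsetD)
    have "h x y = (v y - v x) * ((\<eta> y)\<^sup>2 * g (v y) - (\<eta> x)\<^sup>2 * g (v x))"
      by (simp add: h_def uv \<phi>_def)
    moreover have "(\<Phi> (v y) - \<Phi> (v x))\<^sup>2 * (indicator (ball z \<rho>) x * indicator (ball z \<rho>) y)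
      \<le> (if \<eta> x = 1 \<and> \<eta> y = 1 then (\<Phi> (v x) - \<Phi> (v y))\<^sup>2 else 0)"
      using cutoff_eq_1[OF \<delta>_pos, of _ z \<rho>] by (auto simp: indicator_def power2_commute simp del: mem_ball)
    moreover have "(v y - v x) * ((\<eta> y)\<^sup>2 * g (v y) - (\<eta> x)\<^sup>2 * g (v x)) +
        (if \<eta> x = 1 \<and> \<eta> y = 1 then (\<Phi> (v x) - \<Phi> (v y))\<^sup>2 else 0) \<le> (k (v x) + k (v y)) * (\<eta> x - \<eta> y)\<^sup>2"
      using cutoff_range by (intro test v_ge) auto
    moreover have "(k (v x) + k (v y)) * (\<eta> x - \<eta> y)\<^sup>2 = inner_part x y + inner_part y x"
      using 1 by (simp add: inner_part_def distrib_right power2_commute del: mem_ball)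
    ultimately show ?thesis using nn by linarith
  next
    case 2
    then have "y \<notin> ball z \<rho>" using BS S_sub by blast
    then show ?thesis using out[OF 2] nn by simp
  next
    case 3
    then have "x \<notin> ball z \<rho>" using BS S_sub by blast
    then show ?thesis using out[OF 3] nn h_swap[of x y] by simp
  next
    case 4
    then have "x \<notin> ball z \<rho>" using BS by blast
    then show ?thesis using nn 4 by (simp add: h_0)
  qed
qed

text \<open>The bound \<open>\<delta> \<le> 2 * r\<close> trades \<open>r powr (- \<alpha>)\<close>
  for \<open>\<delta> powr (- \<alpha>)\<close>, and \<open>d \<le> v x\<close> trades
  \<open>d\<close> for \<open>v x\<close>: this is how adding \<open>d\<close> absorbs the
  tail.\<close>

lemma \<delta>_powr: "d * r powr (- \<alpha>) \<le> 4 * \<delta> powr (- \<alpha>) * v x"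
proof -
  have "r powr (- \<alpha>) \<le> (\<delta> / 2) powr (- \<alpha>)"
    using \<delta>_pos \<delta>_le \<alpha>_pos by (intro powr_mono2') auto
  also have "\<dots> = 2 powr \<alpha> * \<delta> powr (- \<alpha>)" using \<delta>_pos by (simp add: powr_divide powr_minus field_simps)
  also have "\<dots> \<le> 4 * \<delta> powr (- \<alpha>)"
  proof (intro mult_right_mono)
    have "2 powr \<alpha> \<le> 2 powr (2::real)" using \<alpha>_less_2 by (intro powr_mono) auto
    then show "2 powr \<alpha> \<le> 4" by simp
  qed simp
  finally have "d * r powr (- \<alpha>) \<le> d * (4 * \<delta> powr (- \<alpha>))" using d_pos by (intro mult_left_mono) auto
  also have "\<dots> \<le> v x * (4 * \<delta> powr (- \<alpha>))" using v_ge by (intro mult_right_mono) auto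
  finally show ?thesis by (simp add: mult_ac)
qed

theorem energy_estimate:
  "quadratic_form \<mu> (ball z \<rho>) (\<lambda>x. \<Phi> (v x)) \<le>
    ennreal (caccioppoli_const \<alpha> C2 * \<delta> powr (- \<alpha>)) * (\<integral>\<^sup>+x\<in>S'. ennreal (k (v x)) \<partial>lborel)"
proof -
  let ?G = "square_kernel (\<lambda>x. \<Phi> (v x)) (ball z \<rho>)"
  let ?I = "\<lambda>x y. ennreal (inner_part x y)"
  let ?O = "\<lambda>x y. ennreal (outer_part x y)"
  let ?P = "\<lambda>x y. (?I x y + ?I y x) + (?O x y + ?O y x)"
  let ?k = "\<integral>\<^sup>+x\<in>S'. ennreal (k (v x)) \<partial>lborel"
  have mG: "offdiag_measurable ?G" by (rule offdiag_measurable_square) measurable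
  have mI: "offdiag_measurable ?I"
    unfolding inner_part_def by (rule offdiag_measurable_ennreal) auto
  have mO: "offdiag_measurable ?O"
    unfolding outer_part_def by (rule outer_kernel_measurable) auto
  note mI' = offdiag_measurable_swap[OF mI] and mO' = offdiag_measurable_swap[OF mO]
  have mh: "offdiag_measurable (\<lambda>x y. ennreal (h x y))" "offdiag_measurable (\<lambda>x y. ennreal (- h x y))"
    by (rule offdiag_measurable_ennreal, use h_measurable in \<open>simp_all add: h_diag split_def\<close>)+
  note neg_pos = double_integral_neg_le_pos[OF h_measurable h_diag h_absolutely_integrable h_bilinear]
  have "double_integral (\<lambda>x y. ennreal (h x y) + ?G x y) \<le> double_integral (\<lambda>x y. ?P x y + ennreal (- h x y))"
  proof (intro double_integral_mono)
    fix x y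
    have "?P x y = ennreal ((inner_part x y + inner_part y x) + (outer_part x y + outer_part y x))"
      using inner_part_nonneg outer_part_nonneg by simp
    then show "ennreal (h x y) + ?G x y \<le> ?P x y + ennreal (- h x y)"
      unfolding square_kernel_def
      using ennreal_add_le_pos_neg[OF pointwise_bound[of x y]] inner_part_nonneg outer_part_nonneg by simp
  qed
  then have "double_integral (\<lambda>x y. ennreal (h x y)) + double_integral ?G \<le> double_integral ?P + double_integral (\<lambda>x y. ennreal (- h x y))"
    by (simp add: double_integral_add mh mG mI mO mI' mO' offdiag_measurable_add)
  also have "\<dots> \<le> double_integral ?P + double_integral (\<lambda>x y. ennreal (h x y))"
    by (intro add_left_mono neg_pos)
  \<comment> \<open>Cancelling the positive part of \<open>h\<close> in \<open>ennreal\<close>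
    requires its finiteness.\<close>
  finally have "double_integral ?G \<le> double_integral ?P"
    using neg_pos(2) by (subst (asm) (2) add.commute) (auto simp: ennreal_add_left_cancel_le)
  also have "double_integral ?P = 2 * (double_integral ?I + double_integral ?O)"
    by (simp add: double_integral_add mI mO mI' mO' offdiag_measurable_add double_integral_swap[OF mI] double_integral_swap[OF mO] mult_2)
  also have "\<dots> \<le> 2 * (ennreal c\<eta> * ?k + ennreal ((C2 + 4) * \<delta> powr (- \<alpha>)) * ?k)"
  proof (intro mult_left_mono add_mono)
    show "double_integral ?I \<le> ennreal c\<eta> * ?k"
      unfolding inner_part_def by (rule eta_kernel_weighted) (use k_nonneg in auto)
    have "double_integral ?O \<le> (\<integral>\<^sup>+x\<in>S. ennreal (g (v x) * (v x * (C2 * \<delta> powr (- \<alpha>)) + d * r powr (- \<alpha>))) \<partial>lborel)"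
      unfolding outer_part_def
    proof (rule outer_kernel_le)
      show "AE x in lebesgue. x \<in> S \<longrightarrow> (\<integral>\<^sup>+y\<in>- S'. ennreal (n y) \<partial>\<mu> x) \<le> ennreal (d * r powr (- \<alpha>))"
        using outer_negative
      proof eventually_elim
        case (elim x)
        show ?case
        proof
          assume "x \<in> S"
          then have "x \<in> ball x0 (7 / 16 * R)" using S_sub ball_z by blast
          then have *: "(\<integral>\<^sup>+y\<in>- ball x0 R. ennreal (max (- u y) 0) \<partial>\<mu> x) \<le> ennreal (d * r powr (- \<alpha>))" using elim by blast
          have "(\<integral>\<^sup>+y\<in>- S'. ennreal (n y) \<partial>\<mu> x) = (\<integral>\<^sup>+y\<in>- ball x0 R. ennreal (max (- u y) 0) \<partial>\<mu> x)"
            using S'_R by (intro nn_integral_cong) (auto simp: n_def indicator_def simp del: mem_ball)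
          with * show "(\<integral>\<^sup>+y\<in>- S'. ennreal (n y) \<partial>\<mu> x) \<le> ennreal (d * r powr (- \<alpha>))" by simp
        qed
      qed
    qed (use g_v v_pos n_nonneg d_pos in \<open>auto simp: less_imp_le\<close>)
    also have "\<dots> \<le> (\<integral>\<^sup>+x. ennreal ((C2 + 4) * \<delta> powr (- \<alpha>)) * (ennreal (k (v x)) * indicator S' x) \<partial>lborel)"
    proof (intro nn_integral_mono)
      fix x
      have "g (v x) * (v x * (C2 * \<delta> powr (- \<alpha>)) + d * r powr (- \<alpha>)) \<le> g (v x) * (v x * (C2 * \<delta> powr (- \<alpha>)) + 4 * \<delta> powr (- \<alpha>) * v x)"
        using g_v \<delta>_powr[of x] by (intro mult_left_mono add_left_mono) auto
      also have "\<dots> = ((C2 + 4) * \<delta> powr (- \<alpha>)) * (g (v x) * v x)" by (simp add: algebra_simps)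
      also have "\<dots> \<le> ((C2 + 4) * \<delta> powr (- \<alpha>)) * k (v x)" using g_v C2_ge_1 by (intro mult_left_mono) auto
      finally have "ennreal (g (v x) * (v x * (C2 * \<delta> powr (- \<alpha>)) + d * r powr (- \<alpha>))) \<le> ennreal ((C2 + 4) * \<delta> powr (- \<alpha>)) * ennreal (k (v x))"
        using C2_ge_1 k_nonneg by (subst ennreal_mult[symmetric]) (auto intro!: ennreal_leI)
      then show "ennreal (g (v x) * (v x * (C2 * \<delta> powr (- \<alpha>)) + d * r powr (- \<alpha>))) * indicator S x \<le> ennreal ((C2 + 4) * \<delta> powr (- \<alpha>)) * (ennreal (k (v x)) * indicator S' x)"
        using S_sub by (auto simp: indicator_def simp del: mem_ball)
    qed
    also have "\<dots> = ennreal ((C2 + 4) * \<delta> powr (- \<alpha>)) * ?k" by (rule nn_integral_cmult) simp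
    finally show "double_integral ?O \<le> ennreal ((C2 + 4) * \<delta> powr (- \<alpha>)) * ?k" .
  qed simp_all
  also have "\<dots> = ennreal (caccioppoli_const \<alpha> C2 * \<delta> powr (- \<alpha>)) * ?k"
  proof -
    have "caccioppoli_const \<alpha> C2 * \<delta> powr (- \<alpha>) = 2 * (c\<eta> + (C2 + 4) * \<delta> powr (- \<alpha>))"
      by (simp add: caccioppoli_const_def algebra_simps)
    also have "ennreal \<dots> = 2 * (ennreal c\<eta> + ennreal ((C2 + 4) * \<delta> powr (- \<alpha>)))"
      using cutoff_const_nonneg[OF \<alpha>_less_2 C2_ge_1] C2_ge_1 by (simp add: ennreal_mult)
    finally show ?thesis by (simp add: distrib_right mult.assoc)
  qed
  finally show ?thesis by (simp add: quadratic_form_eq)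
qed

end

subsection \<open>Logarithmic oscillation\<close>

lemma emeasure_ball_eq:
  "0 \<le> r \<Longrightarrow> emeasure lborel (ball (z :: 'a::euclidean_space) r) = ennreal (unit_ball_vol (DIM('a)) * r ^ DIM('a))"
  by (rule emeasure_ball)

lemma chebyshev_deviation:
  fixes f :: "'a::euclidean_space \<Rightarrow> real"
  assumes [measurable]: "f \<in> borel_measurable borel" "B \<in> sets borel" and lam: "0 < lam"
    and bd: "(\<integral>\<^sup>+x\<in>B. ennreal ((f x - c)\<^sup>2) \<partial>lborel) \<le> ennreal a"
  shows "emeasure lborel {x \<in> B. lam \<le> \<bar>f x - c\<bar>} \<le> ennreal (a / lam\<^sup>2)"
proof -
  let ?A = "{x \<in> B. lam \<le> \<bar>f x - c\<bar>}"
  have [measurable]: "?A \<in> sets borel" by measurable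
  have "ennreal (lam\<^sup>2) * emeasure lborel ?A = (\<integral>\<^sup>+x. ennreal (lam\<^sup>2) * indicator ?A x \<partial>lborel)"
    by (subst nn_integral_cmult_indicator) auto
  also have "\<dots> \<le> (\<integral>\<^sup>+x\<in>B. ennreal ((f x - c)\<^sup>2) \<partial>lborel)"
  proof (intro nn_integral_mono)
    fix x
    have "lam\<^sup>2 \<le> (f x - c)\<^sup>2" if "lam \<le> \<bar>f x - c\<bar>"
      using power_mono[OF that, of 2] lam by simp
    then show "ennreal (lam\<^sup>2) * indicator ?A x \<le> ennreal ((f x - c)\<^sup>2) * indicator B x"
      by (auto simp: indicator_def intro: ennreal_leI)
  qed
  finally have "ennreal (lam\<^sup>2) * emeasure lborel ?A \<le> ennreal a" using bd by (rule order_trans)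
  then have "ennreal (1 / lam\<^sup>2) * (ennreal (lam\<^sup>2) * emeasure lborel ?A) \<le> ennreal (1 / lam\<^sup>2) * ennreal a"
    by (intro mult_left_mono) auto
  also have "ennreal (1 / lam\<^sup>2) * (ennreal (lam\<^sup>2) * emeasure lborel ?A) = emeasure lborel ?A"
    using lam by (simp add: mult.assoc[symmetric] ennreal_mult[symmetric])
  also have "ennreal (1 / lam\<^sup>2) * ennreal a = ennreal (a / lam\<^sup>2)"
    by (simp add: ennreal_mult'[symmetric])
  finally show ?thesis .
qed

lemma deviation_constants_close:
  fixes f :: "'a::euclidean_space \<Rightarrow> real"
  assumes [measurable]: "f \<in> borel_measurable borel" and sub: "ball z s \<subseteq> ball z' s'" and s: "0 < s"
    and ab: "0 \<le> a" "0 \<le> b"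
    and 1: "(\<integral>\<^sup>+x\<in>ball z s. ennreal ((f x - c)\<^sup>2) \<partial>lborel) \<le> ennreal a"
    and 2: "(\<integral>\<^sup>+x\<in>ball z' s'. ennreal ((f x - c')\<^sup>2) \<partial>lborel) \<le> ennreal b"
  shows "(c - c')\<^sup>2 * (unit_ball_vol (DIM('a)) * s ^ DIM('a)) \<le> 2 * (a + b)"
proof -
  have "ennreal ((c - c')\<^sup>2) * emeasure lborel (ball z s) = (\<integral>\<^sup>+x. ennreal ((c - c')\<^sup>2) * indicator (ball z s) x \<partial>lborel)"
    by (subst nn_integral_cmult_indicator) auto
  also have "\<dots> \<le> (\<integral>\<^sup>+x. 2 * (ennreal ((f x - c)\<^sup>2) * indicator (ball z s) x) + 2 * (ennreal ((f x - c')\<^sup>2) * indicator (ball z' s') x) \<partial>lborel)"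
  proof (intro nn_integral_mono)
    fix x
    have "(c - c')\<^sup>2 \<le> 2 * (f x - c)\<^sup>2 + 2 * (f x - c')\<^sup>2"
      using zero_le_power2[of "(f x - c) + (f x - c')"] by (simp add: power2_eq_square algebra_simps)
    then have "ennreal ((c - c')\<^sup>2) \<le> ennreal (2 * (f x - c)\<^sup>2 + 2 * (f x - c')\<^sup>2)" by (rule ennreal_leI)
    also have "\<dots> = 2 * ennreal ((f x - c)\<^sup>2) + 2 * ennreal ((f x - c')\<^sup>2)" by (simp add: ennreal_mult)
    finally show "ennreal ((c - c')\<^sup>2) * indicator (ball z s) x \<le> 2 * (ennreal ((f x - c)\<^sup>2) * indicator (ball z s) x) + 2 * (ennreal ((f x - c')\<^sup>2) * indicator (ball z' s') x)"
      using sub by (auto simp: indicator_def simp del: mem_ball)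
  qed
  also have "\<dots> = 2 * (\<integral>\<^sup>+x\<in>ball z s. ennreal ((f x - c)\<^sup>2) \<partial>lborel) + 2 * (\<integral>\<^sup>+x\<in>ball z' s'. ennreal ((f x - c')\<^sup>2) \<partial>lborel)"
    by (simp add: nn_integral_add nn_integral_cmult)
  also have "\<dots> \<le> 2 * ennreal a + 2 * ennreal b" by (intro add_mono mult_left_mono 1 2) auto
  also have "\<dots> = ennreal (2 * (a + b))" using ab by (simp add: ennreal_mult)
  finally have "ennreal ((c - c')\<^sup>2 * (unit_ball_vol (DIM('a)) * s ^ DIM('a))) \<le> ennreal (2 * (a + b))"
    using s by (simp add: emeasure_ball_eq ennreal_mult)
  then show ?thesis by (subst (asm) ennreal_le_iff) (use ab in auto)
qed

text \<open>Poincare's constant times the energy constant for collar width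
  \<open>\<rho> / 2\<close>; the 4 bounds
  \<open>\<rho> powr \<alpha> * (\<rho> / 2) powr (- \<alpha>)\<close>.\<close>

definition oscillation_const :: "real \<Rightarrow> real \<Rightarrow> real \<Rightarrow> real" where
  "oscillation_const \<alpha> C1 C2 = 4 * C1 * caccioppoli_const \<alpha> C2"

text \<open>The 4 is the constant \<open>k\<close> of the logarithmic test, and \<open>2 ^ N\<close>
  is the volume ratio of the doubled ball.\<close>

definition log_const :: "real \<Rightarrow> real \<Rightarrow> real \<Rightarrow> nat \<Rightarrow> real" where
  "log_const \<alpha> C1 C2 N = 4 * 2 ^ N * oscillation_const \<alpha> C1 C2"

context weak_supersolution
begin

lemma DIM_N[simp]: "DIM('a) = N" by (simp add: N_eq)

abbreviation "Cc \<equiv> caccioppoli_const \<alpha> C2"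
abbreviation "C4 \<equiv> oscillation_const \<alpha> C1 C2"
abbreviation "K0 \<equiv> log_const \<alpha> C1 C2 N"
lemmas C4_def = oscillation_const_def[of \<alpha> C1 C2]
lemmas K0_def = log_const_def[of \<alpha> C1 C2 N]
abbreviation "\<omega> \<equiv> unit_ball_vol N"

lemma Cc_ge: "10 \<le> Cc"
  by (rule caccioppoli_const_ge[OF \<alpha>_less_2 C2_ge_1])

lemma C4_ge: "1 \<le> C4"
proof -
  have "1 * 10 \<le> C1 * Cc" using C1_ge_1 Cc_ge by (intro mult_mono) auto
  then show ?thesis by (simp add: C4_def)
qed

lemma K0_ge: "1 \<le> K0"
proof -
  have "1 * 1 \<le> (2::real) ^ N * C4" using C4_ge by (intro mult_mono) auto
  then show ?thesis by (simp add: K0_def)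
qed

lemma energy_le:
  assumes adm: "admissible_test d g \<Phi> k" and \<delta>: "0 < \<delta>" "\<delta> \<le> 2 * r"
    and ball: "ball z (\<rho> + 2 * \<delta>) \<subseteq> ball x0 (7 / 16 * R)"
  shows "quadratic_form \<mu> (ball z \<rho>) (\<lambda>x. \<Phi> (v x)) \<le>
    ennreal (Cc * \<delta> powr (- \<alpha>)) * (\<integral>\<^sup>+x\<in>ball z (\<rho> + 2 * \<delta>). ennreal (k (v x)) \<partial>lborel)"
proof -
  obtain L where L: "\<forall>a\<ge>d. g a \<le> L \<and> (\<forall>b\<ge>d. \<bar>g a - g b\<bar> \<le> L * \<bar>a - b\<bar> \<and> \<bar>\<Phi> a - \<Phi> b\<bar> \<le> L * \<bar>a - b\<bar>)"
    using adm unfolding admissible_test_def by blast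
  interpret caccioppoli \<mu> \<alpha> C2 C1 E u x0 R r d K N g \<Phi> k z \<rho> \<delta> L
    by unfold_locales (use adm L \<delta> ball in \<open>auto simp: admissible_test_def simp del: split_paired_All\<close>)
  show ?thesis by (rule energy_estimate)
qed

lemma local_poincare:
  assumes adm: "admissible_test d g \<Phi> k" and \<rho>: "0 < \<rho>" and ball: "ball z \<rho> \<subseteq> ball x0 R"
  obtains c where "(\<integral>\<^sup>+x\<in>ball z \<rho>. ennreal ((\<Phi> (v x) - c)\<^sup>2) \<partial>lborel)
     \<le> ennreal (C1 * \<rho> powr \<alpha>) * quadratic_form \<mu> (ball z \<rho>) (\<lambda>x. \<Phi> (v x))"
proof -
  obtain L where L: "\<And>a b. a \<ge> d \<Longrightarrow> b \<ge> d \<Longrightarrow> \<bar>\<Phi> a - \<Phi> b\<bar> \<le> L * \<bar>a - b\<bar>"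
    using adm unfolding admissible_test_def by blast
  have L0: "0 \<le> L" using L[of d "d + 1"] by simp
  \<comment> \<open>\<open>F\<close> extends \<open>\<Phi>\<close> constantly below
    \<open>d\<close>, so that \<open>F (u x) = \<Phi> (v x)\<close> at every point and
    \<open>H_loc_lipschitz\<close> applies.\<close>
  define F where "F s = \<Phi> (max (s + d) d)" for s
  have "(\<lambda>x. F (u x)) \<in> H_loc \<mu> E"
  proof (rule H_loc_lipschitz[OF bounded_E u_borel u_H_loc])
    fix s t
    have "\<bar>F s - F t\<bar> \<le> L * \<bar>max (s + d) d - max (t + d) d\<bar>" unfolding F_def by (rule L) auto
    also have "\<dots> \<le> L * \<bar>s - t\<bar>" using L0 by (intro mult_left_mono) auto
    finally show "\<bar>F s - F t\<bar> \<le> L * \<bar>s - t\<bar>" .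
  qed
  moreover have "(\<lambda>x. F (u x)) = (\<lambda>x. \<Phi> (v x))" by (simp add: F_def v_def)
  ultimately have "(\<lambda>x. \<Phi> (v x)) \<in> H_loc \<mu> E" by simp
  from poincare[unfolded poincare_inequality_def, rule_format, OF this \<rho> order_trans[OF ball ball_E]]
  have "(\<integral>\<^sup>+x\<in>ball z \<rho>. ennreal ((\<Phi> (v x) - average (ball z \<rho>) (\<lambda>x. \<Phi> (v x)))\<^sup>2) \<partial>lebesgue)
     \<le> ennreal (C1 * \<rho> powr \<alpha>) * quadratic_form \<mu> (ball z \<rho>) (\<lambda>x. \<Phi> (v x))" .
  then show ?thesis by (intro that) (simp add: nn_integral_completion)
qed

lemma powr_\<alpha>_le_4: "0 < \<rho> \<Longrightarrow> \<rho> powr \<alpha> * (\<rho> / 2) powr (- \<alpha>) \<le> 4"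
proof -
  assume \<rho>: "0 < \<rho>"
  then have "\<rho> powr \<alpha> * (\<rho> / 2) powr (- \<alpha>) = 2 powr \<alpha>"
    by (simp add: powr_divide powr_minus field_simps)
  also have "\<dots> \<le> 2 powr (2::real)" using \<alpha>_less_2 by (intro powr_mono) auto
  finally show ?thesis by simp
qed

lemma ball_sub_R: "ball z \<rho> \<subseteq> ball x0 (7 / 16 * R) \<Longrightarrow> ball z \<rho> \<subseteq> ball x0 R"
  using subset_ball[of "7 / 16 * R" R x0] R_pos by auto

text \<open>A collar proportional to the radius makes the powers of \<open>\<rho>\<close> from
  Poincare's inequality and from the energy estimate cancel, so the constant is the same at all
  scales.\<close>

lemma local_oscillation:
  assumes adm: "admissible_test d g \<Phi> k" and \<rho>: "0 < \<rho>" "\<rho> \<le> 4 * r"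
    and ball: "ball z (2 * \<rho>) \<subseteq> ball x0 (7 / 16 * R)"
  obtains c where "(\<integral>\<^sup>+x\<in>ball z \<rho>. ennreal ((\<Phi> (v x) - c)\<^sup>2) \<partial>lborel)
     \<le> ennreal C4 * (\<integral>\<^sup>+x\<in>ball z (2 * \<rho>). ennreal (k (v x)) \<partial>lborel)"
proof -
  have "ball z \<rho> \<subseteq> ball z (2 * \<rho>)" using \<rho> by (intro subset_ball) auto
  then have bR: "ball z \<rho> \<subseteq> ball x0 R" using ball ball_sub_R by blast
  obtain c where c: "(\<integral>\<^sup>+x\<in>ball z \<rho>. ennreal ((\<Phi> (v x) - c)\<^sup>2) \<partial>lborel)
     \<le> ennreal (C1 * \<rho> powr \<alpha>) * quadratic_form \<mu> (ball z \<rho>) (\<lambda>x. \<Phi> (v x))"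
    using local_poincare[OF adm \<rho>(1) bR] by blast
  let ?k = "\<integral>\<^sup>+x\<in>ball z (2 * \<rho>). ennreal (k (v x)) \<partial>lborel"
  have "quadratic_form \<mu> (ball z \<rho>) (\<lambda>x. \<Phi> (v x)) \<le> ennreal (Cc * (\<rho> / 2) powr (- \<alpha>)) * ?k"
    using energy_le[OF adm, of "\<rho> / 2" z \<rho>] \<rho> ball by (simp add: mult.commute)
  then have "ennreal (C1 * \<rho> powr \<alpha>) * quadratic_form \<mu> (ball z \<rho>) (\<lambda>x. \<Phi> (v x))
    \<le> ennreal (C1 * \<rho> powr \<alpha>) * (ennreal (Cc * (\<rho> / 2) powr (- \<alpha>)) * ?k)"
    by (intro mult_left_mono) auto
  also have "\<dots> = ennreal (C1 * Cc * (\<rho> powr \<alpha> * (\<rho> / 2) powr (- \<alpha>))) * ?k"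
    using C1_ge_1 Cc_ge by (subst mult.assoc[symmetric], subst ennreal_mult[symmetric]) (auto simp: mult_ac)
  also have "\<dots> \<le> ennreal C4 * ?k"
  proof (intro mult_right_mono ennreal_leI)
    have "C1 * Cc * (\<rho> powr \<alpha> * (\<rho> / 2) powr (- \<alpha>)) \<le> C1 * Cc * 4"
      using C1_ge_1 Cc_ge powr_\<alpha>_le_4[OF \<rho>(1)] by (intro mult_left_mono) auto
    then show "C1 * Cc * (\<rho> powr \<alpha> * (\<rho> / 2) powr (- \<alpha>)) \<le> C4" by (simp add: C4_def)
  qed simp
  finally show ?thesis using c that by (meson order_trans)
qed

lemma log_oscillation:
  assumes \<rho>: "0 < \<rho>" "\<rho> \<le> 4 * r" and ball: "ball z (2 * \<rho>) \<subseteq> ball x0 (7 / 16 * R)"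
  obtains c where "(\<integral>\<^sup>+x\<in>ball z \<rho>. ennreal ((ln (v x) - c)\<^sup>2) \<partial>lborel) \<le> ennreal (K0 * (\<omega> * \<rho> ^ N))"
proof -
  obtain c where "(\<integral>\<^sup>+x\<in>ball z \<rho>. ennreal ((ln (v x) - c)\<^sup>2) \<partial>lborel)
     \<le> ennreal C4 * (\<integral>\<^sup>+x\<in>ball z (2 * \<rho>). ennreal 4 \<partial>lborel)"
    by (rule local_oscillation[OF admissible_log[OF d_pos] \<rho> ball])
  also have "(\<integral>\<^sup>+x\<in>ball z (2 * \<rho>). ennreal 4 \<partial>lborel) = ennreal (4 * (\<omega> * (2 * \<rho>) ^ N))"
    using \<rho> by (subst nn_integral_cmult_indicator) (auto simp: emeasure_ball_eq ennreal_mult)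
  also have "ennreal C4 * ennreal (4 * (\<omega> * (2 * \<rho>) ^ N)) = ennreal (K0 * (\<omega> * \<rho> ^ N))"
    using C4_ge \<rho> by (subst ennreal_mult[symmetric]) (auto simp: K0_def power_mult_distrib mult_ac)
  finally show ?thesis by (rule that)
qed

lemma ball_x0_sub: "z \<in> ball x0 s \<Longrightarrow> s + t \<le> s' \<Longrightarrow> ball z t \<subseteq> ball x0 s'"
proof
  fix x assume "z \<in> ball x0 s" "s + t \<le> s'" "x \<in> ball z t"
  then show "x \<in> ball x0 s'" using dist_triangle[of x0 x z] by simp
qed

lemma ball_x0_sub': "z \<in> ball x0 s \<Longrightarrow> s + t \<le> 14 * r \<Longrightarrow> ball z t \<subseteq> ball x0 (7 / 16 * R)"
  by (rule ball_x0_sub) (use r_less in auto)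

text \<open>Bound for the change of the constant approximating \<open>ln v\<close> when the radius
  shrinks by a factor of at most 4; \<open>4 ^ N\<close> is the corresponding volume ratio.\<close>

abbreviation "\<Lambda> \<equiv> sqrt (2 * K0 * (1 + 4 ^ N))"

text \<open>Approximating constants on nested balls of comparable size differ by at most
  \<open>\<Lambda>\<close>, as both are close in mean square to \<open>ln v\<close> on the smaller
  ball. The radius drops by 4 from \<open>ball x0 (4 * r)\<close> to \<open>ball z r\<close> and by
  2 at each halving. An upper bound is recorded because large values of \<open>v\<close> are to be
  controlled.\<close>

lemma log_chain:
  assumes z: "z \<in> ball x0 (2 * r)"
    and c0: "(\<integral>\<^sup>+x\<in>ball x0 (4 * r). ennreal ((ln (v x) - c0)\<^sup>2) \<partial>lborel) \<le> ennreal (K0 * (\<omega> * (4 * r) ^ N))"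
  shows "\<exists>c. (\<integral>\<^sup>+x\<in>ball z (r / 2 ^ m). ennreal ((ln (v x) - c)\<^sup>2) \<partial>lborel) \<le> ennreal (K0 * (\<omega> * (r / 2 ^ m) ^ N))
    \<and> c \<le> c0 + \<Lambda> * (real m + 1)"
proof (induction m)
  have lm[measurable]: "(\<lambda>x. ln (v x)) \<in> borel_measurable borel" by measurable
  have *: "c \<le> c' + \<Lambda>"
    if sub: "ball z s \<subseteq> ball z' s'" and s: "0 < s" "s' \<le> 4 * s" "0 \<le> s'"
    and 1: "(\<integral>\<^sup>+x\<in>ball z s. ennreal ((ln (v x) - c)\<^sup>2) \<partial>lborel) \<le> ennreal (K0 * (\<omega> * s ^ N))"
    and 2: "(\<integral>\<^sup>+x\<in>ball z' s'. ennreal ((ln (v x) - c')\<^sup>2) \<partial>lborel) \<le> ennreal (K0 * (\<omega> * s' ^ N))"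
    for z z' s s' c c'
  proof -
    have p: "0 < \<omega> * s ^ N" using s by simp
    have "(c - c')\<^sup>2 * (\<omega> * s ^ N) \<le> 2 * (K0 * (\<omega> * s ^ N) + K0 * (\<omega> * s' ^ N))"
      by (rule deviation_constants_close[OF lm sub s(1) _ _ 1 2, unfolded DIM_N]) (use K0_ge s in auto)
    also have "\<dots> \<le> 2 * (K0 * (\<omega> * s ^ N) + K0 * (\<omega> * (4 * s) ^ N))"
      using K0_ge s by (intro mult_left_mono add_left_mono power_mono) auto
    also have "\<dots> = (2 * K0 * (1 + 4 ^ N)) * (\<omega> * s ^ N)" by (simp add: power_mult_distrib algebra_simps)
    finally have "(c - c')\<^sup>2 \<le> 2 * K0 * (1 + 4 ^ N)" using p by (simp only: mult_le_cancel_right_pos)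
    then have "c - c' \<le> \<Lambda>" by (rule real_le_rsqrt)
    then show ?thesis by simp
  qed
  case 0
  obtain c where c: "(\<integral>\<^sup>+x\<in>ball z r. ennreal ((ln (v x) - c)\<^sup>2) \<partial>lborel) \<le> ennreal (K0 * (\<omega> * r ^ N))"
    by (rule log_oscillation[OF r_pos _ ball_x0_sub'[OF z]]) (use r_pos in auto)
  have "c \<le> c0 + \<Lambda>"
    by (rule *[OF ball_x0_sub[OF z] _ _ _ c c0]) (use r_pos in auto)
  then show ?case using c by auto
  case (Suc m)
  then obtain c where c: "(\<integral>\<^sup>+x\<in>ball z (r / 2 ^ m). ennreal ((ln (v x) - c)\<^sup>2) \<partial>lborel) \<le> ennreal (K0 * (\<omega> * (r / 2 ^ m) ^ N))"
    "c \<le> c0 + \<Lambda> * (real m + 1)" by blast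
  have s: "0 < r / 2 ^ Suc m" "r / 2 ^ Suc m \<le> r" "r / 2 ^ m = 2 * (r / 2 ^ Suc m)"
    using r_pos one_le_power[of "2::real" "Suc m"] by (auto simp: divide_le_eq mult_le_cancel_left1)
  obtain c' where c': "(\<integral>\<^sup>+x\<in>ball z (r / 2 ^ Suc m). ennreal ((ln (v x) - c')\<^sup>2) \<partial>lborel) \<le> ennreal (K0 * (\<omega> * (r / 2 ^ Suc m) ^ N))"
    by (rule log_oscillation[OF s(1) _ ball_x0_sub'[OF z]]) (use r_pos s in \<open>auto simp del: power_Suc\<close>)
  have "c' \<le> c + \<Lambda>"
    by (rule *[OF subset_ball s(1) _ _ c' c(1)]; use s(1,3) in linarith)
  with c(2) have "c' \<le> c0 + \<Lambda> * (real (Suc m) + 1)" by (simp add: algebra_simps)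
  with c' show ?case by blast
qed

end

subsection \<open>Integrability of a small power\<close>

lemma emeasure_le_twice_complement:
  assumes [measurable]: "A1 \<in> sets M" "A2 \<in> sets M" "B \<in> sets M"
    and B: "emeasure M B = ennreal b" "0 \<le> b" and sub: "B \<subseteq> A1 \<union> A2" and A1: "emeasure M A1 \<le> ennreal (b / 2)"
  shows "emeasure M B \<le> 2 * emeasure M A2"
proof -
  have "ennreal b \<le> emeasure M (A1 \<union> A2)" unfolding B(1)[symmetric] by (rule emeasure_mono[OF sub]) measurable
  also have "\<dots> \<le> emeasure M A1 + emeasure M A2" by (rule emeasure_subadditive) measurable
  also have "\<dots> \<le> ennreal (b / 2) + emeasure M A2" by (intro add_right_mono A1)
  finally have le: "ennreal b \<le> ennreal (b / 2) + emeasure M A2" .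
  show ?thesis
  proof (cases "emeasure M A2")
    case (real e)
    with le B(2) have "ennreal b \<le> ennreal (b / 2 + e)" by simp
    then have "b \<le> b / 2 + e" using real B(2) by (subst (asm) ennreal_le_iff) auto
    then have "ennreal b \<le> ennreal (2 * e)" by (intro ennreal_leI) simp
    also have "\<dots> = 2 * emeasure M A2" using real by (simp add: ennreal_mult)
    finally show ?thesis by (simp add: B(1))
  qed simp
qed

context weak_supersolution
begin

lemma of_nat_5_power: "(of_nat (5 ^ DIM('a)) :: ennreal) = ennreal (5 ^ N)"
  by (simp only: ennreal_of_nat_eq_real_of_nat DIM_N of_nat_power of_nat_numeral)

text \<open>Chosen so that, by Chebyshev's inequality, \<open>ln v\<close> deviates by
  \<open>lam\<close> or more on at most half of a ball.\<close>

abbreviation "lam \<equiv> sqrt (2 * K0)"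

lemma lam_pos: "0 < lam" and lam_sq: "lam\<^sup>2 = 2 * K0"
  using K0_ge by auto

text \<open>On at least half of \<open>ball z s\<close> the value \<open>v x powr q\<close> is at
  most \<open>T\<close>, so \<open>nn_integral_square_le_deviation\<close> replaces the unknown mean
  by \<open>T\<close>. Since \<open>c\<close> drifts by at most \<open>\<Lambda>\<close> per
  halving, the bound for \<open>T\<^sup>2\<close> grows at most by 2 per halving. The 320 is
  \<open>10 * 32\<close>.\<close>

lemma power_local:
  assumes q: "0 < q" "q \<le> 1/4" "exp (2 * q * \<Lambda>) \<le> 2"
    and z: "z \<in> ball x0 (2 * r)" and s: "s = r / 2 ^ m"
    and c0: "(\<integral>\<^sup>+x\<in>ball x0 (4 * r). ennreal ((ln (v x) - c0)\<^sup>2) \<partial>lborel) \<le> ennreal (K0 * (\<omega> * (4 * r) ^ N))"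
  shows "(\<integral>\<^sup>+x\<in>ball z s. ennreal (v x powr (2 * q)) \<partial>lborel) \<le>
    ennreal (320 * q\<^sup>2 * C4) * (\<integral>\<^sup>+x\<in>ball z (2 * s). ennreal (v x powr (2 * q)) \<partial>lborel)
    + ennreal (8 * exp (2 * q * (c0 + lam)) * 2 ^ m) * emeasure lborel (ball z (2 * s))"
proof -
  have s_pos: "0 < s" "s \<le> r"
    using r_pos one_le_power[of "2::real" m] by (auto simp: s divide_le_eq mult_le_cancel_left1)
  let ?W = "\<integral>\<^sup>+x\<in>ball z (2 * s). ennreal (v x powr (2 * q)) \<partial>lborel"
  have sq: "(v x powr q)\<^sup>2 = v x powr (2 * q)" for x
    by (simp add: power2_eq_square flip: powr_add)
  obtain c where c: "(\<integral>\<^sup>+x\<in>ball z s. ennreal ((ln (v x) - c)\<^sup>2) \<partial>lborel) \<le> ennreal (K0 * (\<omega> * s ^ N))"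
    "c \<le> c0 + \<Lambda> * (real m + 1)"
    using log_chain[OF z c0, of m] by (auto simp: s)
  define T where "T = exp (q * (c + lam))"
  have "emeasure lborel {x \<in> ball z s. lam \<le> \<bar>ln (v x) - c\<bar>} \<le> ennreal (K0 * (\<omega> * s ^ N) / lam\<^sup>2)"
    by (rule chebyshev_deviation[OF _ _ lam_pos c(1)]) measurable
  also have "K0 * (\<omega> * s ^ N) / lam\<^sup>2 = \<omega> * s ^ N / 2" using K0_ge by (simp add: lam_sq)
  finally have ch: "emeasure lborel {x \<in> ball z s. lam \<le> \<bar>ln (v x) - c\<bar>} \<le> ennreal (\<omega> * s ^ N / 2)" .
  have half: "emeasure lborel (ball z s) \<le> 2 * emeasure lborel {x \<in> ball z s. v x powr q \<le> T}"
  proof (rule emeasure_le_twice_complement[OF _ _ _ _ _ _ ch])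
    show "emeasure lborel (ball z s) = ennreal (\<omega> * s ^ N)" using s_pos by (simp add: emeasure_ball_eq)
    show "ball z s \<subseteq> {x \<in> ball z s. lam \<le> \<bar>ln (v x) - c\<bar>} \<union> {x \<in> ball z s. v x powr q \<le> T}"
    proof
      fix x assume x: "x \<in> ball z s"
      have imp: "v x powr q \<le> T" if "\<bar>ln (v x) - c\<bar> < lam"
      proof -
        have "q * ln (v x) \<le> q * (c + lam)" using that q by (intro mult_left_mono) auto
        then show ?thesis using v_pos[of x] by (simp add: T_def powr_def)
      qed
      then show "x \<in> {x \<in> ball z s. lam \<le> \<bar>ln (v x) - c\<bar>} \<union> {x \<in> ball z s. v x powr q \<le> T}"
        using x by (cases "lam \<le> \<bar>ln (v x) - c\<bar>") (use imp in \<open>auto simp: not_le simp del: mem_ball\<close>)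
    qed
  qed (use s_pos in auto)
  obtain c' where c': "(\<integral>\<^sup>+x\<in>ball z s. ennreal ((v x powr q - c')\<^sup>2) \<partial>lborel)
     \<le> ennreal C4 * (\<integral>\<^sup>+x\<in>ball z (2 * s). ennreal (32 * q\<^sup>2 * v x powr (2 * q)) \<partial>lborel)"
    by (rule local_oscillation[OF admissible_powr[OF d_pos q(1,2)] s_pos(1) _ ball_x0_sub'[OF z]])
       (use s_pos r_pos in auto)
  have "(\<integral>\<^sup>+x\<in>ball z (2 * s). ennreal (32 * q\<^sup>2 * v x powr (2 * q)) \<partial>lborel) = ennreal (32 * q\<^sup>2) * ?W"
    by (subst nn_integral_cmult[symmetric]) (auto simp: ennreal_mult mult.assoc)
  with c' have c'': "(\<integral>\<^sup>+x\<in>ball z s. ennreal ((v x powr q - c')\<^sup>2) \<partial>lborel) \<le> ennreal C4 * (ennreal (32 * q\<^sup>2) * ?W)"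
    by simp
  have T2: "4 * T\<^sup>2 \<le> 8 * exp (2 * q * (c0 + lam)) * 2 ^ m"
  proof -
    have "T\<^sup>2 = exp (2 * q * (c + lam))" by (simp add: T_def power2_eq_square flip: exp_add)
    also have "\<dots> \<le> exp (2 * q * (c0 + lam) + real (Suc m) * (2 * q * \<Lambda>))"
    proof -
      have "2 * q * (c + lam) \<le> 2 * q * (c0 + \<Lambda> * (real m + 1) + lam)" using c(2) q by (intro mult_left_mono) auto
      also have "\<dots> = 2 * q * (c0 + lam) + real (Suc m) * (2 * q * \<Lambda>)" by (simp add: algebra_simps)
      finally show ?thesis by simp
    qed
    also have "\<dots> = exp (2 * q * (c0 + lam)) * exp (2 * q * \<Lambda>) ^ Suc m"
      by (simp only: exp_add exp_of_nat_mult)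
    also have "\<dots> \<le> exp (2 * q * (c0 + lam)) * 2 ^ Suc m"
      using q by (intro mult_left_mono power_mono) auto
    finally show ?thesis by (simp add: mult_ac)
  qed
  have "(\<integral>\<^sup>+x\<in>ball z s. ennreal ((v x powr q)\<^sup>2) \<partial>lborel)
      \<le> 10 * (\<integral>\<^sup>+x\<in>ball z s. ennreal ((v x powr q - c')\<^sup>2) \<partial>lborel) + ennreal (4 * T\<^sup>2) * emeasure lborel (ball z s)"
    by (rule nn_integral_square_le_deviation[OF _ _ _ _ half]) (auto simp: T_def)
  also have "\<dots> \<le> 10 * (ennreal C4 * (ennreal (32 * q\<^sup>2) * ?W)) + ennreal (8 * exp (2 * q * (c0 + lam)) * 2 ^ m) * emeasure lborel (ball z (2 * s))"
    using s_pos by (intro add_mono mult_left_mono[OF c''] mult_mono[OF ennreal_leI[OF T2] emeasure_mono] subset_ball) auto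
  also have "10 * (ennreal C4 * (ennreal (32 * q\<^sup>2) * ?W)) = ennreal (320 * q\<^sup>2 * C4) * ?W"
  proof -
    have "ennreal (320 * q\<^sup>2 * C4) = 10 * (ennreal C4 * ennreal (32 * q\<^sup>2))"
      using C4_ge by (simp add: ennreal_mult[symmetric] ennreal_numeral[symmetric] mult_ac del: ennreal_numeral)
    then show ?thesis by (simp add: mult.assoc)
  qed
  finally show ?thesis by (simp add: sq)
qed

text \<open>
  The energy estimate for \<open>v powr q\<close> carries a factor \<open>q\<^sup>2\<close>, which makes the coefficient on the larger ball at most
  \<open>1/4\<close> whatever the width \<open>2 * s\<close> of the collar, while the additive term grows only like \<open>2 ^ m\<close>.
\<close>

lemma power_step:
  assumes q: "0 < q" "q \<le> 1/4" "exp (2 * q * \<Lambda>) \<le> 2" "1280 * C4 * 5 ^ N * q\<^sup>2 \<le> 1"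
    and \<rho>: "0 < \<rho>" "\<rho> + 2 * s \<le> 2 * r" and s: "s = r / 2 ^ m"
    and c0: "(\<integral>\<^sup>+x\<in>ball x0 (4 * r). ennreal ((ln (v x) - c0)\<^sup>2) \<partial>lborel) \<le> ennreal (K0 * (\<omega> * (4 * r) ^ N))"
  shows "(\<integral>\<^sup>+x\<in>ball x0 \<rho>. ennreal (v x powr (2 * q)) \<partial>lborel) \<le>
    ennreal (1/4) * (\<integral>\<^sup>+x\<in>ball x0 (\<rho> + 2 * s). ennreal (v x powr (2 * q)) \<partial>lborel)
    + ennreal (8 * exp (2 * q * (c0 + lam)) * (5 ^ N * (\<omega> * (2 * r) ^ N)) * 2 ^ m)"
proof -
  have s_pos: "0 < s" using r_pos by (simp add: s)
  obtain Z where Z: "finite Z" "Z \<subseteq> ball x0 \<rho>" "ball x0 \<rho> \<subseteq> (\<Union>z\<in>Z. ball z s)"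
    and ov: "\<And>y. card {z \<in> Z. y \<in> ball z (2 * s)} \<le> 5 ^ DIM('a)"
    by (rule ball_covering[OF s_pos \<rho>(1)]) blast
  let ?W = "\<lambda>x. ennreal (v x powr (2 * q))"
  let ?J = "\<integral>\<^sup>+x\<in>ball x0 (\<rho> + 2 * s). ?W x \<partial>lborel"
  define a where "a = 8 * exp (2 * q * (c0 + lam)) * 2 ^ m"
  have a: "0 \<le> a" by (simp add: a_def)
  have [measurable]: "?W \<in> borel_measurable borel" by measurable
  have "(\<integral>\<^sup>+x\<in>ball x0 \<rho>. ?W x \<partial>lborel) \<le> (\<Sum>z\<in>Z. \<integral>\<^sup>+x\<in>ball z s. ?W x \<partial>lborel)"
    by (rule nn_integral_cover_le[OF _ Z(1,3)]) measurable
  also have "\<dots> \<le> (\<Sum>z\<in>Z. ennreal (320 * q\<^sup>2 * C4) * (\<integral>\<^sup>+x\<in>ball z (2 * s). ?W x \<partial>lborel)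
       + ennreal a * (\<integral>\<^sup>+x\<in>ball z (2 * s). 1 \<partial>lborel))"
  proof (intro sum_mono)
    fix z assume "z \<in> Z"
    then have "z \<in> ball x0 (2 * r)" using Z(2) \<rho> s_pos by auto
    from power_local[OF q(1-3) this s c0]
    show "(\<integral>\<^sup>+x\<in>ball z s. ?W x \<partial>lborel) \<le> ennreal (320 * q\<^sup>2 * C4) * (\<integral>\<^sup>+x\<in>ball z (2 * s). ?W x \<partial>lborel)
       + ennreal a * (\<integral>\<^sup>+x\<in>ball z (2 * s). 1 \<partial>lborel)" by (simp add: a_def)
  qed
  also have "\<dots> = ennreal (320 * q\<^sup>2 * C4) * (\<Sum>z\<in>Z. \<integral>\<^sup>+x\<in>ball z (2 * s). ?W x \<partial>lborel)
       + ennreal a * (\<Sum>z\<in>Z. \<integral>\<^sup>+x\<in>ball z (2 * s). 1 \<partial>lborel)"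
    by (simp add: sum.distrib sum_distrib_left)
  also have "\<dots> \<le> ennreal (320 * q\<^sup>2 * C4) * (of_nat (5 ^ DIM('a)) * ?J)
       + ennreal a * (of_nat (5 ^ DIM('a)) * (\<integral>\<^sup>+x\<in>ball x0 (\<rho> + 2 * s). 1 \<partial>lborel))"
    by (intro add_mono mult_left_mono sum_nn_integral_overlap_le[OF _ Z(1,2) ov]) auto
  also have "\<dots> = ennreal (320 * q\<^sup>2 * C4 * 5 ^ N) * ?J + ennreal (a * 5 ^ N) * emeasure lborel (ball x0 (\<rho> + 2 * s))"
    unfolding of_nat_5_power using C4_ge a by (simp add: ennreal_mult mult.assoc)
  also have "\<dots> \<le> ennreal (1/4) * ?J + ennreal (a * 5 ^ N) * ennreal (\<omega> * (2 * r) ^ N)"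
  proof (intro add_mono mult_right_mono mult_left_mono ennreal_leI)
    show "320 * q\<^sup>2 * C4 * 5 ^ N \<le> 1 / 4" using q(4) by (simp add: mult_ac)
    have "emeasure lborel (ball x0 (\<rho> + 2 * s)) \<le> emeasure lborel (ball x0 (2 * r))"
      using \<rho> by (intro emeasure_mono subset_ball) auto
    then show "emeasure lborel (ball x0 (\<rho> + 2 * s)) \<le> ennreal (\<omega> * (2 * r) ^ N)"
      using r_pos by (simp add: emeasure_ball_eq)
  qed auto
  also have "ennreal (a * 5 ^ N) * ennreal (\<omega> * (2 * r) ^ N) = ennreal (8 * exp (2 * q * (c0 + lam)) * (5 ^ N * (\<omega> * (2 * r) ^ N)) * 2 ^ m)"
    using a r_pos by (subst ennreal_mult[symmetric]) (auto simp: a_def mult_ac)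
  finally show ?thesis .
qed

text \<open>The coefficient \<open>(1/4) ^ n\<close> meets the additive term
  \<open>A * 2 ^ (n + 2)\<close>, so the errors \<open>4 * A * (1/2) ^ n\<close> have the finite sum
  \<open>8 * A\<close>.\<close>

lemma power_bound:
  assumes q: "0 < q" "q \<le> 1/4" "exp (2 * q * \<Lambda>) \<le> 2" "1280 * C4 * 5 ^ N * q\<^sup>2 \<le> 1"
    and c0: "(\<integral>\<^sup>+x\<in>ball x0 (4 * r). ennreal ((ln (v x) - c0)\<^sup>2) \<partial>lborel) \<le> ennreal (K0 * (\<omega> * (4 * r) ^ N))"
  shows "(\<integral>\<^sup>+x\<in>ball x0 r. ennreal (v x powr (2 * q)) \<partial>lborel) \<le>
    ennreal (64 * exp (2 * q * (c0 + lam)) * (5 ^ N * (\<omega> * (2 * r) ^ N)))"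
proof -
  define J where "J \<rho> = (\<integral>\<^sup>+x\<in>ball x0 \<rho>. ennreal (v x powr (2 * q)) \<partial>lborel)" for \<rho>
  define A where "A = 8 * exp (2 * q * (c0 + lam)) * (5 ^ N * (\<omega> * (2 * r) ^ N))"
  have A: "0 \<le> A" using r_pos by (simp add: A_def)
  \<comment> \<open>The radii increase from \<open>r\<close> towards \<open>2 * r\<close>.
    Consecutive ones differ by \<open>r / 2 ^ (n + 1) = 2 * (r / 2 ^ (n + 2))\<close>, hence the
    shift by 2 in the scale passed to \<open>power_step\<close>.\<close>
  define \<rho> where "\<rho> n = 2 * r - r / 2 ^ n" for n :: nat
  have \<rho>: "0 < \<rho> n" "\<rho> (Suc n) = \<rho> n + 2 * (r / 2 ^ (n + 2))" "\<rho> n \<le> 2 * r" for n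
  proof -
    have "r / 2 ^ n \<le> r / 1" using r_pos by (intro divide_left_mono) auto
    then show "0 < \<rho> n" using r_pos by (simp add: \<rho>_def)
    show "\<rho> (Suc n) = \<rho> n + 2 * (r / 2 ^ (n + 2))" by (simp add: \<rho>_def field_simps)
    show "\<rho> n \<le> 2 * r" using r_pos by (simp add: \<rho>_def)
  qed
  have J_mono: "\<rho> \<le> \<rho>' \<Longrightarrow> J \<rho> \<le> J \<rho>'" for \<rho> \<rho>'
    unfolding J_def using subset_ball[of \<rho> \<rho>' x0] by (intro nn_integral_mono) (auto simp: indicator_def)
  have step: "J (\<rho> n) \<le> ennreal (1/4) * J (\<rho> (Suc n)) + ennreal (A * 2 ^ (n + 2))" for n
    unfolding J_def A_def \<rho>(2)
    by (rule power_step[OF q \<rho>(1) _ refl c0]) (use \<rho>(2,3)[of "Suc n"] \<rho>(2)[of n] in simp)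
  have iter: "J r \<le> ennreal ((1/4) ^ n) * J (\<rho> n) + ennreal (8 * A * (1 - (1/2) ^ n))" for n
  proof (induction n)
    case 0
    then show ?case by (simp add: \<rho>_def)
  next
    case (Suc n)
    have p: "(1/2::real) ^ n \<le> 1" by (intro power_le_one) auto
    have "J r \<le> ennreal ((1/4) ^ n) * J (\<rho> n) + ennreal (8 * A * (1 - (1/2) ^ n))" by (rule Suc)
    also have "\<dots> \<le> ennreal ((1/4) ^ n) * (ennreal (1/4) * J (\<rho> (Suc n)) + ennreal (A * 2 ^ (n + 2))) + ennreal (8 * A * (1 - (1/2) ^ n))"
      by (intro add_right_mono mult_left_mono step) auto
    also have "\<dots> = ennreal ((1/4) ^ n) * ennreal (1/4) * J (\<rho> (Suc n)) + (ennreal ((1/4) ^ n) * ennreal (A * 2 ^ (n + 2)) + ennreal (8 * A * (1 - (1/2) ^ n)))"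
      by (simp add: distrib_left mult.assoc add.assoc)
    also have "ennreal ((1/4) ^ n) * ennreal (1/4) = ennreal ((1/4) ^ Suc n)"
      by (subst ennreal_mult[symmetric]) (auto simp: mult.commute)
    also have "ennreal ((1/4) ^ n) * ennreal (A * 2 ^ (n + 2)) + ennreal (8 * A * (1 - (1/2) ^ n)) = ennreal (8 * A * (1 - (1/2) ^ Suc n))"
    proof -
      have "(1/4::real) ^ n * 2 ^ n = (1/2) ^ n" by (simp flip: power_mult_distrib)
      then have "(1/4) ^ n * (A * 2 ^ (n + 2)) = 4 * A * (1/2) ^ n" by (simp add: power_add mult_ac)
      then show ?thesis using A p mult_left_mono[OF p A]
        by (subst ennreal_mult[symmetric], simp, simp, subst ennreal_plus[symmetric]) (auto simp: algebra_simps)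
    qed
    finally show ?case .
  qed
  \<comment> \<open>Qualitative finiteness suffices, since it enters only through the remainder
    \<open>(1/4) ^ n * J (\<rho> n)\<close>, which tends to 0.\<close>
  have "J (2 * r) < \<infinity>"
  proof -
    have "J (2 * r) \<le> (\<integral>\<^sup>+x. ennreal (2 + d) * (ennreal (1 + (u x)\<^sup>2) * indicator (ball x0 (R / 2)) x) \<partial>lborel)"
      unfolding J_def
    proof (intro nn_integral_mono)
      fix x
      have sub: "ball x0 (2 * r) \<subseteq> ball x0 (R / 2)" "ball x0 (2 * r) \<subseteq> ball x0 R"
        using r_pos r_less by (auto intro!: subset_ball)
      have "v x powr (2 * q) \<le> (2 + d) * (1 + (u x)\<^sup>2)" if "x \<in> ball x0 (2 * r)"
      proof -
        have vx: "v x = u x + d" "0 \<le> u x" using that sub v_eq u_nonneg by blast+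
        have "v x powr (2 * q) \<le> (1 + v x) powr (2 * q)" using q v_pos[of x] by (intro powr_mono2) auto
        also have "\<dots> \<le> (1 + v x) powr 1" using q v_pos[of x] by (intro powr_mono) auto
        also have "\<dots> = 1 + d + u x" using v_pos[of x] vx by simp
        also have "u x \<le> 1 + (u x)\<^sup>2" using zero_le_power2[of "u x - 1"] vx by (simp add: power2_diff)
        also have "1 + d + (1 + (u x)\<^sup>2) \<le> (2 + d) * (1 + (u x)\<^sup>2)" using d_pos by (simp add: algebra_simps)
        finally show ?thesis by simp
      qed
      then have "x \<in> ball x0 (2 * r) \<Longrightarrow> ennreal (v x powr (2 * q)) \<le> ennreal (2 + d) * ennreal (1 + (u x)\<^sup>2)"
        using d_pos by (subst ennreal_mult[symmetric]) (auto intro!: ennreal_leI simp del: mem_ball)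
      then show "ennreal (v x powr (2 * q)) * indicator (ball x0 (2 * r)) x \<le> ennreal (2 + d) * (ennreal (1 + (u x)\<^sup>2) * indicator (ball x0 (R / 2)) x)"
        using sub by (auto simp: indicator_def simp del: mem_ball)
    qed
    also have "\<dots> = ennreal (2 + d) * (\<integral>\<^sup>+x\<in>ball x0 (R / 2). ennreal (1 + (u x)\<^sup>2) \<partial>lborel)"
      by (rule nn_integral_cmult) simp
    also have "\<dots> < \<infinity>" using u_finite_half_ball by (simp add: ennreal_mult_less_top)
    finally show ?thesis .
  qed
  then obtain j where j: "J (2 * r) = ennreal j" "0 \<le> j" by (cases "J (2 * r)") auto
  have "J r \<le> ennreal ((1/4) ^ n * j + 8 * A)" for n
  proof -
    have "J r \<le> ennreal ((1/4) ^ n) * ennreal j + ennreal (8 * A)"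
      by (rule order_trans[OF iter[of n]])
         (intro add_mono mult_left_mono ennreal_leI, use J_mono[OF \<rho>(3)] j A in \<open>auto simp: mult_le_cancel_left1 mult_left_le\<close>)
    also have "\<dots> = ennreal ((1/4) ^ n * j + 8 * A)" using j A by (simp add: ennreal_mult)
    finally show ?thesis .
  qed
  moreover have "(\<lambda>n. ennreal ((1/4) ^ n * j + 8 * A)) \<longlonglongrightarrow> ennreal (0 * j + 8 * A)"
    by (intro tendsto_ennrealI tendsto_intros LIMSEQ_realpow_zero) auto
  ultimately have "J r \<le> ennreal (0 * j + 8 * A)" by (intro LIMSEQ_le_const) auto
  then show ?thesis by (simp add: J_def A_def mult_ac)
qed

text \<open>
  On balls of radius \<open>s\<close> the truncation vanishes on half of the ball, so Poincare's inequality on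
  them carries no mean value; summing over a covering by such balls replaces a Sobolev inequality,
  and the gain is the factor \<open>(s / \<delta>) powr \<alpha>\<close>.
\<close>

lemma de_giorgi_step:
  assumes \<rho>': "0 < \<rho>'" and s: "0 < s" and \<delta>: "0 < \<delta>" "\<delta> \<le> 2 * r" and \<rho>: "\<rho>' + s + 2 * \<delta> \<le> \<rho>" "\<rho> \<le> 14 * r"
    and l: "l' < l" "0 \<le> l"
    and small: "emeasure lborel {x \<in> ball x0 \<rho>. v x < l} \<le> ennreal (\<omega> * s ^ N / 2)"
  shows "ennreal ((l - l')\<^sup>2) * emeasure lborel {x \<in> ball x0 \<rho>'. v x < l'} \<le>
    ennreal (10 * C1 * 5 ^ N * Cc * (s powr \<alpha> * \<delta> powr (- \<alpha>)) * l\<^sup>2) * emeasure lborel {x \<in> ball x0 \<rho>. v x < l}"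
proof -
  define w where "w x = max (l - v x) 0" for x
  have [measurable]: "w \<in> borel_measurable borel" unfolding w_def[abs_def] by measurable
  define Q where "Q = quadratic_form \<mu> (ball x0 (\<rho>' + s)) w"
  obtain Z where Z: "finite Z" "Z \<subseteq> ball x0 \<rho>'" "ball x0 \<rho>' \<subseteq> (\<Union>z\<in>Z. ball z s)"
    and ov2: "\<And>y. card {z \<in> Z. y \<in> ball z (2 * s)} \<le> 5 ^ DIM('a)"
    by (rule ball_covering[OF s \<rho>']) blast
  have ov: "card {z \<in> Z. y \<in> ball z s} \<le> 5 ^ DIM('a)" for y
    by (rule order_trans[OF card_mono ov2[of y]]) (use Z(1) s in auto)
  have loc: "(\<integral>\<^sup>+x\<in>ball z s. ennreal ((w x)\<^sup>2) \<partial>lborel) \<le> ennreal (10 * C1 * s powr \<alpha>) * quadratic_form \<mu> (ball z s) w"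
    if z: "z \<in> Z" for z
  proof -
    have zb: "z \<in> ball x0 \<rho>'" using z Z(2) by blast
    have sub: "ball z s \<subseteq> ball x0 \<rho>" by (rule ball_x0_sub[OF zb]) (use \<rho> \<delta> in auto)
    have "ball x0 \<rho> \<subseteq> ball x0 R" using \<rho> r_less r_pos by (intro subset_ball) auto
    with sub have bR: "ball z s \<subseteq> ball x0 R" by blast
    obtain c where c: "(\<integral>\<^sup>+x\<in>ball z s. ennreal ((w x - c)\<^sup>2) \<partial>lborel) \<le> ennreal (C1 * s powr \<alpha>) * quadratic_form \<mu> (ball z s) w"
      unfolding w_def by (rule local_poincare[OF admissible_truncation[OF d_pos] s bR])
    \<comment> \<open>The threshold is 0, so the additive term of
      \<open>nn_integral_square_le_deviation\<close> disappears.\<close>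
    have half: "emeasure lborel (ball z s) \<le> 2 * emeasure lborel {x \<in> ball z s. w x \<le> 0}"
    proof (rule emeasure_le_twice_complement[OF _ _ _ _ _ _ small])
      show "emeasure lborel (ball z s) = ennreal (\<omega> * s ^ N)" using s by (simp add: emeasure_ball_eq)
      show "ball z s \<subseteq> {x \<in> ball x0 \<rho>. v x < l} \<union> {x \<in> ball z s. w x \<le> 0}"
        using sub by (auto simp: w_def simp del: mem_ball)
    qed (use s in auto)
    have "(\<integral>\<^sup>+x\<in>ball z s. ennreal ((w x)\<^sup>2) \<partial>lborel) \<le> 10 * (\<integral>\<^sup>+x\<in>ball z s. ennreal ((w x - c)\<^sup>2) \<partial>lborel)"
      using nn_integral_square_le_deviation[OF _ _ _ _ half, of c] by (simp add: w_def)
    also have "\<dots> \<le> 10 * (ennreal (C1 * s powr \<alpha>) * quadratic_form \<mu> (ball z s) w)"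
      by (intro mult_left_mono c) auto
    also have "\<dots> = ennreal (10 * C1 * s powr \<alpha>) * quadratic_form \<mu> (ball z s) w"
      using C1_ge_1 by (simp add: ennreal_mult mult.assoc)
    finally show ?thesis .
  qed
  have [measurable]: "{x \<in> ball x0 \<rho>. v x < l} \<in> sets borel" "{x \<in> ball x0 \<rho>'. v x < l'} \<in> sets borel" by measurable
  have "Q \<le> ennreal (Cc * \<delta> powr (- \<alpha>)) * (\<integral>\<^sup>+x\<in>ball x0 (\<rho>' + s + 2 * \<delta>). ennreal (l\<^sup>2 * indicator {..<l} (v x)) \<partial>lborel)"
    unfolding Q_def w_def
    by (rule energy_le[OF admissible_truncation[OF d_pos] \<delta>]) (use \<rho> r_less r_pos in \<open>intro subset_ball; simp\<close>)
  also have "\<dots> \<le> ennreal (Cc * \<delta> powr (- \<alpha>)) * (\<integral>\<^sup>+x. ennreal (l\<^sup>2) * indicator {x \<in> ball x0 \<rho>. v x < l} x \<partial>lborel)"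
    using \<rho> by (intro mult_left_mono nn_integral_mono) (auto simp: indicator_def)
  also have "\<dots> = ennreal (Cc * \<delta> powr (- \<alpha>)) * (ennreal (l\<^sup>2) * emeasure lborel {x \<in> ball x0 \<rho>. v x < l})"
    by (subst nn_integral_cmult_indicator) auto
  finally have Q: "Q \<le> ennreal (Cc * \<delta> powr (- \<alpha>)) * (ennreal (l\<^sup>2) * emeasure lborel {x \<in> ball x0 \<rho>. v x < l})" .
  have "ennreal ((l - l')\<^sup>2) * emeasure lborel {x \<in> ball x0 \<rho>'. v x < l'} =
      (\<integral>\<^sup>+x. ennreal ((l - l')\<^sup>2) * indicator {x \<in> ball x0 \<rho>'. v x < l'} x \<partial>lborel)"
    by (subst nn_integral_cmult_indicator) auto
  also have "\<dots> \<le> (\<integral>\<^sup>+x\<in>ball x0 \<rho>'. ennreal ((w x)\<^sup>2) \<partial>lborel)"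
    using l by (intro nn_integral_mono) (auto simp: indicator_def w_def intro!: ennreal_leI power_mono)
  also have "\<dots> \<le> (\<Sum>z\<in>Z. \<integral>\<^sup>+x\<in>ball z s. ennreal ((w x)\<^sup>2) \<partial>lborel)"
    by (rule nn_integral_cover_le[OF _ Z(1,3)]) measurable
  also have "\<dots> \<le> (\<Sum>z\<in>Z. ennreal (10 * C1 * s powr \<alpha>) * quadratic_form \<mu> (ball z s) w)"
    by (intro sum_mono loc)
  also have "\<dots> = ennreal (10 * C1 * s powr \<alpha>) * (\<Sum>z\<in>Z. quadratic_form \<mu> (ball z s) w)"
    by (simp add: sum_distrib_left)
  also have "\<dots> \<le> ennreal (10 * C1 * s powr \<alpha>) * (of_nat (5 ^ DIM('a)) * Q)"
    unfolding Q_def by (intro mult_left_mono sum_quadratic_form_overlap_le Z ov) auto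
  also have "\<dots> \<le> ennreal (10 * C1 * s powr \<alpha>) * (of_nat (5 ^ DIM('a)) * (ennreal (Cc * \<delta> powr (- \<alpha>)) * (ennreal (l\<^sup>2) * emeasure lborel {x \<in> ball x0 \<rho>. v x < l})))"
    by (intro mult_left_mono Q) auto
  also have "\<dots> = ennreal (10 * C1 * 5 ^ N * Cc * (s powr \<alpha> * \<delta> powr (- \<alpha>)) * l\<^sup>2) * emeasure lborel {x \<in> ball x0 \<rho>. v x < l}"
  proof -
    have "ennreal (10 * C1 * s powr \<alpha>) * (ennreal (5 ^ N) * (ennreal (Cc * \<delta> powr (- \<alpha>)) * ennreal (l\<^sup>2))) =
      ennreal (10 * C1 * 5 ^ N * Cc * (s powr \<alpha> * \<delta> powr (- \<alpha>)) * l\<^sup>2)"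
      using C1_ge_1 Cc_ge by (simp add: ennreal_mult[symmetric] mult_ac)
    then show ?thesis unfolding of_nat_5_power by (simp only: mult.assoc[symmetric])
  qed
  finally show ?thesis .
qed

end

subsection \<open>Lower bound and weak Harnack inequality\<close>

text \<open>These are the demands of the power iteration: validity of the power test, growth of the
  threshold by at most 2 per halving, and, with \<open>B = 1280 * C4 * 5 ^ N\<close>, a coefficient
  of at most \<open>1/4\<close> once overlap is counted.\<close>

lemma exponent_exists:
  fixes \<Lambda> :: real assumes "0 < \<Lambda>" "0 < B"
  obtains q :: real where "0 < q" "q \<le> 1/4" "exp (2 * q * \<Lambda>) \<le> 2" "B * q\<^sup>2 \<le> 1"
proof -
  define q where "q = min (1/4) (min (ln 2 / (2 * \<Lambda>)) (1 / sqrt B))"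
  have q: "0 < q" "q \<le> 1/4" "q \<le> ln 2 / (2 * \<Lambda>)" "q \<le> 1 / sqrt B"
    using assms by (auto simp: q_def)
  have "2 * q * \<Lambda> \<le> ln 2" using q(3) assms by (simp add: field_simps)
  then have "exp (2 * q * \<Lambda>) \<le> exp (ln 2)" by (simp only: exp_le_cancel_iff)
  then have "exp (2 * q * \<Lambda>) \<le> 2" by simp
  moreover have "q\<^sup>2 \<le> (1 / sqrt B)\<^sup>2" using q by (intro power_mono) auto
  then have "B * q\<^sup>2 \<le> 1" using assms by (simp add: power_divide field_simps)
  ultimately show ?thesis using that q by blast
qed

text \<open>\<open>\<tau>\<close> is fixed by requiring that the gain
  \<open>((2 * \<tau>) powr \<alpha>) ^ j\<close> decay like the squared level gaps, that is like
  \<open>(1/4) ^ j\<close>. Then \<open>\<sigma>\<close> makes the remaining factor at most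
  \<open>\<tau> ^ N\<close>, the volume ratio of consecutive small balls.\<close>

lemma geometric_scales_exist:
  fixes \<alpha> G :: real assumes "0 < \<alpha>" "1 \<le> G"
  obtains \<tau> \<sigma> :: real where "0 < \<tau>" "\<tau> \<le> 1/2" "(2 * \<tau>) powr \<alpha> = 1/4" "0 < \<sigma>" "\<sigma> \<le> 1/4"
    "G * (4 * \<sigma>) powr \<alpha> \<le> \<tau> ^ N"
proof -
  define \<tau> :: real where "\<tau> = (1/4) powr (1/\<alpha>) / 2"
  define \<sigma> where "\<sigma> = (\<tau> ^ N / G) powr (1/\<alpha>) / 4"
  have "(1/4::real) powr (1/\<alpha>) \<le> 1" using assms by (intro powr_le1) auto
  then have t: "0 < \<tau>" "\<tau> \<le> 1/2" by (auto simp: \<tau>_def)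
  have t2: "(2 * \<tau>) powr \<alpha> = 1/4" using assms by (simp add: \<tau>_def powr_powr)
  have "\<tau> ^ N \<le> 1" using t by (intro power_le_one) auto
  define y where "y = \<tau> ^ N / G"
  have y: "0 < y" "y \<le> 1" using \<open>\<tau> ^ N \<le> 1\<close> t assms by (auto simp: y_def divide_le_eq)
  then have "y powr (1/\<alpha>) \<le> 1" "0 < y powr (1/\<alpha>)" using assms by (auto intro!: powr_le1)
  then have s: "0 < \<sigma>" "\<sigma> \<le> 1/4" by (simp_all add: \<sigma>_def y_def)
  have "G * (4 * \<sigma>) powr \<alpha> = G * y" using assms y by (simp add: \<sigma>_def y_def[symmetric] powr_powr)
  then have "G * (4 * \<sigma>) powr \<alpha> = \<tau> ^ N" using assms by (simp add: y_def)
  then show ?thesis using that t t2 s by auto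
qed

lemma ennreal_le_divide:
  assumes p: "0 < p" and le: "ennreal p * a \<le> ennreal b"
  shows "a \<le> ennreal (b / p)"
proof -
  have "ennreal (1 / p) * (ennreal p * a) \<le> ennreal (1 / p) * ennreal b" by (intro mult_left_mono le) auto
  also have "ennreal (1 / p) * (ennreal p * a) = a" using p by (simp add: mult.assoc[symmetric] ennreal_mult[symmetric])
  also have "ennreal (1 / p) * ennreal b = ennreal (b / p)" using p by (simp add: ennreal_mult'[symmetric])
  finally show ?thesis .
qed

section \<open>De Giorgi iteration and the estimates for \<open>v\<close>\<close>

context weak_supersolution
begin

text \<open>The induction hypothesis is itself the smallness required by
  \<open>de_giorgi_step\<close>: the sublevel set has at most half the volume of a ball of radius
  \<open>s j\<close>. The gain \<open>(s j / \<delta> j) powr \<alpha> = (4 * \<sigma>) powr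
  \<alpha> * (1/4) ^ j\<close> pays for dividing by the squared level gap.\<close>

lemma de_giorgi:
  assumes \<tau>: "0 < \<tau>" "\<tau> \<le> 1/2" "(2 * \<tau>) powr \<alpha> = 1/4" and \<sigma>: "0 < \<sigma>" "\<sigma> \<le> 1/4"
    and G: "160 * C1 * 5 ^ N * Cc * (4 * \<sigma>) powr \<alpha> \<le> \<tau> ^ N"
    and k: "0 < k" and small: "emeasure lborel {x \<in> ball x0 (4 * r). v x < k} \<le> ennreal (\<omega> * (r * \<sigma>) ^ N / 2)"
  shows "AE x in lborel. x \<in> ball x0 (2 * r) \<longrightarrow> k / 2 \<le> v x"
proof -
  \<comment> \<open>Radii fall from \<open>4 * r\<close> towards \<open>2 * r\<close> and levels
    from \<open>k\<close> towards \<open>k / 2\<close>. The drop \<open>r / 2 ^ j\<close> of the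
    radius has room for \<open>s j \<le> r / 2 ^ j / 4\<close> and for the two collars
    \<open>2 * \<delta> j = r / 2 ^ j / 2\<close>.\<close>
  define \<rho> where "\<rho> j = 2 * r + 2 * r / 2 ^ j" for j :: nat
  define l where "l j = k / 2 + k / 2 / 2 ^ j" for j :: nat
  define s where "s j = r * \<sigma> * \<tau> ^ j" for j :: nat
  define \<delta> where "\<delta> j = r / 2 ^ j / 4" for j :: nat
  have p1: "r / 2 ^ j \<le> r" "k / 2 / 2 ^ j \<le> k / 2" for j
    using r_pos k divide_left_mono[of 1 "2 ^ j" r] divide_left_mono[of 1 "2 ^ j" "k/2"] by auto
  have s_le: "s j \<le> r / 2 ^ j / 4" "0 < s j" for j
  proof -
    have "\<sigma> * \<tau> ^ j \<le> 1/4 * (1/2) ^ j" using \<tau> \<sigma> by (intro mult_mono power_mono) auto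
    then have "r * (\<sigma> * \<tau> ^ j) \<le> r * (1/4 * (1/2) ^ j)" using r_pos by (intro mult_left_mono) auto
    then show "s j \<le> r / 2 ^ j / 4" by (simp add: s_def power_one_over mult_ac)
    show "0 < s j" using r_pos \<tau> \<sigma> by (simp add: s_def)
  qed
  have claim: "emeasure lborel {x \<in> ball x0 (\<rho> j). v x < l j} \<le> ennreal (\<omega> * s j ^ N / 2)" for j
  proof (induction j)
    case 0
    then show ?case using small by (simp add: \<rho>_def l_def s_def)
  next
    case (Suc j)
    let ?c = "10 * C1 * 5 ^ N * Cc * (s j powr \<alpha> * \<delta> j powr (- \<alpha>)) * (l j)\<^sup>2"
    have c: "0 \<le> ?c" using C1_ge_1 Cc_ge by simp
    have ll: "l j - l (Suc j) = k / 4 / 2 ^ j" by (simp add: l_def field_simps)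
    have lk: "0 \<le> l j" "l j \<le> k" using k p1(2)[of j] by (auto simp: l_def)
    have "ennreal ((l j - l (Suc j))\<^sup>2) * emeasure lborel {x \<in> ball x0 (\<rho> (Suc j)). v x < l (Suc j)} \<le> ennreal ?c * emeasure lborel {x \<in> ball x0 (\<rho> j). v x < l j}"
    proof (rule de_giorgi_step[OF _ s_le(2) _ _ _ _ _ lk(1) Suc])
      show "0 < \<rho> (Suc j)" using r_pos by (simp add: \<rho>_def add_pos_pos)
      show "0 < \<delta> j" "\<delta> j \<le> 2 * r" using r_pos p1(1)[of j] by (auto simp: \<delta>_def)
      have "\<rho> j - \<rho> (Suc j) = r / 2 ^ j" by (simp add: \<rho>_def field_simps)
      then show "\<rho> (Suc j) + s j + 2 * \<delta> j \<le> \<rho> j" using s_le[of j] by (simp add: \<delta>_def)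
      show "\<rho> j \<le> 14 * r" using r_pos p1(1)[of j] by (simp add: \<rho>_def)
      show "l (Suc j) < l j" using ll k by (simp add: algebra_simps)
    qed
    also have "\<dots> \<le> ennreal ?c * ennreal (\<omega> * s j ^ N / 2)" by (intro mult_left_mono Suc) auto
    also have "\<dots> = ennreal (?c * (\<omega> * s j ^ N / 2))" using c s_le(2)[of j] by (intro ennreal_mult[symmetric]) auto
    finally have "emeasure lborel {x \<in> ball x0 (\<rho> (Suc j)). v x < l (Suc j)} \<le> ennreal (?c * (\<omega> * s j ^ N / 2) / (l j - l (Suc j))\<^sup>2)"
      by (rule ennreal_le_divide[rotated]) (use ll k in simp)
    also have "\<dots> \<le> ennreal (\<omega> * s (Suc j) ^ N / 2)"
    proof (rule ennreal_leI)
      have "s j / \<delta> j = 4 * \<sigma> * (2 * \<tau>) ^ j" using r_pos by (simp add: s_def \<delta>_def power_mult_distrib)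
      then have "s j powr \<alpha> * \<delta> j powr (- \<alpha>) = (4 * \<sigma> * (2 * \<tau>) ^ j) powr \<alpha>"
        using s_le(2)[of j] r_pos by (simp add: powr_minus \<delta>_def divide_inverse[symmetric] powr_divide[symmetric])
      also have "\<dots> = (4 * \<sigma>) powr \<alpha> * ((2 * \<tau>) powr \<alpha>) ^ j"
      proof -
        have "(t ^ j) powr \<alpha> = (t powr \<alpha>) ^ j" if "0 < t" for t :: real
          using that by (simp add: powr_realpow[symmetric] powr_powr mult.commute)
        from this[of "2 * \<tau>"] show ?thesis using \<tau>(1) \<sigma> by (subst powr_mult) auto
      qed
      also have "\<dots> = (4 * \<sigma>) powr \<alpha> * (1/4) ^ j" by (simp only: \<tau>(3))
      finally have sd: "s j powr \<alpha> * \<delta> j powr (- \<alpha>) = (4 * \<sigma>) powr \<alpha> * (1/4) ^ j" .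
      have "?c \<le> 10 * C1 * 5 ^ N * Cc * (s j powr \<alpha> * \<delta> j powr (- \<alpha>)) * k\<^sup>2"
        using C1_ge_1 Cc_ge lk by (intro mult_left_mono power_mono) auto
      \<comment> \<open>The squared level gap is \<open>k\<^sup>2 / 16 * (1/4) ^ j\<close>, and
        \<open>160 = 10 * 16\<close>.\<close>
      also have "\<dots> = (160 * C1 * 5 ^ N * Cc * (4 * \<sigma>) powr \<alpha>) * (l j - l (Suc j))\<^sup>2"
      proof -
        have "(k / 4 / 2 ^ j)\<^sup>2 = k\<^sup>2 / 16 * (1/4) ^ j"
        proof -
          have "(4::real) ^ j = 2 ^ j * 2 ^ j" by (simp flip: power_mult_distrib)
          then show ?thesis by (simp add: power_divide power_one_over power2_eq_square)
        qed
        then show ?thesis unfolding sd ll by simp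
      qed
      also have "\<dots> \<le> \<tau> ^ N * (l j - l (Suc j))\<^sup>2" by (intro mult_right_mono G) auto
      finally have "?c / (l j - l (Suc j))\<^sup>2 \<le> \<tau> ^ N" using ll k by (simp add: divide_le_eq)
      then have "?c / (l j - l (Suc j))\<^sup>2 * (\<omega> * s j ^ N / 2) \<le> \<tau> ^ N * (\<omega> * s j ^ N / 2)"
        using s_le(2)[of j] by (intro mult_right_mono) auto
      also have "\<dots> = \<omega> * s (Suc j) ^ N / 2" by (simp add: s_def power_mult_distrib)
      finally show "?c * (\<omega> * s j ^ N / 2) / (l j - l (Suc j))\<^sup>2 \<le> \<omega> * s (Suc j) ^ N / 2" by (simp add: mult_ac)
    qed
    finally show ?case .
  qed
  let ?A = "{x \<in> ball x0 (2 * r). v x < k / 2}"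
  have [measurable]: "?A \<in> sets borel" by measurable
  have "emeasure lborel ?A \<le> ennreal (\<omega> * s j ^ N / 2)" for j
  proof (rule order_trans[OF emeasure_mono claim[of j]])
    have "k / 2 \<le> l j" "2 * r \<le> \<rho> j" using k r_pos by (auto simp: l_def \<rho>_def)
    then show "?A \<subseteq> {x \<in> ball x0 (\<rho> j). v x < l j}" by auto
  qed measurable
  moreover have "(\<lambda>j. ennreal (\<omega> * s j ^ N / 2)) \<longlonglongrightarrow> ennreal (\<omega> * (r * \<sigma> * 0) ^ N / 2)"
    unfolding s_def using \<tau> by (intro tendsto_ennrealI tendsto_intros LIMSEQ_realpow_zero) auto
  ultimately have "emeasure lborel ?A \<le> ennreal (\<omega> * (r * \<sigma> * 0) ^ N / 2)" by (intro LIMSEQ_le_const) auto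
  also have "\<dots> = 0" using DIM_positive[where 'a='a] by simp
  finally have "?A \<in> null_sets lborel" by (intro null_setsI) auto
  then have "AE x in lborel. x \<notin> ?A" by (rule AE_not_in)
  then show ?thesis by eventually_elim auto
qed

text \<open>Both conclusions are tied to the same \<open>c\<close>; eliminating \<open>exp c\<close>
  between them yields the Harnack inequality.\<close>

theorem weak_harnack:
  assumes q: "0 < q" "q \<le> 1/4" "exp (2 * q * \<Lambda>) \<le> 2" "1280 * C4 * 5 ^ N * q\<^sup>2 \<le> 1"
    and \<tau>: "0 < \<tau>" "\<tau> \<le> 1/2" "(2 * \<tau>) powr \<alpha> = 1/4" and \<sigma>: "0 < \<sigma>" "\<sigma> \<le> 1/4"
    and G: "160 * C1 * 5 ^ N * Cc * (4 * \<sigma>) powr \<alpha> \<le> \<tau> ^ N"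
  obtains c where "(\<integral>\<^sup>+x\<in>ball x0 r. ennreal (v x powr (2 * q)) \<partial>lborel) \<le>
      ennreal (64 * 10 ^ N * exp (2 * q * lam) * exp (2 * q * c) * (\<omega> * r ^ N))"
    "AE x in lborel. x \<in> ball x0 (2 * r) \<longrightarrow> exp (c - sqrt (2 * K0 * (4 / \<sigma>) ^ N)) / 2 \<le> v x"
proof -
  obtain c where c: "(\<integral>\<^sup>+x\<in>ball x0 (4 * r). ennreal ((ln (v x) - c)\<^sup>2) \<partial>lborel) \<le> ennreal (K0 * (\<omega> * (4 * r) ^ N))"
    by (rule log_oscillation[of "4 * r" x0]) (use r_pos r_less in \<open>auto intro!: subset_ball\<close>)
  have "(\<integral>\<^sup>+x\<in>ball x0 r. ennreal (v x powr (2 * q)) \<partial>lborel) \<le>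
    ennreal (64 * exp (2 * q * (c + lam)) * (5 ^ N * (\<omega> * (2 * r) ^ N)))"
    by (rule power_bound[OF q c])
  also have "64 * exp (2 * q * (c + lam)) * (5 ^ N * (\<omega> * (2 * r) ^ N)) = 64 * 10 ^ N * exp (2 * q * lam) * exp (2 * q * c) * (\<omega> * r ^ N)"
  proof -
    have "(10::real) ^ N = 5 ^ N * 2 ^ N" by (simp flip: power_mult_distrib)
    then show ?thesis by (simp add: power_mult_distrib distrib_left exp_add)
  qed
  finally have 1: "(\<integral>\<^sup>+x\<in>ball x0 r. ennreal (v x powr (2 * q)) \<partial>lborel) \<le>
      ennreal (64 * 10 ^ N * exp (2 * q * lam) * exp (2 * q * c) * (\<omega> * r ^ N))" .
  \<comment> \<open>Chosen so that Chebyshev's inequality on \<open>ball x0 (4 * r)\<close> gives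
    exactly half the volume of a ball of radius \<open>r * \<sigma>\<close>, the starting condition
    of \<open>de_giorgi\<close>.\<close>
  define l where "l = sqrt (2 * K0 * (4 / \<sigma>) ^ N)"
  have l: "0 < l" "l\<^sup>2 = 2 * K0 * (4 / \<sigma>) ^ N" using K0_ge \<sigma> by (auto simp: l_def)
  have "emeasure lborel {x \<in> ball x0 (4 * r). v x < exp (c - l)} \<le> emeasure lborel {x \<in> ball x0 (4 * r). l \<le> \<bar>ln (v x) - c\<bar>}"
  proof (rule emeasure_mono)
    show "{x \<in> ball x0 (4 * r). v x < exp (c - l)} \<subseteq> {x \<in> ball x0 (4 * r). l \<le> \<bar>ln (v x) - c\<bar>}"
    proof safe
      fix x assume "v x < exp (c - l)"
      then have "ln (v x) < c - l" using v_pos[of x] by (metis exp_gt_zero ln_exp ln_less_cancel_iff)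
      then show "l \<le> \<bar>ln (v x) - c\<bar>" by simp
    qed
  qed measurable
  also have "\<dots> \<le> ennreal (K0 * (\<omega> * (4 * r) ^ N) / l\<^sup>2)"
    by (rule chebyshev_deviation[OF _ _ l(1) c]) measurable
  also have "K0 * (\<omega> * (4 * r) ^ N) / l\<^sup>2 = \<omega> * (r * \<sigma>) ^ N / 2"
    unfolding l(2) using K0_ge \<sigma> by (simp add: power_divide power_mult_distrib)
  finally have "AE x in lborel. x \<in> ball x0 (2 * r) \<longrightarrow> exp (c - l) / 2 \<le> v x"
    by (intro de_giorgi[OF \<tau> \<sigma> G]) auto
  with 1 show ?thesis unfolding l_def by (rule that)
qed

end

subsection \<open>Reduction to Borel functions\<close>

lemma borel_measurable_completion_AE:
  assumes f: "f \<in> borel_measurable (completion M)" and ae: "AE x in completion M. f x = g x"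
  shows "g \<in> borel_measurable (completion M)"
proof (rule measurableI)
  fix A :: "'b set" assume A: "A \<in> sets borel"
  show "g -` A \<inter> space (completion M) \<in> sets (completion M)"
  proof (rule completion.in_sets_AE)
    show "f -` A \<inter> space (completion M) \<in> sets (completion M)" using f A by (rule measurable_sets)
    show "AE x in completion M. x \<in> f -` A \<inter> space (completion M) \<longleftrightarrow> x \<in> g -` A \<inter> space (completion M)"
      using ae by eventually_elim auto
  qed auto
qed auto

text \<open>For a complete measure, functions equal almost everywhere are measurable together; if
  they are not measurable, both integrals have the default value 0. The inner integrals of
  \<open>bilinear_form\<close> call for this generality.\<close>

lemma integral_completion_cong_AE:
  fixes f g :: "'a \<Rightarrow> real"
  assumes ae: "AE x in completion M. f x = g x"
  shows "integral\<^sup>L (completion M) f = integral\<^sup>L (completion M) g"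
proof (cases "f \<in> borel_measurable (completion M)")
  case True
  then show ?thesis using ae borel_measurable_completion_AE by (intro integral_cong_AE)
next
  case False
  have "AE x in completion M. g x = f x" using ae by eventually_elim simp
  then have "g \<notin> borel_measurable (completion M)" using False borel_measurable_completion_AE by blast
  then show ?thesis using False
    by (metis borel_measurable_integrable not_integrable_integral_eq)
qed

context nonlocal_kernel
begin

text \<open>Symmetry for a null set \<open>N\<close> and its complement: the integral over
  \<open>- N\<close> of the mass sent into \<open>N\<close> equals an integral over
  \<open>N\<close>, which is 0. So for almost every \<open>x\<close> a change of a function on
  \<open>N\<close> is invisible to \<open>\<mu> x\<close>.\<close>

lemma AE_lborel_AE_mu:
  assumes "AE x in lborel. P x"
  shows "AE x in lebesgue. AE y in \<mu> x. P y"
proof -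
  obtain N where N: "N \<in> null_sets lborel" "{x. \<not> P x} \<subseteq> N"
  proof -
    obtain N where "\<And>x. x \<in> space lborel - N \<Longrightarrow> P x" "N \<in> null_sets lborel"
      using AE_E3[OF assms] by blast
    then show ?thesis by (intro that[of N]) auto
  qed
  then have [measurable]: "N \<in> sets borel" by auto
  have m[measurable]: "(\<lambda>x. emeasure (\<mu> x) N) \<in> borel_measurable lebesgue" by (rule measurable_emeasure_mu) simp
  have "- N \<in> sets lborel" by simp
  then have [measurable]: "- N \<in> sets lebesgue" by (rule sets_completionI_sets)
  have "(\<integral>\<^sup>+x\<in>- N. emeasure (\<mu> x) N \<partial>lebesgue) = (\<integral>\<^sup>+x\<in>N. emeasure (\<mu> x) (- N) \<partial>lebesgue)"
    by (rule symmetric_rect) auto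
  also have "\<dots> = 0"
    using N(1) by (simp add: nn_integral_completion nn_integral_null_set)
  finally have "AE x in lebesgue. emeasure (\<mu> x) N * indicator (- N) x = 0"
    by (subst (asm) nn_integral_0_iff_AE) auto
  moreover have "AE x in lebesgue. x \<notin> N" using N(1) by (intro AE_completion AE_not_in)
  ultimately show ?thesis
  proof eventually_elim
    case (elim x)
    then have "N \<in> null_sets (\<mu> x)" by (auto simp: sets_mu intro!: null_setsI)
    then show ?case using N(2) by (intro AE_I'[of N]) auto
  qed
qed

lemma quadratic_form_cong_AE:
  assumes ae: "AE x in lborel. u x = w x"
  shows "quadratic_form \<mu> D u = quadratic_form \<mu> D w"
  unfolding quadratic_form_def
proof (rule nn_integral_cong_AE)
  have "AE x in lebesgue. u x = w x" using ae by (rule AE_completion)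
  with AE_lborel_AE_mu[OF ae]
  show "AE x in lebesgue. (\<integral>\<^sup>+y\<in>D. ennreal ((u y - u x)\<^sup>2) \<partial>completion (\<mu> x)) * indicator D x =
    (\<integral>\<^sup>+y\<in>D. ennreal ((w y - w x)\<^sup>2) \<partial>completion (\<mu> x)) * indicator D x"
  proof eventually_elim
    case (elim x)
    have "(\<integral>\<^sup>+y\<in>D. ennreal ((u y - u x)\<^sup>2) \<partial>\<mu> x) = (\<integral>\<^sup>+y\<in>D. ennreal ((w y - w x)\<^sup>2) \<partial>\<mu> x)"
      using elim by (intro nn_integral_cong_AE) (auto elim: eventually_mono)
    then show ?case by (simp add: nn_integral_completion)
  qed
qed

lemma H_loc_cong_AE:
  assumes u: "u \<in> H_loc \<mu> E" and w: "w \<in> borel_measurable borel" and ae: "AE x in lborel. u x = w x"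
  shows "w \<in> H_loc \<mu> E"
  unfolding H_loc_def
proof (intro CollectI allI impI)
  fix D :: "'a set" assume D: "open D" "closure D \<subseteq> E"
  have uD: "u \<in> L2 D" "quadratic_form \<mu> D u < \<infinity>" using u D by (auto simp: H_loc_def)
  have [measurable]: "u \<in> borel_measurable (lebesgue_on D)" using uD by (simp add: L2_def)
  have "w \<in> borel_measurable lebesgue" by (rule measurable_completion) (simp add: w)
  then have [measurable]: "w \<in> borel_measurable (lebesgue_on D)" by (rule measurable_restrict_space1)
  have "AE x in lebesgue. u x = w x" using ae by (rule AE_completion)
  then have aeD: "AE x in lebesgue_on D. u x = w x"
    using D(1) by (subst AE_restrict_space_iff) (auto elim: eventually_mono)
  have "integrable (lebesgue_on D) (\<lambda>x. (u x)\<^sup>2) \<longleftrightarrow> integrable (lebesgue_on D) (\<lambda>x. (w x)\<^sup>2)"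
    by (rule integrable_cong_AE) (use aeD in \<open>auto elim: eventually_mono\<close>)
  then have "w \<in> L2 D" using uD by (simp add: L2_def)
  then show "w \<in> L2 D \<and> quadratic_form \<mu> D w < \<infinity>" using uD quadratic_form_cong_AE[OF ae] by simp
qed

lemma bilinear_form_cong_AE:
  assumes ae: "AE x in lborel. u x = w x"
  shows "bilinear_form \<mu> UNIV u \<phi> = bilinear_form \<mu> UNIV w \<phi>"
proof -
  have "AE x in lebesgue. u x = w x" using ae by (rule AE_completion)
  with AE_lborel_AE_mu[OF ae]
  have "AE x in lebesgue. (LINT y|completion (\<mu> x). (u y - u x) * (\<phi> y - \<phi> x)) = (LINT y|completion (\<mu> x). (w y - w x) * (\<phi> y - \<phi> x))"
  proof eventually_elim
    case (elim x)
    have "AE y in completion (\<mu> x). u y = w y" using elim by (intro AE_completion) auto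
    then show ?case using elim by (intro integral_completion_cong_AE) (auto elim: eventually_mono)
  qed
  then show ?thesis
    unfolding bilinear_form_def set_lebesgue_integral_def
    by (simp add: integral_completion_cong_AE)
qed

lemma nn_integral_mu_cong_AE:
  fixes f :: "real \<Rightarrow> ennreal"
  assumes ae: "AE x in lborel. u x = w x"
  shows "AE x in lebesgue. (\<integral>\<^sup>+y\<in>A. f (w y) \<partial>\<mu> x) = (\<integral>\<^sup>+y\<in>A. f (u y) \<partial>completion (\<mu> x))"
  using AE_lborel_AE_mu[OF ae]
proof eventually_elim
  case (elim x)
  have "(\<integral>\<^sup>+y\<in>A. f (w y) \<partial>\<mu> x) = (\<integral>\<^sup>+y\<in>A. f (u y) \<partial>\<mu> x)"
    using elim by (intro nn_integral_cong_AE) (auto elim: eventually_mono)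
  then show ?case by (simp add: nn_integral_completion)
qed

end

section \<open>Averages and essential infima\<close>

lemma average_powr_le:
  fixes u w :: "'a::euclidean_space \<Rightarrow> real"
  assumes r: "0 < r" and b: "0 \<le> b"
    and le: "AE x in lborel. x \<in> ball z r \<longrightarrow> u x powr e \<le> w x powr e"
    and w: "(\<integral>\<^sup>+x\<in>ball z r. ennreal (w x powr e) \<partial>lborel) \<le> ennreal (b * (unit_ball_vol (DIM('a)) * r ^ DIM('a)))"
  shows "average (ball z r) (\<lambda>x. u x powr e) \<le> b"
proof -
  let ?V = "unit_ball_vol (DIM('a)) * r ^ DIM('a)"
  have V: "0 < ?V" using r by simp
  have "(\<integral>\<^sup>+x. ennreal (indicator (ball z r) x *\<^sub>R (u x powr e)) \<partial>lebesgue) \<le> (\<integral>\<^sup>+x\<in>ball z r. ennreal (w x powr e) \<partial>lborel)"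
    unfolding nn_integral_completion using le
    by (intro nn_integral_mono_AE) (auto simp: indicator_def elim!: eventually_mono intro!: ennreal_leI)
  \<comment> \<open>\<open>integral_real_bounded\<close> also covers a non-integrable integrand,
    whose integral has the default value 0.\<close>
  then have "(LINT x:ball z r|lebesgue. u x powr e) \<le> b * ?V"
    unfolding set_lebesgue_integral_def using w b V
    by (intro integral_real_bounded) (auto intro: order_trans)
  moreover have "measure lebesgue (ball z r) = ?V" using r by (simp add: content_ball)
  ultimately show ?thesis using V by (simp add: average_def divide_le_eq)
qed

lemma average_powr_nonneg:
  fixes u :: "'a::euclidean_space \<Rightarrow> real" shows "0 \<le> average A (\<lambda>x. u x powr e)"
  unfolding average_def set_lebesgue_integral_def by (intro divide_nonneg_nonneg integral_nonneg_AE) auto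

lemma ess_inf_geI:
  assumes [measurable]: "u \<in> borel_measurable lebesgue" "B \<in> sets borel" and ae: "AE x in lborel. x \<in> B \<longrightarrow> c \<le> u x"
  shows "ereal c \<le> ess_inf B u"
proof -
  have "u \<in> borel_measurable (lebesgue_on B)" by (rule measurable_restrict_space1) simp
  then have m: "(\<lambda>x. - ereal (u x)) \<in> borel_measurable (lebesgue_on B)" by measurable
  have "AE x in lebesgue. x \<in> B \<longrightarrow> c \<le> u x" using ae by (rule AE_completion)
  then have "AE x in lebesgue_on B. - ereal (u x) \<le> - ereal c"
    by (subst AE_restrict_space_iff) (auto elim: eventually_mono)
  then have "esssup (lebesgue_on B) (\<lambda>x. - ereal (u x)) \<le> - ereal c" using m by (intro esssup_I)
  then show ?thesis unfolding ess_inf_def by (metis ereal_minus_le_minus ereal_uminus_uminus)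
qed

theorem theorem1p2:
  fixes \<alpha> C1 C2 :: real
  assumes "CARD('n::finite) \<ge> 2"
    and "0 < \<alpha>" and "\<alpha> < 2"
    and "C1 \<ge> 1" and "C2 \<ge> 1"
  shows "\<exists>\<epsilon> \<eta> :: real. 0 < \<epsilon> \<and> \<epsilon> < 1 \<and> 0 < \<eta> \<and> \<eta> < 1 \<and>
    (\<forall>(E :: (real ^ 'n) set) (\<mu> :: real ^ 'n \<Rightarrow> (real ^ 'n) measure) (x0 :: real ^ 'n) (R :: real)
        (u :: real ^ 'n \<Rightarrow> real) (r :: real).
      open E \<longrightarrow> connected E \<longrightarrow> E \<noteq> {} \<longrightarrow> bounded E \<longrightarrow>
      (\<forall>x. sets (\<mu> x) = sets borel) \<longrightarrow>
      symmetric_family \<mu> \<longrightarrow>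
      poincare_inequality \<alpha> \<mu> E C1 \<longrightarrow>
      decay_estimate \<alpha> \<mu> C2 \<longrightarrow>
      ball x0 R \<subseteq> E \<longrightarrow>
      local_weak_supersolution \<mu> E u \<longrightarrow>
      (AE x in lebesgue. x \<in> ball x0 R \<longrightarrow> 0 \<le> u x) \<longrightarrow>
      0 < r \<longrightarrow> r < R / 32 \<longrightarrow>
      ess_inf (ball x0 (2 * r)) u \<ge>
        ereal (\<eta> * (average (ball x0 r) (\<lambda>x. u x powr \<epsilon>)) powr (1 / \<epsilon>))
          - ereal ((r / R) powr \<alpha>) * enn2ereal (Tail \<alpha> \<mu> (\<lambda>y. max (- u y) 0) x0 (7 / 8 * R) R))"
proof -
  define N where "N = CARD('n)"
  define K0 where "K0 = log_const \<alpha> C1 C2 N"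
  define C4 where "C4 = oscillation_const \<alpha> C1 C2"
  define Cc where "Cc = caccioppoli_const \<alpha> C2"
  have Cc: "10 \<le> Cc" unfolding Cc_def using assms by (intro caccioppoli_const_ge)
  have C1Cc: "1 * 1 \<le> C1 * Cc" using assms Cc by (intro mult_mono) auto
  then have C4: "0 < C4" by (simp add: C4_def oscillation_const_def Cc_def)
  have K0: "0 < K0" using C4 by (simp add: K0_def log_const_def C4_def)
  obtain q where q: "0 < q" "q \<le> 1/4" "exp (2 * q * sqrt (2 * K0 * (1 + 4 ^ N))) \<le> 2" "1280 * C4 * 5 ^ N * q\<^sup>2 \<le> 1"
    by (rule exponent_exists[of "sqrt (2 * K0 * (1 + 4 ^ N))" "1280 * C4 * 5 ^ N"]) (use K0 C4 in \<open>auto simp: add_pos_pos\<close>)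
  have "1 * 1 \<le> (160 :: real) * 5 ^ N" by (intro mult_mono one_le_power) auto
  then have "1 * 1 \<le> (160 * 5 ^ N :: real) * (C1 * Cc)"
    using C1Cc mult_mono[of 1 "160 * 5 ^ N" 1 "C1 * Cc"] by simp
  then have "1 \<le> 160 * C1 * 5 ^ N * Cc" by (simp add: mult_ac)
  then obtain \<tau> \<sigma> :: real where \<tau>: "0 < \<tau>" "\<tau> \<le> 1/2" "(2 * \<tau>) powr \<alpha> = 1/4" and \<sigma>: "0 < \<sigma>" "\<sigma> \<le> 1/4"
    and G: "160 * C1 * 5 ^ N * Cc * (4 * \<sigma>) powr \<alpha> \<le> \<tau> ^ N"
    by (rule geometric_scales_exist[OF assms(2), where N=N])
  \<comment> \<open>The factor in the integral bound of \<open>weak_harnack\<close> after division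
    by the volume of the ball.\<close>
  define Q where "Q = 64 * 10 ^ N * exp (2 * q * sqrt (2 * K0))"
  have "1 * (1 * 1) \<le> 64 * (10 ^ N * exp (2 * q * sqrt (2 * K0)))"
    using q K0 by (intro mult_mono) (auto simp: one_le_exp_iff one_le_power)
  then have Q: "1 \<le> Q" by (simp add: Q_def)
  define l where "l = sqrt (2 * K0 * (4 / \<sigma>) ^ N)"
  have l: "0 \<le> l" using K0 \<sigma> by (simp add: l_def)
  define \<epsilon> where "\<epsilon> = 2 * q"
  have \<epsilon>: "0 < \<epsilon>" "\<epsilon> < 1" using q by (auto simp: \<epsilon>_def)
  \<comment> \<open>The average is at most \<open>Q * exp (\<epsilon> * c)\<close> and
    \<open>v\<close> is at least \<open>exp (c - l) / 2\<close>; raising the first to the power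
    \<open>1 / \<epsilon>\<close> and eliminating \<open>exp c\<close> gives this constant, which is
    built from \<open>C1\<close>, \<open>C2\<close>, \<open>N\<close> and \<open>\<alpha>\<close>
    alone.\<close>
  define \<eta> where "\<eta> = exp (- l) / 2 * Q powr (- (1 / \<epsilon>))"
  have "Q powr (- (1 / \<epsilon>)) \<le> Q powr 0" using Q \<epsilon> by (intro powr_mono) auto
  then have "exp (- l) * Q powr (- (1 / \<epsilon>)) \<le> 1 * 1" using l Q by (intro mult_mono) auto
  then have \<eta>: "0 < \<eta>" "\<eta> < 1" using Q by (auto simp: \<eta>_def)
  show ?thesis
  proof (rule exI[of _ \<epsilon>], rule exI[of _ \<eta>], intro conjI \<epsilon> \<eta> allI impI)
    fix E :: "(real ^ 'n) set" and \<mu> :: "real ^ 'n \<Rightarrow> (real ^ 'n) measure" and x0 :: "real ^ 'n" and R :: real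
      and u :: "real ^ 'n \<Rightarrow> real" and r :: real
    assume E: "open E" "connected E" "E \<noteq> {}" "bounded E" and sets_mu: "\<forall>x. sets (\<mu> x) = sets borel"
      and sym: "symmetric_family \<mu>" and poin: "poincare_inequality \<alpha> \<mu> E C1" and decay: "decay_estimate \<alpha> \<mu> C2"
      and ball: "ball x0 R \<subseteq> E" and sup: "local_weak_supersolution \<mu> E u"
      and nonneg: "AE x in lebesgue. x \<in> ball x0 R \<longrightarrow> 0 \<le> u x" and r: "0 < r" "r < R / 32"
    interpret nonlocal_kernel \<mu> \<alpha> C2
      by unfold_locales (use sets_mu sym decay assms in auto)
    have R: "0 < R" using r by simp
    let ?t = "Tail \<alpha> \<mu> (\<lambda>y. max (- u y) 0) x0 (7 / 8 * R) R"
    let ?a = "average (ball x0 r) (\<lambda>x. u x powr \<epsilon>)"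
    have u_leb: "u \<in> borel_measurable lebesgue" using sup by (simp add: local_weak_supersolution_def)
    obtain u0 where u0: "u0 \<in> borel_measurable lborel" "AE x in lborel. u x = u0 x"
      using completion_ex_borel_measurable_real[OF u_leb] by blast
    \<comment> \<open>The representative \<open>u0\<close> is non-negative on the ball only almost
      everywhere, while the locale asks for every point, hence the truncation.\<close>
    define w where "w x = (if x \<in> ball x0 R then max (u0 x) 0 else u0 x)" for x
    have [measurable]: "u0 \<in> borel_measurable borel" using u0(1) by simp
    have w[measurable]: "w \<in> borel_measurable borel" unfolding w_def[abs_def] by measurable
    have nonneg': "AE x in lborel. x \<in> ball x0 R \<longrightarrow> 0 \<le> u x"
      using nonneg by (simp add: AE_completion_iff)
    have uw: "AE x in lborel. u x = w x"
      using u0(2) nonneg' by eventually_elim (auto simp: w_def max_def simp del: mem_ball)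
    show "ereal (\<eta> * ?a powr (1 / \<epsilon>)) - ereal ((r / R) powr \<alpha>) * enn2ereal ?t \<le> ess_inf (ball x0 (2 * r)) u"
    proof (cases "?t = \<infinity>")
      \<comment> \<open>An infinite tail has the positive coefficient
        \<open>(r / R) powr \<alpha>\<close>, so the claimed lower bound is minus infinity.\<close>
      case True
      then show ?thesis using r R by simp
    next
      case False
      define t where "t = enn2real ?t"
      have t: "?t = ennreal t" "0 \<le> t" using False by (auto simp: t_def less_top)
      define p where "p = (r / R) powr \<alpha> * t"
      have main: "AE x in lborel. x \<in> ball x0 (2 * r) \<longrightarrow> \<eta> * ?a powr (1 / \<epsilon>) - p - e \<le> u x" if e: "0 < e" for e
      proof -
        \<comment> \<open>The summand \<open>e\<close> keeps \<open>d\<close> positive even if the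
          tail vanishes. It is sent to 0 along \<open>1 / Suc n\<close> at the end, so the tail
          retains its exact coefficient.\<close>
        define d where "d = p + e"
        have d: "0 < d" using e t by (simp add: d_def p_def add_nonneg_pos)
        let ?S = "\<lambda>A B. SUP x\<in>A. \<integral>\<^sup>+y\<in>- B. ennreal \<bar>u y\<bar> \<partial>completion (\<mu> x)"
        have half_pos: "0 < R / 2" using R by simp
        \<comment> \<open>The finiteness condition is taken at radius \<open>R / 2\<close>: the
          closure of that ball lies in \<open>E\<close>, so \<open>u\<close> has finite energy
          there. Then \<open>7 / 8 * (R / 2) = 7 / 16 * R\<close> is the radius in the
          locale.\<close>
        have "ball x0 (R / 2) \<subseteq> E" using ball R by (auto simp: subset_eq)
        then have S: "?S (ball x0 (7 / 8 * (R / 2))) (ball x0 (R / 2)) < \<infinity>"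
          using sup half_pos unfolding local_weak_supersolution_def by blast
        define K where "K = enn2real (?S (ball x0 (7 / 8 * (R / 2))) (ball x0 (R / 2)))"
        have K: "?S (ball x0 (7 / 8 * (R / 2))) (ball x0 (R / 2)) = ennreal K"
          using S by (simp add: K_def)
        have outer: "AE x in lebesgue. x \<in> ball x0 (7 / 16 * R) \<longrightarrow> (\<integral>\<^sup>+y\<in>- ball x0 (R / 2). ennreal \<bar>w y\<bar> \<partial>\<mu> x) \<le> ennreal K"
          using nn_integral_mu_cong_AE[OF uw, where A="- ball x0 (R / 2)" and f="\<lambda>s. ennreal \<bar>s\<bar>"]
        proof eventually_elim
          case (elim x)
          then show ?case unfolding K[symmetric] by (auto intro!: SUP_upper simp del: mem_ball simp: mult.commute)
        qed
        have neg: "AE x in lebesgue. x \<in> ball x0 (7 / 16 * R) \<longrightarrow>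
          (\<integral>\<^sup>+y\<in>- ball x0 R. ennreal (max (- w y) 0) \<partial>\<mu> x) \<le> ennreal (d * r powr (- \<alpha>))"
          using nn_integral_mu_cong_AE[OF uw, where A="- ball x0 R" and f="\<lambda>s. ennreal (max (- s) 0)"]
        proof eventually_elim
          case (elim x)
          show ?case
          proof
            assume "x \<in> ball x0 (7 / 16 * R)"
            then have x: "x \<in> ball x0 (7 / 8 * R)" using R by auto
            let ?I = "\<integral>\<^sup>+y\<in>- ball x0 R. ennreal (max (- u y) 0) \<partial>completion (\<mu> x)"
            have "ennreal (R powr \<alpha>) * ?I \<le> ?t"
              unfolding Tail_def using x by (intro mult_left_mono SUP_upper) auto
            then have "?I \<le> ennreal (t / R powr \<alpha>)" unfolding t(1) by (rule ennreal_le_divide[rotated]) (use R in simp)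
            also have "\<dots> \<le> ennreal (d * r powr (- \<alpha>))"
            proof (rule ennreal_leI)
              have "t / R powr \<alpha> = p * r powr (- \<alpha>)"
                using r R by (simp add: p_def powr_divide powr_minus field_simps)
              also have "\<dots> \<le> d * r powr (- \<alpha>)" using e by (intro mult_right_mono) (auto simp: d_def)
              finally show "t / R powr \<alpha> \<le> d * r powr (- \<alpha>)" .
            qed
            finally show "(\<integral>\<^sup>+y\<in>- ball x0 R. ennreal (max (- w y) 0) \<partial>\<mu> x) \<le> ennreal (d * r powr (- \<alpha>))"
              using elim by simp
          qed
        qed
        interpret W: weak_supersolution \<mu> \<alpha> C2 C1 E w x0 R r d K N
        proof unfold_locales
          show "N = DIM(real ^ 'n)" by (simp add: N_def)
          show "w \<in> H_loc \<mu> E" using sup by (intro H_loc_cong_AE[OF _ w uw]) (simp add: local_weak_supersolution_def)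
          show "0 \<le> w x" if "x \<in> ball x0 R" for x using that by (simp add: w_def)
          show "0 \<le> bilinear_form \<mu> UNIV w \<phi>" if "\<phi> \<in> H_space \<mu>" "\<And>x. 0 \<le> \<phi> x" "closure {x. \<phi> x \<noteq> 0} \<subseteq> E" for \<phi>
            using sup that unfolding local_weak_supersolution_def bilinear_form_cong_AE[OF uw, symmetric] by blast
        qed (use E ball assms poin w r d outer neg in auto)
        obtain c where c: "(\<integral>\<^sup>+x\<in>ball x0 r. ennreal (W.v x powr (2 * q)) \<partial>lborel) \<le>
            ennreal (64 * 10 ^ N * exp (2 * q * sqrt (2 * K0)) * exp (2 * q * c) * (unit_ball_vol N * r ^ N))"
          "AE x in lborel. x \<in> ball x0 (2 * r) \<longrightarrow> exp (c - l) / 2 \<le> W.v x"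
          by (rule W.weak_harnack[of q \<tau> \<sigma>, folded K0_def C4_def Cc_def, folded l_def, OF q \<tau> \<sigma> G])
        have avg: "?a \<le> Q * exp (\<epsilon> * c)"
        proof (rule average_powr_le[OF r(1)])
          show "(\<integral>\<^sup>+x\<in>ball x0 r. ennreal (W.v x powr \<epsilon>) \<partial>lborel) \<le> ennreal (Q * exp (\<epsilon> * c) * (unit_ball_vol (DIM(real ^ 'n)) * r ^ DIM(real ^ 'n)))"
            using c(1) by (simp add: Q_def \<epsilon>_def N_def)
          have sub: "ball x0 r \<subseteq> ball x0 R" using r by (intro subset_ball) simp
          show "AE x in lborel. x \<in> ball x0 r \<longrightarrow> u x powr \<epsilon> \<le> W.v x powr \<epsilon>"
            using uw nonneg'
          proof eventually_elim
            case (elim x)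
            show ?case
            proof
              assume "x \<in> ball x0 r"
              then have xR: "x \<in> ball x0 R" using sub by blast
              then have "W.v x = u x + d" using elim W.v_eq by simp
              then show "u x powr \<epsilon> \<le> W.v x powr \<epsilon>" using elim xR d \<epsilon> by (intro powr_mono2) auto
            qed
          qed
        qed (use Q in simp)
        have "?a powr (1 / \<epsilon>) \<le> (Q * exp (\<epsilon> * c)) powr (1 / \<epsilon>)"
          using avg \<epsilon> average_powr_nonneg by (intro powr_mono2) auto
        also have "\<dots> = Q powr (1 / \<epsilon>) * exp c" using Q \<epsilon> by (simp add: powr_mult exp_powr_real)
        finally have "\<eta> * ?a powr (1 / \<epsilon>) \<le> \<eta> * (Q powr (1 / \<epsilon>) * exp c)" using \<eta> by (intro mult_left_mono) auto
        also have "\<dots> = exp (c - l) / 2" using Q by (simp add: \<eta>_def powr_minus exp_diff exp_minus field_simps)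
        finally have le: "\<eta> * ?a powr (1 / \<epsilon>) \<le> exp (c - l) / 2" .
        have sub: "ball x0 (2 * r) \<subseteq> ball x0 R" using r by (intro subset_ball) simp
        show ?thesis using c(2) uw
        proof eventually_elim
          case (elim x)
          show ?case
          proof
            assume x: "x \<in> ball x0 (2 * r)"
            then have "W.v x = u x + d" using elim sub W.v_eq by force
            then show "\<eta> * ?a powr (1 / \<epsilon>) - p - e \<le> u x" using elim x le by (simp add: d_def)
          qed
        qed
      qed
      have "AE x in lborel. \<forall>n. x \<in> ball x0 (2 * r) \<longrightarrow> \<eta> * ?a powr (1 / \<epsilon>) - p - 1 / real (Suc n) \<le> u x"
        unfolding AE_all_countable by (intro allI main) simp
      then have "AE x in lborel. x \<in> ball x0 (2 * r) \<longrightarrow> \<eta> * ?a powr (1 / \<epsilon>) - p \<le> u x"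
      proof eventually_elim
        case (elim x)
        show ?case
        proof
          assume "x \<in> ball x0 (2 * r)"
          then have n: "\<eta> * ?a powr (1 / \<epsilon>) - p - 1 / real (Suc n) \<le> u x" for n using elim by blast
          show "\<eta> * ?a powr (1 / \<epsilon>) - p \<le> u x"
          proof (rule field_le_epsilon)
            fix e :: real assume "0 < e"
            then obtain n where "1 / real (Suc n) < e" using nat_approx_posE by blast
            with n[of n] show "\<eta> * ?a powr (1 / \<epsilon>) - p \<le> u x + e" by simp
          qed
        qed
      qed
      then have "ereal (\<eta> * ?a powr (1 / \<epsilon>) - p) \<le> ess_inf (ball x0 (2 * r)) u"
        by (rule ess_inf_geI[OF u_leb ball_borel])
      then show ?thesis using t by (simp add: p_def)
    qed
  qed
qed

end
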